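(* Let $R$ be the homogeneous coordinate ring of a $0$-dimensional scheme $\mathbb{X}$ in $\mathbb{P}^n$ (setting and notation as in the context). Then: (a) The map $\psi:R\to S[x_0]$ given by $\psi(f)=f^{\rm deh}x_0^d$ for $f\in R_d$ is an injective graded $K[x_0]$-algebra homomorphism. (b) For $i\ge r_{\mathbb{X}}$, the map $\psi_i:R_i\to Sx_0^i$ is an isomorphism of $K$-vector spaces. (c) The subring $\widetilde{R}$ of $Q^h(R)$ generated by all homogeneous elements of non-negative degree satisfies $\widetilde{R}\cong S[x_0]$ and is contained in the integral closure of $R$ in $Q^h(R)$. (d) The ring $\widetilde{R}$ is the integral closure of $R$ in $Q^h(R)$ if and only if $S$ is a reduced ring.
   Context: Let $K$ be a perfect field, $n\ge 1$, $P=K[X_0,\dots,X_n]$ with the standard grading, and $\mathbb{X}\subseteq\mathbb{P}^n$ a $0$-dimensional subscheme over $K$ with saturated homogeneous vanishing ideal $I_{\mathbb{X}}$. Put $R=P/I_{\mathbb{X}}$ and let $x_i$ be the image of $X_i$ in $R$. Assume no point of the support of $\mathbb{X}$ lies on the hyperplane $X_0=0$; then $x_0$ is a non-zerodivisor of $R$. Let $S=R/\langle x_0-1\rangle$ (a finite dimensional $K$-algebra), and let $f^{\rm deh}\in S$ be the image of $f\in R$. In $S[x_0]$, $S$ has degree $0$ and $x_0$ is an indeterminate of degree $1$. Let $\mathrm{HF}_{\mathbb{X}}(i)=\dim_K R_i$, $\deg(\mathbb{X})=\dim_K S$ its value for $i\gg0$, and $r_{\mathbb{X}}$ the least integer with $\mathrm{HF}_{\mathbb{X}}(i)=\deg(\mathbb{X})$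 for all $i\ge r_{\mathbb{X}}$. The homogeneous ring of quotients of $R$ is the graded $K$-algebra $Q^h(R)=\{a/b\mid a,b\in R,\ b\text{ homogeneous non-zerodivisor}\}$. *)

theory Defs
  imports "HOL-Algebra.Algebra" "HOL-Algebra.Algebraic_Closure_Type" "HOL-Library.Poly_Mapping"
begin

definition perfect_field :: "'k::field itself \<Rightarrow> bool" where
  "perfect_field _ \<longleftrightarrow> CHAR('k) = 0 \<or> (\<forall>a::'k. \<exists>b. b ^ CHAR('k) = a)"


section \<open>The graded ring $P = K[X_0,\dots,X_n]$\<close>

text \<open>
  Monomials are finitely supported exponent vectors over \<^typ>\<open>nat\<close>; $P$ is the subring of
  those polynomials in which only the indeterminates with index at most $n$ occur.
\<close>

type_synonym 'k mpoly = "(nat \<Rightarrow>\<^sub>0 nat) \<Rightarrow>\<^sub>0 'k"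

definition mdeg :: "(nat \<Rightarrow>\<^sub>0 nat) \<Rightarrow> nat" where
  "mdeg m = (\<Sum>i\<in>Poly_Mapping.keys m. Poly_Mapping.lookup m i)"

definition Var :: "nat \<Rightarrow> 'k::field mpoly" where
  "Var i = Poly_Mapping.single (Poly_Mapping.single i 1) 1"

definition Const :: "'k::field \<Rightarrow> 'k mpoly" where
  "Const c = Poly_Mapping.single 0 c"

definition mpoly_ring :: "nat \<Rightarrow> 'k::field mpoly ring" where
  "mpoly_ring n = (ring_of_type_algebra :: 'k mpoly ring)
     \<lparr>carrier := {p. \<forall>m\<in>Poly_Mapping.keys p. Poly_Mapping.keys m \<subseteq> {..n}}\<rparr>"

definition forms :: "nat \<Rightarrow> nat \<Rightarrow> 'k::field mpoly set" where
  "forms n d = {p \<in> carrier (mpoly_ring n). \<forall>m\<in>Poly_Mapping.keys p. mdeg m = d}"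

definition hom_component :: "nat \<Rightarrow> 'k::field mpoly \<Rightarrow> 'k mpoly" where
  "hom_component d p = Poly_Mapping.mapp (\<lambda>m c. if mdeg m = d then c else 0) p"

definition homogeneous_ideal :: "nat \<Rightarrow> 'k::field mpoly set \<Rightarrow> bool" where
  "homogeneous_ideal n I \<longleftrightarrow>
     ideal I (mpoly_ring n) \<and> (\<forall>p\<in>I. \<forall>d. hom_component d p \<in> I)"

text \<open>
  The forms of degree $k$ generate the $k$-th power of the irrelevant ideal $\mathfrak m$, so this
  is $I :_P \mathfrak m^\infty \subseteq I$.
\<close>

definition saturated :: "nat \<Rightarrow> 'k::field mpoly set \<Rightarrow> bool" where
  "saturated n I \<longleftrightarrow>
     (\<forall>f\<in>carrier (mpoly_ring n). (\<exists>k. \<forall>g\<in>forms n k. g * f \<in> I) \<longrightarrow> f \<in> I)"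


section \<open>The subscheme of $\mathbb P^n$ defined by $I$\<close>

definition scheme_points :: "nat \<Rightarrow> 'k::field mpoly set \<Rightarrow> 'k mpoly set set" where
  "scheme_points n I = {p. primeideal p (mpoly_ring n) \<and> homogeneous_ideal n p \<and>
      I \<subseteq> p \<and> (\<exists>i\<le>n. Var i \<notin> p)}"

definition point_chain :: "nat \<Rightarrow> 'k::field mpoly set \<Rightarrow> nat \<Rightarrow> bool" where
  "point_chain n I k \<longleftrightarrow>
     (\<exists>c. (\<forall>i\<le>k. c i \<in> scheme_points n I) \<and> (\<forall>i<k. c i \<subset> c (Suc i)))"

text \<open>The empty scheme has no dimension in this sense.\<close>

definition scheme_has_dim :: "nat \<Rightarrow> 'k::field mpoly set \<Rightarrow> nat \<Rightarrow> bool" where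
  "scheme_has_dim n I d \<longleftrightarrow> point_chain n I d \<and> (\<forall>k. point_chain n I k \<longrightarrow> k \<le> d)"


section \<open>The rings $R$, $S$ and $S[x_0]$\<close>

definition coord_ring :: "nat \<Rightarrow> 'k::field mpoly set \<Rightarrow> 'k mpoly set ring" where
  "coord_ring n I = mpoly_ring n Quot I"

definition coord_class :: "nat \<Rightarrow> 'k::field mpoly set \<Rightarrow> 'k mpoly \<Rightarrow> 'k mpoly set" where
  "coord_class n I p = I +>\<^bsub>mpoly_ring n\<^esub> p"

definition coord_part :: "nat \<Rightarrow> 'k::field mpoly set \<Rightarrow> nat \<Rightarrow> 'k mpoly set set" where
  "coord_part n I d = coord_class n I ` forms n d"

text \<open>
  Homogeneous components in $R$. For a homogeneous ideal all the cosets in this union coincide.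
\<close>

definition coord_component ::
    "nat \<Rightarrow> 'k::field mpoly set \<Rightarrow> nat \<Rightarrow> 'k mpoly set \<Rightarrow> 'k mpoly set" where
  "coord_component n I d f = (\<Union>p\<in>f. coord_class n I (hom_component d p))"

definition coord_const :: "nat \<Rightarrow> 'k::field mpoly set \<Rightarrow> 'k \<Rightarrow> 'k mpoly set" where
  "coord_const n I c = coord_class n I (Const c)"

definition x0 :: "nat \<Rightarrow> 'k::field mpoly set \<Rightarrow> 'k mpoly set" where
  "x0 n I = coord_class n I (Var 0)"

definition deh_ideal :: "nat \<Rightarrow> 'k::field mpoly set \<Rightarrow> 'k mpoly set set" where
  "deh_ideal n I = PIdl\<^bsub>coord_ring n I\<^esub> (x0 n I \<ominus>\<^bsub>coord_ring n I\<^esub> \<one>\<^bsub>coord_ring n I\<^esub>)"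

definition deh_ring :: "nat \<Rightarrow> 'k::field mpoly set \<Rightarrow> 'k mpoly set set ring" where
  "deh_ring n I = coord_ring n I Quot deh_ideal n I"

definition deh :: "nat \<Rightarrow> 'k::field mpoly set \<Rightarrow> 'k mpoly set \<Rightarrow> 'k mpoly set set" where
  "deh n I f = deh_ideal n I +>\<^bsub>coord_ring n I\<^esub> f"

definition deh_const :: "nat \<Rightarrow> 'k::field mpoly set \<Rightarrow> 'k \<Rightarrow> 'k mpoly set set" where
  "deh_const n I c = deh n I (coord_const n I c)"

abbreviation Sx0 :: "nat \<Rightarrow> 'k::field mpoly set \<Rightarrow>
    ('k mpoly set set, nat \<Rightarrow> 'k mpoly set set) up_ring" where
  "Sx0 n I \<equiv> UP (deh_ring n I)"

definition Sx0_part :: "nat \<Rightarrow> 'k::field mpoly set \<Rightarrow> nat \<Rightarrow> (nat \<Rightarrow> 'k mpoly set set) set" where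
  "Sx0_part n I d = (\<lambda>s. up_ring.monom (Sx0 n I) s d) ` carrier (deh_ring n I)"

definition Sx0_const :: "nat \<Rightarrow> 'k::field mpoly set \<Rightarrow> 'k \<Rightarrow> nat \<Rightarrow> 'k mpoly set set" where
  "Sx0_const n I c = up_ring.monom (Sx0 n I) (deh_const n I c) 0"

text \<open>
  Elements of \<^term>\<open>carrier (UP S)\<close> are coefficient functions, so this is
  $\psi(f) = \sum_d (f_d)^{\rm deh} x_0^d$ where $f_d$ is the degree $d$ component of $f$.
\<close>

definition psi :: "nat \<Rightarrow> 'k::field mpoly set \<Rightarrow> 'k mpoly set \<Rightarrow> nat \<Rightarrow> 'k mpoly set set" where
  "psi n I f = (\<lambda>d. deh n I (coord_component n I d f))"


section \<open>Hilbert function, degree, regularity index\<close>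

definition HF :: "nat \<Rightarrow> 'k::field mpoly set \<Rightarrow> nat \<Rightarrow> nat" where
  "HF n I i = ring.dim (coord_ring n I) (range (coord_const n I)) (coord_part n I i)"

definition scheme_degree :: "nat \<Rightarrow> 'k::field mpoly set \<Rightarrow> nat" where
  "scheme_degree n I =
     ring.dim (deh_ring n I) (range (deh_const n I)) (carrier (deh_ring n I))"

definition reg_index :: "nat \<Rightarrow> 'k::field mpoly set \<Rightarrow> nat" where
  "reg_index n I = (LEAST r. \<forall>i\<ge>r. HF n I i = scheme_degree n I)"


section \<open>Homogeneous ring of quotients\<close>

definition hom_nzd :: "nat \<Rightarrow> 'k::field mpoly set \<Rightarrow> 'k mpoly set set" where
  "hom_nzd n I = {b \<in> (\<Union>d. coord_part n I d). \<forall>a\<in>carrier (coord_ring n I).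
      a \<otimes>\<^bsub>coord_ring n I\<^esub> b = \<zero>\<^bsub>coord_ring n I\<^esub> \<longrightarrow> a = \<zero>\<^bsub>coord_ring n I\<^esub>}"

text \<open>
  The fraction $a/b$ is an equivalence class of pairs. All denominators are non-zerodivisors, so
  cross-multiplication is the usual equivalence of fractions.
\<close>

definition hfrac :: "nat \<Rightarrow> 'k::field mpoly set \<Rightarrow> 'k mpoly set \<Rightarrow> 'k mpoly set \<Rightarrow>
    ('k mpoly set \<times> 'k mpoly set) set" where
  "hfrac n I a b = {(c, d). c \<in> carrier (coord_ring n I) \<and> d \<in> hom_nzd n I \<and>
      a \<otimes>\<^bsub>coord_ring n I\<^esub> d = c \<otimes>\<^bsub>coord_ring n I\<^esub> b}"

definition hquot_ring :: "nat \<Rightarrow> 'k::field mpoly set \<Rightarrow>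
    ('k mpoly set \<times> 'k mpoly set) set ring" where
  "hquot_ring n I =
    \<lparr>carrier = {hfrac n I a b | a b. a \<in> carrier (coord_ring n I) \<and> b \<in> hom_nzd n I},
     monoid.mult = (\<lambda>u v. \<Union>(a, b)\<in>u. \<Union>(c, d)\<in>v.
       hfrac n I (a \<otimes>\<^bsub>coord_ring n I\<^esub> c) (b \<otimes>\<^bsub>coord_ring n I\<^esub> d)),
     monoid.one = hfrac n I \<one>\<^bsub>coord_ring n I\<^esub> \<one>\<^bsub>coord_ring n I\<^esub>,
     ring.zero = hfrac n I \<zero>\<^bsub>coord_ring n I\<^esub> \<one>\<^bsub>coord_ring n I\<^esub>,
     ring.add = (\<lambda>u v. \<Union>(a, b)\<in>u. \<Union>(c, d)\<in>v.
       hfrac n I ((a \<otimes>\<^bsub>coord_ring n I\<^esub> d) \<oplus>\<^bsub>coord_ring n I\<^esub> (c \<otimes>\<^bsub>coord_ring n I\<^esub> b))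
         (b \<otimes>\<^bsub>coord_ring n I\<^esub> d))\<rparr>"

definition hquot_embed :: "nat \<Rightarrow> 'k::field mpoly set \<Rightarrow> 'k mpoly set \<Rightarrow>
    ('k mpoly set \<times> 'k mpoly set) set" where
  "hquot_embed n I f = hfrac n I f \<one>\<^bsub>coord_ring n I\<^esub>"

definition hquot_part :: "nat \<Rightarrow> 'k::field mpoly set \<Rightarrow> int \<Rightarrow>
    ('k mpoly set \<times> 'k mpoly set) set set" where
  "hquot_part n I k = {hfrac n I a b | a b i j.
      a \<in> coord_part n I i \<and> b \<in> hom_nzd n I \<inter> coord_part n I j \<and> k = int i - int j}"

definition R_tilde :: "nat \<Rightarrow> 'k::field mpoly set \<Rightarrow>
    ('k mpoly set \<times> 'k mpoly set) set set" where
  "R_tilde n I = generate_ring (hquot_ring n I) (\<Union>k\<in>{0..}. hquot_part n I k)"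

definition R_tilde_ring :: "nat \<Rightarrow> 'k::field mpoly set \<Rightarrow>
    ('k mpoly set \<times> 'k mpoly set) set ring" where
  "R_tilde_ring n I = (hquot_ring n I)\<lparr>carrier := R_tilde n I\<rparr>"

definition R_tilde_part :: "nat \<Rightarrow> 'k::field mpoly set \<Rightarrow> nat \<Rightarrow>
    ('k mpoly set \<times> 'k mpoly set) set set" where
  "R_tilde_part n I d = R_tilde n I \<inter> hquot_part n I (int d)"


section \<open>The $K[x_0]$-algebra structures\<close>

abbreviation Kx0 :: "'k::field itself \<Rightarrow> ('k, nat \<Rightarrow> 'k) up_ring" where
  "Kx0 _ \<equiv> UP (ring_of_type_algebra :: 'k ring)"

text \<open>
  An algebra over $K[x_0]$ is given by its structure homomorphism. On $R$ and on $S[x_0]$ it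
  extends $K \to R$ and $K \to S[x_0]$ by sending the indeterminate to $x_0$.
\<close>

definition coord_struct :: "nat \<Rightarrow> 'k::field mpoly set \<Rightarrow> (nat \<Rightarrow> 'k) \<Rightarrow> 'k mpoly set" where
  "coord_struct n I =
     UnivPoly.eval (ring_of_type_algebra :: 'k ring) (coord_ring n I) (coord_const n I) (x0 n I)"

definition Sx0_struct ::
    "nat \<Rightarrow> 'k::field mpoly set \<Rightarrow> (nat \<Rightarrow> 'k) \<Rightarrow> nat \<Rightarrow> 'k mpoly set set" where
  "Sx0_struct n I = UnivPoly.eval (ring_of_type_algebra :: 'k ring) (Sx0 n I) (Sx0_const n I)
     (up_ring.monom (Sx0 n I) \<one>\<^bsub>deh_ring n I\<^esub> 1)"

definition R_tilde_struct :: "nat \<Rightarrow> 'k::field mpoly set \<Rightarrow> (nat \<Rightarrow> 'k) \<Rightarrow>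
    ('k mpoly set \<times> 'k mpoly set) set" where
  "R_tilde_struct n I p = hquot_embed n I (coord_struct n I p)"

definition graded_algebra_hom ::
    "('c, 'm) ring_scheme \<Rightarrow>
     ('a, 'p) ring_scheme \<Rightarrow> ('c \<Rightarrow> 'a) \<Rightarrow> (nat \<Rightarrow> 'a set) \<Rightarrow>
     ('b, 'q) ring_scheme \<Rightarrow> ('c \<Rightarrow> 'b) \<Rightarrow> (nat \<Rightarrow> 'b set) \<Rightarrow> ('a \<Rightarrow> 'b) \<Rightarrow> bool" where
  "graded_algebra_hom C A \<alpha> GA B \<beta> GB h \<longleftrightarrow>
     h \<in> ring_hom A B \<and> (\<forall>c\<in>carrier C. h (\<alpha> c) = \<beta> c) \<and> (\<forall>d. h ` GA d \<subseteq> GB d)"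


section \<open>Linear isomorphisms, integral closure, reducedness\<close>

text \<open>
  $V \subseteq A$ and $W \subseteq B$ are $K$-subspaces of rings with structure maps $\alpha$, $\beta$.
\<close>

definition vector_space_iso ::
    "('a, 'p) ring_scheme \<Rightarrow> ('k \<Rightarrow> 'a) \<Rightarrow> 'a set \<Rightarrow>
     ('b, 'q) ring_scheme \<Rightarrow> ('k \<Rightarrow> 'b) \<Rightarrow> 'b set \<Rightarrow> ('a \<Rightarrow> 'b) \<Rightarrow> bool" where
  "vector_space_iso A \<alpha> V B \<beta> W h \<longleftrightarrow>
     bij_betw h V W \<and>
     (\<forall>u\<in>V. \<forall>v\<in>V. h (u \<oplus>\<^bsub>A\<^esub> v) = h u \<oplus>\<^bsub>B\<^esub> h v) \<and>
     (\<forall>c. \<forall>v\<in>V. h (\<alpha> c \<otimes>\<^bsub>A\<^esub> v) = \<beta> c \<otimes>\<^bsub>B\<^esub> h v)"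

definition integral_closure :: "('a, 'm) ring_scheme \<Rightarrow> 'a set \<Rightarrow> 'a set" where
  "integral_closure Q A = {z \<in> carrier Q. \<exists>m a. a \<in> {..<m} \<rightarrow> A \<and>
      z [^]\<^bsub>Q\<^esub> (m::nat) \<oplus>\<^bsub>Q\<^esub> (\<Oplus>\<^bsub>Q\<^esub>i\<in>{..<m}. a i \<otimes>\<^bsub>Q\<^esub> z [^]\<^bsub>Q\<^esub> i) = \<zero>\<^bsub>Q\<^esub>}"

definition reduced_ring :: "('a, 'm) ring_scheme \<Rightarrow> bool" where
  "reduced_ring A \<longleftrightarrow>
     (\<forall>s\<in>carrier A. \<forall>k::nat. s [^]\<^bsub>A\<^esub> k = \<zero>\<^bsub>A\<^esub> \<longrightarrow> s = \<zero>\<^bsub>A\<^esub>)"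

end

(*
  The forms of degree k lie in a homogeneous ideal J for large k as soon as J has no points: a
  homogeneous ideal maximal among those avoiding the powers of X_i is prime. For J = (I : f) with
  X_0 f in I this shows, with saturatedness, that x_0 is a non-zerodivisor of R; for J = I + (X_0) it
  shows R_{d+1} = x_0 R_d for d >= k_0. Hence dehomogenization is injective on every R_d and maps
  R_d onto S for d >= k_0, so S is finite-dimensional, psi is injective, and x_0^{k_0} S[x_0] is
  contained in psi(R).

  For a homogeneous non-zerodivisor b of R of degree j, b^deh is a non-zerodivisor of a
  finite-dimensional algebra, hence a unit, and psi(b) = b^deh x_0^j. So Q^h(R) is S[x_0, 1/x_0], and
  the elements of R~ are the fractions psi^{-1}(x_0^{k_0} F) / x_0^{k_0} with F in S[x_0].

  F is integral over R: S[x_0] / x_0^{2 k_0 + 1} S[x_0] is finite-dimensional, so F satisfies a monic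
  equation over K modulo x_0^{k_0} S[x_0], and the defect can be absorbed into the constant
  coefficient. If S is reduced, the lowest term of a Laurent polynomial with a pole rules out any
  integral equation; conversely s / x_0 is integral for nilpotent s.
*)
theory Submission
  imports Defs
begin

section \<open>Graded polynomials\<close>

text \<open>Points are homogeneous primes without coordinates, as K need not be algebraically
  closed. The hypothesis on X_0 enters through one fact: an ideal containing I and X_0 has no
  points.

  Two degrees must be kept apart. r_X is defined by the Hilbert function alone, whereas R_d -> S is
  first known to be onto for d >= k_0, a degree from which x_0 R_d = R_{d+1}. The existence of k_0
  makes the Hilbert function eventually equal to dim S, so that r_X is well defined; for i >= r_X
  the injective image of R_i in S has full dimension and is therefore S. This gives (b), while the
  constructions for (c) and (d) work with k_0 throughout.

  S[x_0, 1/x_0] is never constructed. Since x_0^{k_0} moves S[x_0] into psi(R), every F is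
  represented with the one denominator x_0^{k_0}, and a pole is measured by the least power of x_0
  that moves an element of Q^h(R) into the image of S[x_0]. Identities between forms of equal degree
  are checked in S, where x_0 becomes 1.\<close>

lemma mpoly_ring_simps [simp]:
  "monoid.mult (mpoly_ring n :: 'k::field mpoly ring) = (\<lambda>p q. p * q)"
  "monoid.one (mpoly_ring n :: 'k mpoly ring) = 1"
  "ring.zero (mpoly_ring n :: 'k mpoly ring) = 0"
  "ring.add (mpoly_ring n :: 'k mpoly ring) = (\<lambda>p q. p + q)"
  by (simp_all add: mpoly_ring_def ring_of_type_algebra_def)

lemma mem_mpoly_ring:
  "p \<in> carrier (mpoly_ring n) \<longleftrightarrow> (\<forall>m\<in>Poly_Mapping.keys p. Poly_Mapping.keys m \<subseteq> {..n})"
  by (simp add: mpoly_ring_def)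

lemma mpoly_ring_closed [simp]:
  fixes p q :: "'k::field mpoly"
  shows "0 \<in> carrier (mpoly_ring n :: 'k mpoly ring)"
    and "1 \<in> carrier (mpoly_ring n :: 'k mpoly ring)"
    and "p \<in> carrier (mpoly_ring n) \<Longrightarrow> q \<in> carrier (mpoly_ring n) \<Longrightarrow> p + q \<in> carrier (mpoly_ring n)"
    and "p \<in> carrier (mpoly_ring n) \<Longrightarrow> - p \<in> carrier (mpoly_ring n)"
    and "p \<in> carrier (mpoly_ring n) \<Longrightarrow> q \<in> carrier (mpoly_ring n) \<Longrightarrow> p - q \<in> carrier (mpoly_ring n)"
    and "p \<in> carrier (mpoly_ring n) \<Longrightarrow> q \<in> carrier (mpoly_ring n) \<Longrightarrow> p * q \<in> carrier (mpoly_ring n)"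
proof -
  show "0 \<in> carrier (mpoly_ring n :: 'k mpoly ring)" "1 \<in> carrier (mpoly_ring n :: 'k mpoly ring)"
    by (simp_all add: mem_mpoly_ring)
  show neg: "- p \<in> carrier (mpoly_ring n)" if "p \<in> carrier (mpoly_ring n)" for p :: "'k mpoly"
    using that by (simp add: mem_mpoly_ring in_keys_iff)
  show add: "p + q \<in> carrier (mpoly_ring n)"
    if "p \<in> carrier (mpoly_ring n)" "q \<in> carrier (mpoly_ring n)" for p q :: "'k mpoly"
    using that Poly_Mapping.keys_add[of p q] unfolding mem_mpoly_ring by blast
  show "p - q \<in> carrier (mpoly_ring n)"
    if "p \<in> carrier (mpoly_ring n)" "q \<in> carrier (mpoly_ring n)"
    using add[OF that(1) neg[OF that(2)]] by simp
  show "p * q \<in> carrier (mpoly_ring n)"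
    if "p \<in> carrier (mpoly_ring n)" "q \<in> carrier (mpoly_ring n)"
    unfolding mem_mpoly_ring
  proof
    fix m assume "m \<in> Poly_Mapping.keys (p * q)"
    then obtain a b where "m = a + b" "a \<in> Poly_Mapping.keys p" "b \<in> Poly_Mapping.keys q"
      using keys_mult[of p q] by blast
    then show "Poly_Mapping.keys m \<subseteq> {..n}"
      using that Poly_Mapping.keys_add[of a b] unfolding mem_mpoly_ring by blast
  qed
qed

lemma mpoly_ring_sum_closed [simp]:
  "(\<And>i. i \<in> A \<Longrightarrow> f i \<in> carrier (mpoly_ring n)) \<Longrightarrow> sum f A \<in> carrier (mpoly_ring n)"
  by (induction A rule: infinite_finite_induct) auto

lemma mpoly_ring_power_closed [simp]:
  "p \<in> carrier (mpoly_ring n) \<Longrightarrow> p ^ e \<in> carrier (mpoly_ring n)"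
  by (induction e) auto

lemma cring_mpoly_ring: "cring (mpoly_ring n :: 'k::field mpoly ring)"
proof (rule cringI)
  show "abelian_group (mpoly_ring n :: 'k mpoly ring)"
  proof (rule abelian_groupI)
    show "\<exists>y\<in>carrier (mpoly_ring n). y \<oplus>\<^bsub>mpoly_ring n\<^esub> x = \<zero>\<^bsub>mpoly_ring n\<^esub>"
      if "x \<in> carrier (mpoly_ring n)" for x :: "'k mpoly"
      using that by (intro bexI[of _ "- x"]) auto
  qed (auto simp: algebra_simps)
  show "Group.comm_monoid (mpoly_ring n :: 'k mpoly ring)"
    by (rule comm_monoidI) (auto simp: algebra_simps)
qed (auto simp: algebra_simps)

lemma a_inv_mpoly_ring:
  assumes "p \<in> carrier (mpoly_ring n)"
  shows "\<ominus>\<^bsub>mpoly_ring n\<^esub> p = - p"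
proof -
  interpret P: cring "mpoly_ring n" by (rule cring_mpoly_ring)
  show ?thesis by (rule P.minus_equality) (use assms in auto)
qed

section \<open>Degrees, forms and homogeneous components\<close>

lemma Const_closed [simp]: "Const c \<in> carrier (mpoly_ring n)"
  by (auto simp: Const_def mem_mpoly_ring)

lemma Var_closed [simp]: "i \<le> n \<Longrightarrow> Var i \<in> carrier (mpoly_ring n)"
  by (auto simp: Var_def mem_mpoly_ring)

lemma mdeg_add: "mdeg (a + b) = mdeg a + mdeg b"
  unfolding mdeg_def by (rule setsum_keys_plus_distrib) auto

lemma mdeg_single [simp]: "mdeg (Poly_Mapping.single i e) = e"
  by (cases "e = 0") (simp_all add: mdeg_def)

lemma mdeg_0 [simp]: "mdeg 0 = 0"
  by (simp add: mdeg_def)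

lemma lookup_hom_component:
  "Poly_Mapping.lookup (hom_component d p) m = (if mdeg m = d then Poly_Mapping.lookup p m else 0)"
  by (simp add: hom_component_def lookup_mapp when_def in_keys_iff)

lemma hom_component_add: "hom_component d (p + q) = hom_component d p + hom_component d q"
  by (rule poly_mapping_eqI) (simp add: lookup_hom_component lookup_add)

lemma hom_component_0 [simp]: "hom_component d 0 = 0"
  by (rule poly_mapping_eqI) (simp add: lookup_hom_component)

lemma hom_component_sum: "hom_component d (sum f A) = (\<Sum>i\<in>A. hom_component d (f i))"
  by (induction A rule: infinite_finite_induct) (simp_all add: hom_component_add)

lemma forms_closed: "p \<in> forms n d \<Longrightarrow> p \<in> carrier (mpoly_ring n)"
  by (simp add: forms_def)

lemma hom_component_forms:
  "p \<in> carrier (mpoly_ring n) \<Longrightarrow> hom_component d p \<in> forms n d"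
  by (auto simp: forms_def mem_mpoly_ring in_keys_iff lookup_hom_component split: if_splits)

lemma hom_component_closed [simp]:
  "p \<in> carrier (mpoly_ring n) \<Longrightarrow> hom_component d p \<in> carrier (mpoly_ring n)"
  by (rule forms_closed[OF hom_component_forms])

lemma hom_component_form:
  assumes "p \<in> forms n d"
  shows "hom_component e p = (if e = d then p else 0)"
  using assms
  by (intro poly_mapping_eqI) (auto simp: forms_def lookup_hom_component in_keys_iff)

lemma zero_forms [simp]: "0 \<in> forms n d"
  by (simp add: forms_def)

lemma forms_add: "p \<in> forms n d \<Longrightarrow> q \<in> forms n d \<Longrightarrow> p + q \<in> forms n d"
  using Poly_Mapping.keys_add[of p q] by (auto simp: forms_def)

lemma forms_uminus: "p \<in> forms n d \<Longrightarrow> - p \<in> forms n d"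
  by (auto simp: forms_def in_keys_iff)

lemma forms_mult:
  assumes "p \<in> forms n d" "q \<in> forms n e"
  shows "p * q \<in> forms n (d + e)"
proof -
  have "mdeg m = d + e" if "m \<in> Poly_Mapping.keys (p * q)" for m
  proof -
    obtain a b where "m = a + b" "a \<in> Poly_Mapping.keys p" "b \<in> Poly_Mapping.keys q"
      using keys_mult[of p q] \<open>m \<in> Poly_Mapping.keys (p * q)\<close> by blast
    then show ?thesis
      using assms by (simp add: mdeg_add forms_def)
  qed
  then show ?thesis
    using assms by (simp add: forms_def)
qed

lemma Const_form: "Const c \<in> forms n 0"
  by (simp add: forms_def) (simp add: Const_def)

lemma Var_form: "i \<le> n \<Longrightarrow> Var i \<in> forms n 1"
  by (simp add: forms_def) (simp add: Var_def)

lemma one_form: "1 \<in> forms n 0"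
  by (simp add: forms_def)

text \<open>The expansion holds for every M above the bound, so that two elements, or an element and
  a prescribed degree, can share one range of summation.\<close>

lemma hom_component_bound:
  obtains N where "\<And>M. M \<ge> N \<Longrightarrow> p = (\<Sum>d<M. hom_component d p)"
    and "\<And>d. d \<ge> N \<Longrightarrow> hom_component d p = 0"
proof -
  \<comment> \<open>The inserted 0 keeps \<open>Max\<close> meaningful for p = 0, which has no
    monomials.\<close>
  define N where "N = Suc (Max (insert 0 (mdeg ` Poly_Mapping.keys p)))"
  have N: "mdeg m < N" if "Poly_Mapping.lookup p m \<noteq> 0" for m
    using that by (auto simp: N_def less_Suc_eq_le in_keys_iff intro!: Max_ge)
  have "p = (\<Sum>d<M. hom_component d p)" if "M \<ge> N" for M
    using N that by (intro poly_mapping_eqI) (force simp: lookup_sum lookup_hom_component)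
  moreover have "hom_component d p = 0" if "d \<ge> N" for d
    using N that by (intro poly_mapping_eqI) (force simp: lookup_hom_component)
  ultimately show ?thesis by (rule that)
qed

lemma hom_component_mult_form:
  assumes p: "p \<in> carrier (mpoly_ring n)" and q: "q \<in> forms n s"
  shows "hom_component d (p * q) = (if s \<le> d then hom_component (d - s) p * q else 0)"
proof -
  obtain N where N: "\<And>M. M \<ge> N \<Longrightarrow> p = (\<Sum>d<M. hom_component d p)"
    using hom_component_bound by blast
  define M where "M = max N (Suc d)"
  have "hom_component d (p * q) = (\<Sum>e<M. hom_component d (hom_component e p * q))"
    using N[of M] by (metis M_def hom_component_sum max.cobounded1 sum_distrib_right)
  also have "\<dots> = (\<Sum>e<M. if e + s = d then hom_component e p * q else 0)"
    by (intro sum.cong refl)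
      (simp add: hom_component_form[OF forms_mult[OF hom_component_forms[OF p] q]] eq_commute)
  \<comment> \<open>Subtraction is truncated, so e = d - s may replace e + s = d only under the
    guard s \<le> d.\<close>
  also have "\<dots> = (\<Sum>e<M. if e = d - s then if s \<le> d then hom_component e p * q else 0 else 0)"
    by (intro sum.cong) auto
  also have "\<dots> = (if s \<le> d then hom_component (d - s) p * q else 0)"
    by (simp add: M_def less_max_iff_disj less_Suc_eq_le)
  finally show ?thesis .
qed

lemma hom_component_mult:
  assumes p: "p \<in> carrier (mpoly_ring n)" and q: "q \<in> carrier (mpoly_ring n)"
  shows "hom_component d (p * q) = (\<Sum>i\<le>d. hom_component i p * hom_component (d - i) q)"
proof -
  obtain N where N: "\<And>M. M \<ge> N \<Longrightarrow> q = (\<Sum>d<M. hom_component d q)"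
    using hom_component_bound by blast
  define M where "M = max N (Suc d)"
  have "hom_component d (p * q) = (\<Sum>e<M. hom_component d (p * hom_component e q))"
    using N[of M] by (metis M_def hom_component_sum max.cobounded1 sum_distrib_left)
  also have "\<dots> = (\<Sum>e<M. if e \<le> d then hom_component (d - e) p * hom_component e q else 0)"
    by (intro sum.cong refl hom_component_mult_form[OF p hom_component_forms[OF q]])
  also have "\<dots> = (\<Sum>e\<le>d. hom_component (d - e) p * hom_component e q)"
    by (intro sum.mono_neutral_cong_right) (auto simp: M_def)
  also have "\<dots> = (\<Sum>i\<le>d. hom_component i p * hom_component (d - i) q)"
    by (rule sum.reindex_bij_witness[of _ "\<lambda>i. d - i" "\<lambda>i. d - i"]) auto
  finally show ?thesis .
qed

section \<open>Homogeneous ideals and points\<close>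

lemma ideal_mpoly_ring_iff:
  "ideal J (mpoly_ring n :: 'k::field mpoly ring) \<longleftrightarrow>
     J \<subseteq> carrier (mpoly_ring n) \<and> 0 \<in> J \<and> (\<forall>a\<in>J. \<forall>b\<in>J. a + b \<in> J) \<and>
     (\<forall>a\<in>J. \<forall>c\<in>carrier (mpoly_ring n). c * a \<in> J)"
    (is "?L = ?R")
proof
  interpret P: cring "mpoly_ring n :: 'k mpoly ring" by (rule cring_mpoly_ring)
  { assume ?L
    then interpret ideal J "mpoly_ring n" .
    show ?R using a_subset additive_subgroup.zero_closed[OF is_additive_subgroup]
        additive_subgroup.a_closed[OF is_additive_subgroup] I_l_closed by auto }
  { assume R: ?R
    have "- a \<in> J" if "a \<in> J" for a
    proof -
      have "(- 1) * a \<in> J" using R that by (metis mpoly_ring_closed(2,4))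
      then show ?thesis by simp
    qed
    then have "subgroup J (add_monoid (mpoly_ring n))"
      using R a_inv_mpoly_ring
      by (intro P.add.subgroupI) (auto simp flip: a_inv_def simp: a_inv_mpoly_ring subset_iff)
    then show ?L
      using R by (intro idealI[OF P.ring_axioms]) (auto simp: mult.commute) }
qed

lemma homogeneous_idealD:
  assumes "homogeneous_ideal n J"
  shows "J \<subseteq> carrier (mpoly_ring n)" "0 \<in> J" "\<And>a b. a \<in> J \<Longrightarrow> b \<in> J \<Longrightarrow> a + b \<in> J"
    "\<And>a c. a \<in> J \<Longrightarrow> c \<in> carrier (mpoly_ring n) \<Longrightarrow> c * a \<in> J"
    "\<And>a d. a \<in> J \<Longrightarrow> hom_component d a \<in> J"
  using assms unfolding homogeneous_ideal_def ideal_mpoly_ring_iff by blast+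

lemma homogeneous_ideal_uminus:
  assumes "homogeneous_ideal n J" "a \<in> J"
  shows "- a \<in> J"
  using homogeneous_idealD(4)[OF assms, of "- 1"] by simp

lemma homogeneous_ideal_sum:
  assumes "homogeneous_ideal n J" "\<And>i. i \<in> A \<Longrightarrow> f i \<in> J"
  shows "sum f A \<in> J"
  using assms(2) by (induction A rule: infinite_finite_induct)
    (auto intro: homogeneous_idealD(2,3)[OF assms(1)])

lemma homogeneous_idealI:
  assumes "J \<subseteq> carrier (mpoly_ring n)" "0 \<in> J" "\<And>a b. a \<in> J \<Longrightarrow> b \<in> J \<Longrightarrow> a + b \<in> J"
    "\<And>a c. a \<in> J \<Longrightarrow> c \<in> carrier (mpoly_ring n) \<Longrightarrow> c * a \<in> J"
    "\<And>a d. a \<in> J \<Longrightarrow> hom_component d a \<in> J"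
  shows "homogeneous_ideal n J"
  using assms unfolding homogeneous_ideal_def ideal_mpoly_ring_iff by blast

text \<open>This is J + (a). It is homogeneous because a is a form of degree s: the degree d part of
  q + c a is q_d + c_{d-s} a. It serves both for enlarging a maximal ideal and for I +
  (X_0).\<close>

lemma homogeneous_ideal_add_form:
  assumes J: "homogeneous_ideal n J" and a: "a \<in> forms n s"
  shows "homogeneous_ideal n {q + c * a | q c. q \<in> J \<and> c \<in> carrier (mpoly_ring n)}"
    (is "homogeneous_ideal n ?J")
proof (rule homogeneous_idealI)
  note J' = homogeneous_idealD[OF J]
  show "?J \<subseteq> carrier (mpoly_ring n)" using J'(1) forms_closed[OF a] by auto
  have "0 + 0 * a \<in> ?J" using J'(2) by (metis (mono_tags, lifting) mem_Collect_eq mpoly_ring_closed(1))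
  then show "0 \<in> ?J" by simp
next
  fix x y assume "x \<in> ?J" "y \<in> ?J"
  then obtain q c q' c' where *: "x = q + c * a" "y = q' + c' * a" "q \<in> J" "q' \<in> J"
    "c \<in> carrier (mpoly_ring n)" "c' \<in> carrier (mpoly_ring n)" by blast
  then have "x + y = (q + q') + (c + c') * a" by (simp add: algebra_simps)
  then show "x + y \<in> ?J" using * homogeneous_idealD(3)[OF J] by (blast intro: mpoly_ring_closed)
next
  fix x r :: "'a mpoly" assume "x \<in> ?J" "r \<in> carrier (mpoly_ring n)"
  moreover from this obtain q c where *: "x = q + c * a" "q \<in> J" "c \<in> carrier (mpoly_ring n)"
    by blast
  then have "r * x = r * q + (r * c) * a" by (simp add: algebra_simps)
  ultimately show "r * x \<in> ?J" using * homogeneous_idealD(4)[OF J] by (blast intro: mpoly_ring_closed)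
next
  fix x d assume "x \<in> ?J"
  then obtain q c where *: "x = q + c * a" "q \<in> J" "c \<in> carrier (mpoly_ring n)"
    by blast
  have "hom_component d x = hom_component d q + (if s \<le> d then hom_component (d - s) c else 0) * a"
    using * by (simp add: hom_component_add hom_component_mult_form[OF _ a])
  moreover have "(if s \<le> d then hom_component (d - s) c else 0) \<in> carrier (mpoly_ring n)"
    using * by simp
  ultimately show "hom_component d x \<in> ?J" using * homogeneous_idealD(5)[OF J] by blast
qed

text \<open>For a and b outside J let d and e be the lowest degrees in which a component lies
  outside J. The degree d + e part of a b is a_d b_e plus terms with a factor of lower index, which
  lie in J; so a_d b_e lies in J, and primality is decided by forms.\<close>

lemma homogeneous_primeI:
  assumes J: "homogeneous_ideal n J" and "1 \<notin> J"
    and prime: "\<And>d e a b. a \<in> forms n d \<Longrightarrow> b \<in> forms n e \<Longrightarrow> a * b \<in> J \<Longrightarrow> a \<in> J \<or> b \<in> J"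
  shows "primeideal J (mpoly_ring n)"
proof (rule primeidealI)
  note J' = homogeneous_idealD[OF J]
  show "ideal J (mpoly_ring n)" using J by (simp add: homogeneous_ideal_def)
  show "cring (mpoly_ring n :: 'a mpoly ring)" by (rule cring_mpoly_ring)
  show "carrier (mpoly_ring n) \<noteq> J" using \<open>1 \<notin> J\<close> by (metis mpoly_ring_closed(2))
  fix a b assume a: "a \<in> carrier (mpoly_ring n)" and b: "b \<in> carrier (mpoly_ring n)"
    and ab: "a \<otimes>\<^bsub>mpoly_ring n\<^esub> b \<in> J"
  have least: "\<exists>d. hom_component d p \<notin> J \<and> (\<forall>i<d. hom_component i p \<in> J)" if "p \<notin> J" for p
  proof -
    have "\<exists>d. hom_component d p \<notin> J"
    proof (rule ccontr)
      assume "\<not> ?thesis"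
      moreover obtain N where "p = (\<Sum>d<N. hom_component d p)"
        using hom_component_bound[of p] by blast
      ultimately show False
        using homogeneous_ideal_sum[OF J] \<open>p \<notin> J\<close> by (metis (no_types, lifting))
    qed
    then show ?thesis using exists_least_iff[of "\<lambda>d. hom_component d p \<notin> J"] by blast
  qed
  show "a \<in> J \<or> b \<in> J"
  proof (rule ccontr)
    assume "\<not> ?thesis"
    then obtain d e where d: "hom_component d a \<notin> J" "\<And>i. i < d \<Longrightarrow> hom_component i a \<in> J"
      and e: "hom_component e b \<notin> J" "\<And>i. i < e \<Longrightarrow> hom_component i b \<in> J"
      using least[of a] least[of b] by blast
    let ?t = "\<lambda>i. hom_component i a * hom_component (d + e - i) b"
    have "?t i \<in> J" if "i \<in> {..d + e} - {d}" for i
    proof (cases "i < d")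
      case True
      then show ?thesis
        using J'(4)[OF d(2), of i "hom_component (d + e - i) b"] b by (simp add: mult.commute)
    next
      case False
      \<comment> \<open>Here i > d, so d + e - i < e.\<close>
      then show ?thesis using that a by (intro J'(4) e(2)) auto
    qed
    then have "(\<Sum>i\<in>{..d + e} - {d}. ?t i) \<in> J"
      by (rule homogeneous_ideal_sum[OF J])
    moreover have "(\<Sum>i\<le>d + e. ?t i) \<in> J"
      using ab J'(5)[of "a * b" "d + e"] hom_component_mult[OF a b, of "d + e"] by simp
    moreover have "(\<Sum>i\<le>d + e. ?t i) = ?t d + (\<Sum>i\<in>{..d + e} - {d}. ?t i)"
      by (rule sum.remove) auto
    ultimately have "?t d \<in> J"
      using J'(3)[OF _ homogeneous_ideal_uminus[OF J], of "\<Sum>i\<le>d + e. ?t i"] by fastforce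
    then show False
      using prime[OF hom_component_forms[OF a] hom_component_forms[OF b]] d(1) e(1) by auto
  qed
qed

text \<open>Among the homogeneous ideals that avoid the powers of $v$, a maximal one is prime.\<close>

lemma homogeneous_prime_avoiding_powers:
  assumes J: "homogeneous_ideal n J" and v: "v \<in> carrier (mpoly_ring n)" and avoid: "\<And>e. v ^ e \<notin> J"
  obtains p where "primeideal p (mpoly_ring n)" "homogeneous_ideal n p" "J \<subseteq> p" "v \<notin> p"
proof -
  \<comment> \<open>The exponent e = 0 is included, so all ideals of the family are proper.\<close>
  define avoiding where "avoiding = {q. homogeneous_ideal n q \<and> J \<subseteq> q \<and> (\<forall>e. v ^ e \<notin> q)}"
  have "\<exists>M\<in>avoiding. \<forall>Y\<in>avoiding. M \<subseteq> Y \<longrightarrow> Y = M"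
  proof (rule subset_Zorn_nonempty)
    show "avoiding \<noteq> {}" using J avoid by (auto simp: avoiding_def)
    fix C assume C: "C \<noteq> {}" "subset.chain avoiding C"
    then have CA: "C \<subseteq> avoiding" and tot: "\<And>q r. q \<in> C \<Longrightarrow> r \<in> C \<Longrightarrow> q \<subseteq> r \<or> r \<subseteq> q"
      unfolding subset_chain_def by blast+
    then have hom: "homogeneous_ideal n q" if "q \<in> C" for q using that by (auto simp: avoiding_def)
    have "homogeneous_ideal n (\<Union>C)"
    proof (rule homogeneous_idealI)
      show "\<Union>C \<subseteq> carrier (mpoly_ring n)"
        using homogeneous_idealD(1)[OF hom] by (rule Union_least)
      show "0 \<in> \<Union>C" using C(1) homogeneous_idealD(2)[OF hom] by (metis UnionI equals0I)
      fix a assume "a \<in> \<Union>C"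
      then obtain q where q: "q \<in> C" "a \<in> q" by (rule UnionE)
      show "hom_component d a \<in> \<Union>C" for d using homogeneous_idealD(5)[OF hom[OF q(1)] q(2)] q(1) by (rule UnionI[rotated])
      show "c * a \<in> \<Union>C" if "c \<in> carrier (mpoly_ring n)" for c
        using homogeneous_idealD(4)[OF hom[OF q(1)] q(2) that] q(1) by (rule UnionI[rotated])
      fix b assume "b \<in> \<Union>C"
      then obtain r where r: "r \<in> C" "b \<in> r" by (rule UnionE)
      then obtain t where t: "t \<in> C" "a \<in> t" "b \<in> t" using tot[OF q(1) r(1)] q r by (metis subsetD)
      show "a + b \<in> \<Union>C" using homogeneous_idealD(3)[OF hom[OF t(1)] t(2,3)] t(1) by (rule UnionI[rotated])
    qed
    moreover have "J \<subseteq> \<Union>C" using C(1) CA unfolding avoiding_def by blast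
    moreover have "v ^ e \<notin> \<Union>C" for e using CA unfolding avoiding_def by blast
    ultimately show "\<Union>C \<in> avoiding" by (simp add: avoiding_def)
  qed
  then obtain p where p_avoiding: "p \<in> avoiding" and max: "\<forall>Y\<in>avoiding. p \<subseteq> Y \<longrightarrow> Y = p"
    by (rule bexE)
  from p_avoiding have p: "homogeneous_ideal n p" "J \<subseteq> p" "\<And>e. v ^ e \<notin> p"
    by (simp_all add: avoiding_def)
  note p' = homogeneous_idealD[OF p(1)]
  \<comment> \<open>Adjoining to p a form outside p gives a strictly larger homogeneous ideal over
    J; by maximality it contains a power of v.\<close>
  have power: "\<exists>e q c. v ^ e = q + c * a \<and> q \<in> p \<and> c \<in> carrier (mpoly_ring n)"
    if a: "a \<in> forms n d" "a \<notin> p" for a d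
  proof (rule ccontr)
    let ?J' = "{q + c * a | q c. q \<in> p \<and> c \<in> carrier (mpoly_ring n)}"
    assume "\<not> ?thesis"
    then have notin: "\<forall>e. v ^ e \<notin> ?J'" by blast
    have sub: "p \<subseteq> ?J'"
    proof
      fix x assume "x \<in> p"
      moreover have "x = x + 0 * a" by simp
      ultimately show "x \<in> ?J'" using mpoly_ring_closed(1) by blast
    qed
    then have "?J' = p"
      using homogeneous_ideal_add_form[OF p(1) a(1)] p(2) notin sub
      by (intro max[rule_format]) (simp_all only: avoiding_def mem_Collect_eq, blast)
    moreover have "0 + 1 * a \<in> ?J'" using p'(2) mpoly_ring_closed(2) by blast
    ultimately show False using a(2) by simp
  qed
  have "primeideal p (mpoly_ring n)"
  proof (rule homogeneous_primeI[OF p(1)])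
    show "1 \<notin> p" using p(3)[of 0] by simp
    fix d e a b assume a: "a \<in> forms n d" and b: "b \<in> forms n e" and ab: "a * b \<in> p"
    show "a \<in> p \<or> b \<in> p"
    proof (rule ccontr)
      assume "\<not> ?thesis"
      then obtain f q c f' q' c' where *: "v ^ f = q + c * a" "q \<in> p" "c \<in> carrier (mpoly_ring n)"
        "v ^ f' = q' + c' * b" "q' \<in> p" "c' \<in> carrier (mpoly_ring n)"
        using power[OF a] power[OF b] by blast
      \<comment> \<open>In the product of the two expressions every term has a factor q, q' or a b,
        all of which lie in p.\<close>
      have "v ^ (f + f') = v ^ f' * q + ((c * a) * q' + (c * c') * (a * b))"
        unfolding power_add *(1,4) by (simp add: algebra_simps)
      also have "\<dots> \<in> p"
        using *(3,6) v a b subsetD[OF p'(1) *(5)] mpoly_ring_power_closed[OF v, of f']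
        by (intro p'(3) p'(4)[OF *(2)] p'(4)[OF *(5)] p'(4)[OF ab])
          (simp_all only: mpoly_ring_closed mpoly_ring_power_closed forms_closed)
      finally show False using p(3) by blast
    qed
  qed
  moreover have "v \<notin> p" using p(3)[of 1] by simp
  ultimately show ?thesis using that p(1,2) by blast
qed

section \<open>Ideals without points\<close>

lemma Var_power: "Var i ^ e = Poly_Mapping.single (Poly_Mapping.single i e) 1"
  by (induction e) (simp_all add: Var_def mult_single single_add[symmetric])

lemma mpoly_sum_monomials:
  "p = (\<Sum>m\<in>Poly_Mapping.keys p. Poly_Mapping.single m (Poly_Mapping.lookup p m))"
  by (rule poly_mapping_eqI)
    (auto simp: lookup_sum lookup_single when_def in_keys_iff)

text \<open>Pigeonhole: a monomial of degree at least (n + 1) E in n + 1 variables has an exponent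
  at least E, hence is a multiple of some X_i^E.\<close>

lemma forms_in_ideal_of_Var_powers:
  assumes J: "homogeneous_ideal n J" and pow: "\<And>i. i \<le> n \<Longrightarrow> \<exists>e. Var i ^ e \<in> J"
  obtains k where "\<And>d g. d \<ge> k \<Longrightarrow> g \<in> forms n d \<Longrightarrow> g \<in> J"
proof -
  note J' = homogeneous_idealD[OF J]
  obtain e where e: "\<And>i. i \<le> n \<Longrightarrow> Var i ^ e i \<in> J" using pow by metis
  \<comment> \<open>The sum of all \<open>e i\<close> bounds each of them, so one exponent serves
    all variables.\<close>
  define E where "E = Suc (\<Sum>i\<le>n. e i)"
  have E: "Var i ^ E \<in> J" if "i \<le> n" for i
  proof -
    have "e i \<le> E" using member_le_sum[of i "{..n}" e] that by (simp add: E_def)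
    then have "Var i ^ E = Var i ^ (E - e i) * Var i ^ e i" by (simp flip: power_add)
    then show ?thesis using that by (metis J'(4) e mpoly_ring_power_closed Var_closed)
  qed
  have "g \<in> J" if d: "d \<ge> Suc n * E" and g: "g \<in> forms n d" for d g
  proof -
    have "Poly_Mapping.single m (Poly_Mapping.lookup g m) \<in> J" if m: "m \<in> Poly_Mapping.keys g" for m
    proof -
      have md: "mdeg m = d" and mk: "Poly_Mapping.keys m \<subseteq> {..n}"
        using g m by (auto simp: forms_def mem_mpoly_ring)
      have "\<exists>i\<le>n. E \<le> Poly_Mapping.lookup m i"
      proof (rule ccontr)
        assume "\<not> ?thesis"
        then have lt: "\<And>i. i \<le> n \<Longrightarrow> Poly_Mapping.lookup m i < E" by (meson not_le)
        have "mdeg m = (\<Sum>i\<le>n. Poly_Mapping.lookup m i)"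
          unfolding mdeg_def by (rule sum.mono_neutral_left) (use mk in \<open>auto simp: in_keys_iff\<close>)
        also have "\<dots> < (\<Sum>i\<le>n. E)" by (rule sum_strict_mono) (use lt in auto)
        finally show False using md d by simp
      qed
      then obtain i where i: "i \<le> n" "E \<le> Poly_Mapping.lookup m i" by blast
      define m' where "m' = m - Poly_Mapping.single i E"
      have m': "m = m' + Poly_Mapping.single i E"
        using i(2) by (intro poly_mapping_eqI) (auto simp: m'_def lookup_add lookup_minus lookup_single when_def)
      have "Poly_Mapping.keys m' \<subseteq> Poly_Mapping.keys m"
        by (auto simp: m' in_keys_iff lookup_add)
      then have "Poly_Mapping.single m' (Poly_Mapping.lookup g m) \<in> carrier (mpoly_ring n)"
        using mk by (auto simp: mem_mpoly_ring)
      then have "Poly_Mapping.single m' (Poly_Mapping.lookup g m) * Var i ^ E \<in> J"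
        by (rule J'(4)[OF E[OF i(1)]])
      then show ?thesis by (simp add: Var_power mult_single flip: m')
    qed
    then show "g \<in> J"
      using homogeneous_ideal_sum[OF J] mpoly_sum_monomials[of g] by (metis (no_types, lifting))
  qed
  then show ?thesis by (rule that)
qed

text \<open>A form of the projective Nullstellensatz: if no power of some X_i lay in J, a
  homogeneous prime above J that misses X_i would be a point of J.\<close>

lemma forms_in_ideal_without_points:
  assumes J: "homogeneous_ideal n J" and no_points: "scheme_points n J = {}"
  obtains k where "\<And>d g. d \<ge> k \<Longrightarrow> g \<in> forms n d \<Longrightarrow> g \<in> J"
proof -
  have "\<exists>e. Var i ^ e \<in> J" if i: "i \<le> n" for i
  proof (rule ccontr)
    assume "\<not> ?thesis"
    then obtain p where "primeideal p (mpoly_ring n)" "homogeneous_ideal n p" "J \<subseteq> p" "Var i \<notin> p"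
      using homogeneous_prime_avoiding_powers[OF J, of "Var i"] i Var_closed by metis
    then show False using no_points i by (auto simp: scheme_points_def)
  qed
  then show ?thesis using forms_in_ideal_of_Var_powers[OF J] that by blast
qed

section \<open>Linear dependence of sequences\<close>

context ring
begin

text \<open>Independence is built up by prepending, so the entry found depends on those after it.
  For the list 1, t, ..., t^N this makes a power of t a combination of higher powers, the direction
  that yields an inverse of t.\<close>

lemma dependent_list_split:
  assumes "subfield K R" "dimension N K E" "set Us \<subseteq> E" "N < length Us"
  obtains Vs u Ws where "Us = Vs @ u # Ws" "u \<in> Span K Ws"
proof -
  have E: "E \<subseteq> carrier R" by (rule space_subgroup_props(1)[OF assms(1,2)])
  have "\<exists>Vs u Ws. Us = Vs @ u # Ws \<and> u \<in> Span K Ws" if "dependent K Us" "set Us \<subseteq> E" for Us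
    using that
  proof (induction Us)
    case (Cons u Us)
    show ?case
    proof (cases "u \<in> Span K Us")
      case True
      then show ?thesis by (metis append_Nil)
    next
      case False
      then have "dependent K Us" using Cons.prems E li_Cons[of u K Us] by auto
      then obtain Vs v Ws where "Us = Vs @ v # Ws" "v \<in> Span K Ws" using Cons by auto
      then show ?thesis by (metis append_Cons)
    qed
  qed simp
  moreover have "dependent K Us"
    using independent_length_le_dimension[OF assms(1,2) _ assms(3)] assms(4) by auto
  ultimately show ?thesis using assms(3) that by blast
qed

text \<open>\<open>Span\<close> grows at the head of a list; reversing the indices puts the last
  term in front, where the induction on m peels it off. The sum stands on the side of u, so that u =
  \<open>f m\<close> gives a monic equation.\<close>

lemma Span_sequence:
  assumes K: "subfield K R" and f: "\<And>i. f i \<in> carrier R" and "u \<in> Span K (map f (rev [0..<m]))"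
  shows "\<exists>c. c \<in> {..<m} \<rightarrow> K \<and> u \<oplus> (\<Oplus>i\<in>{..<m}. c i \<otimes> f i) = \<zero>"
  using assms(3)
proof (induction m arbitrary: u)
  case 0
  then show ?case by simp
next
  case (Suc m)
  have KR: "K \<subseteq> carrier R" by (rule subfieldE(3)[OF K])
  have "u \<in> line_extension K (f m) (Span K (map f (rev [0..<m])))" using Suc.prems by simp
  then obtain k v where kv: "k \<in> K" "v \<in> Span K (map f (rev [0..<m]))" "u = k \<otimes> f m \<oplus> v"
    unfolding line_extension_mem_iff by blast
  obtain c where c: "c \<in> {..<m} \<rightarrow> K" "v \<oplus> (\<Oplus>i\<in>{..<m}. c i \<otimes> f i) = \<zero>"
    using Suc.IH[OF kv(2)] by blast
  \<comment> \<open>The sign changes because the combination is moved to the side of u.\<close>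
  define c' where "c' = c(m := \<ominus> k)"
  have kR: "k \<in> carrier R" using kv(1) KR by blast
  have "set (map f (rev [0..<m])) \<subseteq> carrier R" using f by auto
  then have vR: "v \<in> carrier R" using Span_in_carrier[OF KR] kv(2) by blast
  have cf: "(\<lambda>i. c i \<otimes> f i) \<in> {..<m} \<rightarrow> carrier R" using c(1) KR f by blast
  define s where "s = (\<Oplus>i\<in>{..<m}. c i \<otimes> f i)"
  have sR: "s \<in> carrier R" unfolding s_def by (rule finsum_closed[OF cf])
  have "(\<Oplus>i\<in>{..<m}. c' i \<otimes> f i) = s"
    unfolding s_def using cf by (intro finsum_cong') (auto simp: c'_def)
  then have "(\<Oplus>i\<in>{..<Suc m}. c' i \<otimes> f i) = \<ominus> k \<otimes> f m \<oplus> s"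
    unfolding lessThan_Suc using c(1) KR f kR
    by (subst finsum_insert) (auto simp: c'_def Pi_def subset_iff)
  moreover have "u \<oplus> (\<ominus> k \<otimes> f m \<oplus> s) = (k \<otimes> f m \<oplus> \<ominus> (k \<otimes> f m)) \<oplus> (v \<oplus> s)"
    unfolding kv(3) using kR f[of m] vR sR by (simp add: a_ac l_minus)
  ultimately have "u \<oplus> (\<Oplus>i\<in>{..<Suc m}. c' i \<otimes> f i) = \<zero>"
    using c(2) kR f[of m] unfolding s_def[symmetric] by (simp add: r_neg)
  moreover have "c' \<in> {..<Suc m} \<rightarrow> K"
    using c(1) subringE(5)[OF subfieldE(1)[OF K] kv(1)] by (auto simp: c'_def less_Suc_eq)
  ultimately show ?case by blast
qed

text \<open>The opposite order to \<open>dependent_list_split\<close>: some term depends on its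
  predecessors, since otherwise initial segments of every length would be independent in E. The case
  m = 0 is possible and means that \<open>f 0\<close> is zero.\<close>

lemma dependent_sequence:
  fixes f :: "nat \<Rightarrow> 'a"
  assumes K: "subfield K R" and E: "finite_dimension K E" and f: "\<And>i. f i \<in> E"
  obtains m c where "c \<in> {..<m} \<rightarrow> K" "f m \<oplus> (\<Oplus>i\<in>{..<m}. c i \<otimes> f i) = \<zero>"
proof -
  obtain N where N: "dimension N K E" using E by blast
  have fR: "f i \<in> carrier R" for i using f space_subgroup_props(1)[OF K N] by blast
  have "\<exists>m::nat. f m \<in> Span K (map f (rev [0..<m]))"
  proof (rule ccontr)
    assume *: "\<not> ?thesis"
    have "independent K (map f (rev [0..<m]))" for m :: nat
    proof (induction m)
      case (Suc m)
      then show ?case using * fR by (auto intro: li_Cons)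
    qed simp
    then have "length (map f (rev [0..<Suc N])) \<le> N"
      by (rule independent_length_le_dimension[OF K N]) (use f in auto)
    then show False by simp
  qed
  then show ?thesis using Span_sequence[of K f, OF K fR] that by blast
qed

end

section \<open>The graded ring $R$\<close>

locale zero_dim_scheme =
  fixes n :: nat and I :: "'k::field mpoly set"
  assumes homogeneous: "homogeneous_ideal n I"
    and saturated: "saturated n I"
    and points: "scheme_points n I \<noteq> {}"
    and Var0_points: "\<And>p. p \<in> scheme_points n I \<Longrightarrow> Var 0 \<notin> p"
begin

abbreviation "P \<equiv> mpoly_ring n :: 'k mpoly ring"
abbreviation "R \<equiv> coord_ring n I"
abbreviation "cls \<equiv> coord_class n I"
abbreviation "part \<equiv> coord_part n I"
abbreviation "component \<equiv> coord_component n I"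
abbreviation "x \<equiv> x0 n I"

sublocale P: cring P by (rule cring_mpoly_ring)

lemma ideal_I: "ideal I P"
  using homogeneous by (simp add: homogeneous_ideal_def)

section \<open>Points of the scheme and the hyperplane X_0 = 0\<close>

lemma points_antimono: "I \<subseteq> J \<Longrightarrow> scheme_points n J \<subseteq> scheme_points n I"
  by (auto simp: scheme_points_def)

lemma scheme_points_contain: "p \<in> scheme_points n J \<Longrightarrow> J \<subseteq> p"
  by (simp add: scheme_points_def)

text \<open>A point of J would be a point of I containing X_0. Geometrically, the scheme misses the
  hyperplane X_0 = 0.\<close>

lemma no_points_Var0: "I \<subseteq> J \<Longrightarrow> Var 0 \<in> J \<Longrightarrow> scheme_points n J = {}"
  using points_antimono[of J] Var0_points scheme_points_contain by (metis equals0I subsetD)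

text \<open>A point is a proper ideal containing I. This keeps R, and later S, from being zero, so
  that K embeds in both.\<close>

lemma one_notin_I: "1 \<notin> I"
proof
  assume "1 \<in> I"
  obtain p where "p \<in> scheme_points n I" using points by blast
  then have p: "primeideal p P" and "1 \<in> p"
    using \<open>1 \<in> I\<close> by (simp_all add: scheme_points_def subset_iff)
  interpret p: primeideal p P by (rule p)
  show False
    using p.one_imp_carrier p.I_notcarr \<open>1 \<in> p\<close> by simp
qed

text \<open>The colon ideal (I : f), homogeneous since f is a form, contains I and X_0. So it has no
  points and contains all forms of some degree, which by saturation puts f into I.\<close>

lemma Var0_nonzerodivisor_form:
  assumes f: "f \<in> forms n s" and Var0: "Var 0 * f \<in> I"
  shows "f \<in> I"
proof -
  note I' = homogeneous_idealD[OF homogeneous]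
  define J where "J = {g \<in> carrier P. g * f \<in> I}"
  have J: "homogeneous_ideal n J"
  proof (rule homogeneous_idealI)
    show "0 \<in> J" using I'(2) by (simp add: J_def)
    show "a + b \<in> J" if "a \<in> J" "b \<in> J" for a b
      using that I'(3) by (simp add: J_def distrib_right)
    show "c * a \<in> J" if "a \<in> J" "c \<in> carrier P" for a c
      using that I'(4) by (simp add: J_def mult.assoc)
    show "hom_component d a \<in> J" if "a \<in> J" for a d
      using that I'(5)[of "a * f" "d + s"] hom_component_mult_form[OF _ f, of a "d + s"]
      by (simp add: J_def)
  qed (auto simp: J_def)
  have "I \<subseteq> J"
    using I'(1) I'(4) forms_closed[OF f] by (auto simp: J_def mult.commute)
  then have "scheme_points n J = {}"
    using Var0 by (intro no_points_Var0) (simp_all add: J_def)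
  then obtain k where "\<And>d g. d \<ge> k \<Longrightarrow> g \<in> forms n d \<Longrightarrow> g \<in> J"
    using forms_in_ideal_without_points[OF J] by blast
  then have "\<exists>k. \<forall>g\<in>forms n k. g * f \<in> I" unfolding J_def by blast
  then show ?thesis
    using saturated[unfolded saturated_def, rule_format, OF forms_closed[OF f]] by simp
qed

text \<open>X_0 shifts degrees by one, so the claim splits into the claims for the components of
  f.\<close>

lemma Var0_nonzerodivisor:
  assumes f: "f \<in> carrier P" and Var0: "Var 0 * f \<in> I"
  shows "f \<in> I"
proof -
  have "hom_component d f \<in> I" for d
  proof (rule Var0_nonzerodivisor_form[OF hom_component_forms[OF f]])
    have "hom_component (Suc d) (f * Var 0) = hom_component d f * Var 0"
      using hom_component_mult_form[OF f Var_form[of 0 n], of "Suc d"] by simp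
    then show "Var 0 * hom_component d f \<in> I"
      using homogeneous_idealD(5)[OF homogeneous Var0, of "Suc d"] by (simp add: mult.commute)
  qed
  then have sum: "(\<Sum>d<N. hom_component d f) \<in> I" for N
    by (rule homogeneous_ideal_sum[OF homogeneous])
  obtain N where "f = (\<Sum>d<N. hom_component d f)"
    by (rule hom_component_bound[of f]) blast
  then show ?thesis using sum by metis
qed

text \<open>I + (X_0) has no points, so it contains all forms of high degree. Of g = q + c X_0 only
  the part of degree d + 1 is kept: q stays in I by homogeneity, and c is replaced by the form
  c_d.\<close>

lemma forms_Suc_decomposition:
  obtains k where "\<And>d g. d \<ge> k \<Longrightarrow> g \<in> forms n (Suc d) \<Longrightarrow> \<exists>h\<in>forms n d. g - Var 0 * h \<in> I"
proof -
  note I' = homogeneous_idealD[OF homogeneous]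
  let ?J = "{q + c * Var 0 | q c. q \<in> I \<and> c \<in> carrier P}"
  have form: "Var 0 \<in> forms n 1" by (rule Var_form) simp
  have J: "homogeneous_ideal n ?J" by (rule homogeneous_ideal_add_form[OF homogeneous form])
  have "I \<subseteq> ?J"
  proof
    fix q assume "q \<in> I"
    moreover have "q = q + 0 * Var 0" by simp
    ultimately show "q \<in> ?J" using mpoly_ring_closed(1) by blast
  qed
  moreover have "0 + 1 * Var 0 \<in> ?J" using I'(2) mpoly_ring_closed(2) by blast
  ultimately have "scheme_points n ?J = {}" by (intro no_points_Var0) simp_all
  then obtain k where k: "\<And>d g. d \<ge> k \<Longrightarrow> g \<in> forms n d \<Longrightarrow> g \<in> ?J"
    using forms_in_ideal_without_points[OF J] by blast
  have "\<exists>h\<in>forms n d. g - Var 0 * h \<in> I" if d: "d \<ge> k" and g: "g \<in> forms n (Suc d)" for d g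
  proof -
    have "g \<in> ?J" using k[OF _ g] d by simp
    then obtain q c where qc: "g = q + c * Var 0" "q \<in> I" "c \<in> carrier P" by blast
    have "g = hom_component (Suc d) g" using hom_component_form[OF g] by simp
    also have "\<dots> = hom_component (Suc d) q + hom_component d c * Var 0"
      using hom_component_mult_form[OF qc(3) form, of "Suc d"]
      by (simp add: qc(1) hom_component_add)
    finally have "g - Var 0 * hom_component d c = hom_component (Suc d) q"
      by (simp add: algebra_simps)
    then show ?thesis
      using hom_component_forms[OF qc(3), of d] I'(5)[OF qc(2)] by metis
  qed
  then show ?thesis by (rule that)
qed

section \<open>The quotient by I and its grading\<close>

sublocale R: cring R
  unfolding coord_ring_def by (rule ideal.quotient_is_cring[OF ideal_I cring_mpoly_ring])

sublocale cls: ring_hom_cring P R cls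
proof -
  have "cls = (\<lambda>p. I +>\<^bsub>P\<^esub> p)" by (simp add: coord_class_def fun_eq_iff)
  then show "ring_hom_cring P R cls"
    unfolding coord_ring_def using ideal.rcos_ring_hom_cring[OF ideal_I cring_mpoly_ring] by simp
qed

lemmas cls_hom = cls.hom_add[simplified] cls.hom_mult[simplified] cls.hom_zero[simplified]
  cls.hom_one[simplified]

lemma carrier_R: "carrier R = cls ` carrier P"
  unfolding coord_ring_def coord_class_def[abs_def] FactRing_simps by auto

lemma cls_eq_iff: "p \<in> carrier P \<Longrightarrow> q \<in> carrier P \<Longrightarrow> cls p = cls q \<longleftrightarrow> p - q \<in> I"
  using P.quotient_eq_iff_same_a_r_cos[OF ideal_I, of p q]
  by (simp add: coord_class_def a_minus_def a_inv_mpoly_ring)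

lemma cls_eq_zero_iff: "p \<in> carrier P \<Longrightarrow> cls p = \<zero>\<^bsub>R\<^esub> \<longleftrightarrow> p \<in> I"
  using cls_eq_iff[of p 0] by (simp add: cls_hom)

lemma cls_closed [simp]: "p \<in> carrier P \<Longrightarrow> cls p \<in> carrier R"
  by (rule cls.hom_closed)

lemma cls_uminus: "p \<in> carrier P \<Longrightarrow> cls (- p) = \<ominus>\<^bsub>R\<^esub> cls p"
  using cls.hom_a_inv[of p] by (simp add: a_inv_mpoly_ring)

lemma cls_sum:
  "finite A \<Longrightarrow> (\<And>i. i \<in> A \<Longrightarrow> f i \<in> carrier P) \<Longrightarrow> cls (sum f A) = (\<Oplus>\<^bsub>R\<^esub>i\<in>A. cls (f i))"
  by (induction A rule: finite_induct) (simp_all add: cls_hom R.finsum_insert Pi_def)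

lemma one_not_zero: "\<one>\<^bsub>R\<^esub> \<noteq> \<zero>\<^bsub>R\<^esub>"
  using cls_eq_zero_iff[of 1] one_notin_I by (simp add: cls_hom)

lemma part_cases:
  assumes "f \<in> part d" obtains p where "p \<in> forms n d" "p \<in> carrier P" "f = cls p"
  using assms unfolding coord_part_def by (auto intro: forms_closed)

lemma cls_part: "p \<in> forms n d \<Longrightarrow> cls p \<in> part d"
  by (simp add: coord_part_def)

lemma part_closed: "f \<in> part d \<Longrightarrow> f \<in> carrier R"
  by (erule part_cases) simp

lemma zero_part [simp]: "\<zero>\<^bsub>R\<^esub> \<in> part d"
  using cls_part[OF zero_forms] by (simp add: cls_hom)

lemma part_add: "f \<in> part d \<Longrightarrow> g \<in> part d \<Longrightarrow> f \<oplus>\<^bsub>R\<^esub> g \<in> part d"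
  by (elim part_cases) (metis cls_hom(1) cls_part forms_add)

lemma part_uminus: "f \<in> part d \<Longrightarrow> \<ominus>\<^bsub>R\<^esub> f \<in> part d"
  by (elim part_cases) (metis cls_uminus cls_part forms_uminus)

lemma part_mult: "f \<in> part d \<Longrightarrow> g \<in> part e \<Longrightarrow> f \<otimes>\<^bsub>R\<^esub> g \<in> part (d + e)"
  by (elim part_cases) (metis cls_hom(2) cls_part forms_mult)

lemma one_part: "\<one>\<^bsub>R\<^esub> \<in> part 0"
  using cls_part[OF one_form] by (simp add: cls_hom)

lemma const_part: "coord_const n I c \<in> part 0"
  unfolding coord_const_def by (rule cls_part[OF Const_form])

lemma x0_part: "x \<in> part 1"
  unfolding x0_def by (rule cls_part[OF Var_form]) simp

lemma x0_closed [simp]: "x \<in> carrier R"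
  by (rule part_closed[OF x0_part])

lemma const_closed [simp]: "coord_const n I c \<in> carrier R"
  by (rule part_closed[OF const_part])

lemma x0_pow_part: "x [^]\<^bsub>R\<^esub> (d::nat) \<in> part d"
proof (induction d)
  case 0
  show ?case using one_part by simp
next
  case (Suc d)
  then show ?case using part_mult[OF Suc x0_part] by simp
qed

text \<open>The defining union ranges over all representatives. Homogeneity of I makes the cosets
  equal, and p itself shows that the union is not empty.\<close>

lemma component_cls:
  assumes p: "p \<in> carrier P"
  shows "component d (cls p) = cls (hom_component d p)"
proof -
  have "cls (hom_component d q) = cls (hom_component d p)" if q: "q \<in> cls p" for q
  proof -
    obtain i where "i \<in> I" "q = i + p"
      using q by (auto simp: coord_class_def a_r_coset_def r_coset_def)
    then have "q \<in> carrier P" "hom_component d q - hom_component d p \<in> I"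
      using homogeneous_idealD(1,5)[OF homogeneous] p by (auto simp: hom_component_add)
    then show ?thesis using p by (simp add: cls_eq_iff)
  qed
  moreover have "p \<in> cls p"
  proof -
    interpret ideal I P by (rule ideal_I)
    show ?thesis unfolding coord_class_def by (rule a_rcos_self[OF p])
  qed
  ultimately show ?thesis
    unfolding coord_component_def by blast
qed

lemma carrier_R_cases:
  assumes "f \<in> carrier R" obtains p where "p \<in> carrier P" "f = cls p"
  using assms unfolding carrier_R by auto

lemma component_part: "f \<in> carrier R \<Longrightarrow> component d f \<in> part d"
  by (elim carrier_R_cases) (simp add: component_cls cls_part hom_component_forms)

lemma component_closed [simp]: "f \<in> carrier R \<Longrightarrow> component d f \<in> carrier R"
  by (rule part_closed[OF component_part])

lemma component_of_part: "f \<in> part d \<Longrightarrow> component e f = (if e = d then f else \<zero>\<^bsub>R\<^esub>)"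
  by (elim part_cases) (simp add: component_cls hom_component_form cls_hom)

lemma component_add:
  "f \<in> carrier R \<Longrightarrow> g \<in> carrier R \<Longrightarrow> component d (f \<oplus>\<^bsub>R\<^esub> g) = component d f \<oplus>\<^bsub>R\<^esub> component d g"
  by (elim carrier_R_cases) (simp add: component_cls cls_hom[symmetric] hom_component_add)

lemma component_zero [simp]: "component d \<zero>\<^bsub>R\<^esub> = \<zero>\<^bsub>R\<^esub>"
  by (simp add: component_of_part[OF zero_part[of d]])

lemma component_uminus:
  assumes "f \<in> carrier R"
  shows "component d (\<ominus>\<^bsub>R\<^esub> f) = \<ominus>\<^bsub>R\<^esub> component d f"
proof (rule R.minus_equality[symmetric])
  have "component d (\<ominus>\<^bsub>R\<^esub> f) \<oplus>\<^bsub>R\<^esub> component d f = component d (\<ominus>\<^bsub>R\<^esub> f \<oplus>\<^bsub>R\<^esub> f)"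
    using assms by (simp add: component_add)
  then show "component d (\<ominus>\<^bsub>R\<^esub> f) \<oplus>\<^bsub>R\<^esub> component d f = \<zero>\<^bsub>R\<^esub>"
    using assms by (simp add: R.l_neg)
qed (use assms in auto)

lemma component_minus:
  "f \<in> carrier R \<Longrightarrow> g \<in> carrier R \<Longrightarrow> component d (f \<ominus>\<^bsub>R\<^esub> g) = component d f \<ominus>\<^bsub>R\<^esub> component d g"
  by (simp add: a_minus_def component_add component_uminus)

lemma component_mult:
  "f \<in> carrier R \<Longrightarrow> g \<in> carrier R \<Longrightarrow>
     component d (f \<otimes>\<^bsub>R\<^esub> g) = (\<Oplus>\<^bsub>R\<^esub>i\<in>{..d}. component i f \<otimes>\<^bsub>R\<^esub> component (d - i) g)"
  by (elim carrier_R_cases)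
    (simp add: component_cls cls_hom(2)[symmetric] hom_component_mult cls_sum)

lemma component_mult_part:
  assumes "f \<in> carrier R" "g \<in> part s"
  shows "component d (f \<otimes>\<^bsub>R\<^esub> g) = (if s \<le> d then component (d - s) f \<otimes>\<^bsub>R\<^esub> g else \<zero>\<^bsub>R\<^esub>)"
  using assms
  by (elim carrier_R_cases part_cases)
    (simp add: component_cls cls_hom(2,3)[symmetric] hom_component_mult_form)

lemma component_bound:
  assumes "f \<in> carrier R"
  obtains N where "\<And>M. M \<ge> N \<Longrightarrow> f = (\<Oplus>\<^bsub>R\<^esub>d\<in>{..<M}. component d f)"
    and "\<And>d. d \<ge> N \<Longrightarrow> component d f = \<zero>\<^bsub>R\<^esub>"
proof -
  obtain p where p: "p \<in> carrier P" "f = cls p" using assms by (rule carrier_R_cases)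
  obtain N where N: "\<And>M. M \<ge> N \<Longrightarrow> p = (\<Sum>d<M. hom_component d p)"
    "\<And>d. d \<ge> N \<Longrightarrow> hom_component d p = 0"
    using hom_component_bound[of p] by blast
  have "f = (\<Oplus>\<^bsub>R\<^esub>d\<in>{..<M}. component d f)" if "M \<ge> N" for M
    using N(1)[OF that] p by (simp add: component_cls flip: cls_sum)
  moreover have "component d f = \<zero>\<^bsub>R\<^esub>" if "d \<ge> N" for d
    using N(2)[OF that] p by (simp add: component_cls cls_hom)
  ultimately show ?thesis by (rule that)
qed

lemma component_eqI:
  assumes f: "f \<in> carrier R" and g: "g \<in> carrier R" and eq: "\<And>d. component d f = component d g"
  shows "f = g"
proof -
  obtain N where N: "\<And>M. M \<ge> N \<Longrightarrow> f = (\<Oplus>\<^bsub>R\<^esub>d\<in>{..<M}. component d f)"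
    by (rule component_bound[OF f]) blast
  obtain N' where N': "\<And>M. M \<ge> N' \<Longrightarrow> g = (\<Oplus>\<^bsub>R\<^esub>d\<in>{..<M}. component d g)"
    by (rule component_bound[OF g]) blast
  show ?thesis
    using N[of "max N N'"] N'[of "max N N'"] by (simp add: eq)
qed

section \<open>Multiplication by x_0 on R\<close>

lemma x0_nonzerodivisor:
  assumes "f \<in> carrier R" "x \<otimes>\<^bsub>R\<^esub> f = \<zero>\<^bsub>R\<^esub>"
  shows "f = \<zero>\<^bsub>R\<^esub>"
proof -
  obtain p where p: "p \<in> carrier P" "f = cls p" using assms(1) by (rule carrier_R_cases)
  have V: "Var 0 \<in> carrier P" by simp
  have "cls (Var 0 * p) = \<zero>\<^bsub>R\<^esub>"
    using assms(2) p V by (simp add: x0_def cls_hom(2))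
  then have "Var 0 * p \<in> I" using p V by (simp add: cls_eq_zero_iff)
  then show ?thesis
    using Var0_nonzerodivisor p by (simp add: cls_eq_zero_iff)
qed

lemma x0_pow_cancel:
  assumes "f \<in> carrier R" "g \<in> carrier R" "x [^]\<^bsub>R\<^esub> (d::nat) \<otimes>\<^bsub>R\<^esub> f = x [^]\<^bsub>R\<^esub> d \<otimes>\<^bsub>R\<^esub> g"
  shows "f = g"
proof -
  have "h = \<zero>\<^bsub>R\<^esub>" if "h \<in> carrier R" "x [^]\<^bsub>R\<^esub> d \<otimes>\<^bsub>R\<^esub> h = \<zero>\<^bsub>R\<^esub>" for h
    using that
  proof (induction d arbitrary: h)
    case (Suc d)
    then have "x [^]\<^bsub>R\<^esub> d \<otimes>\<^bsub>R\<^esub> (x \<otimes>\<^bsub>R\<^esub> h) = \<zero>\<^bsub>R\<^esub>" by (simp add: R.m_assoc)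
    then have "x \<otimes>\<^bsub>R\<^esub> h = \<zero>\<^bsub>R\<^esub>" using Suc by simp
    then show ?case using x0_nonzerodivisor Suc.prems(1) by blast
  qed simp
  moreover have "x [^]\<^bsub>R\<^esub> d \<otimes>\<^bsub>R\<^esub> (f \<ominus>\<^bsub>R\<^esub> g) = \<zero>\<^bsub>R\<^esub>"
    using assms by (simp add: a_minus_def R.r_distr R.r_minus R.r_neg)
  ultimately have "f \<ominus>\<^bsub>R\<^esub> g = \<zero>\<^bsub>R\<^esub>" using assms by simp
  then show ?thesis using assms by simp
qed

text \<open>From this degree on, multiplication by $x_0$ is surjective on the graded parts of $R$.\<close>

definition k0 :: nat where
  "k0 = (SOME k. \<forall>d\<ge>k. \<forall>g\<in>part (Suc d). \<exists>h\<in>part d. g = x \<otimes>\<^bsub>R\<^esub> h)"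

lemma part_Suc:
  assumes "d \<ge> k0" "g \<in> part (Suc d)"
  obtains h where "h \<in> part d" "g = x \<otimes>\<^bsub>R\<^esub> h"
proof -
  obtain k where k: "\<And>d g. d \<ge> k \<Longrightarrow> g \<in> forms n (Suc d) \<Longrightarrow> \<exists>h\<in>forms n d. g - Var 0 * h \<in> I"
    using forms_Suc_decomposition by blast
  have "\<exists>h\<in>part d. g = x \<otimes>\<^bsub>R\<^esub> h" if d: "d \<ge> k" and g: "g \<in> part (Suc d)" for d g
  proof -
    obtain p where p: "p \<in> forms n (Suc d)" "g = cls p" using g by (rule part_cases)
    obtain h where h: "h \<in> forms n d" "p - Var 0 * h \<in> I" using k[OF d p(1)] by blast
    have V: "Var 0 \<in> carrier P" by simp
    have "g = cls (Var 0 * h)"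
      using h p V forms_closed[OF h(1)] forms_closed[OF p(1)] by (simp add: cls_eq_iff)
    also have "\<dots> = x \<otimes>\<^bsub>R\<^esub> cls h"
      using V forms_closed[OF h(1)] by (simp add: x0_def cls_hom(2))
    finally show ?thesis using cls_part[OF h(1)] by blast
  qed
  then have "\<exists>k. \<forall>d\<ge>k. \<forall>g\<in>part (Suc d). \<exists>h\<in>part d. g = x \<otimes>\<^bsub>R\<^esub> h" by blast
  then have "\<forall>d\<ge>k0. \<forall>g\<in>part (Suc d). \<exists>h\<in>part d. g = x \<otimes>\<^bsub>R\<^esub> h"
    unfolding k0_def by (rule someI_ex)
  then show ?thesis using assms that by blast
qed

lemma part_above_k0:
  assumes "k0 \<le> j" "g \<in> part (j + i)"
  obtains h where "h \<in> part j" "g = x [^]\<^bsub>R\<^esub> i \<otimes>\<^bsub>R\<^esub> h"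
  using assms(2)
proof (induction i arbitrary: g thesis)
  case 0
  then show ?case using part_closed by auto
next
  case (Suc i)
  have "k0 \<le> j + i" "g \<in> part (Suc (j + i))" using Suc.prems(2) assms(1) by simp_all
  then obtain g' where g': "g' \<in> part (j + i)" "g = x \<otimes>\<^bsub>R\<^esub> g'"
    by (rule part_Suc)
  then obtain h where "h \<in> part j" "g' = x [^]\<^bsub>R\<^esub> i \<otimes>\<^bsub>R\<^esub> h" using Suc.IH by blast
  then show ?case
    using Suc.prems(1)[of h] g' part_closed by (simp add: R.m_assoc R.m_comm R.m_lcomm)
qed

section \<open>Finite-dimensional graded parts over K\<close>

abbreviation "Kring \<equiv> ring_of_type_algebra :: 'k ring"

lemma Const_add: "Const (a + b) = Const a + (Const b :: 'k mpoly)"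
  by (simp add: Const_def single_add)

lemma Const_mult: "Const (a * b) = Const a * (Const b :: 'k mpoly)"
  by (simp add: Const_def mult_single)

lemma Const_1: "Const 1 = (1 :: 'k mpoly)"
  by (simp add: Const_def)

sublocale K: Ring.field Kring by (rule field_from_type_algebra)

lemma carrier_Kring [simp]: "carrier Kring = UNIV"
  by (simp add: ring_of_type_algebra_def)

sublocale const: ring_hom_cring Kring R "coord_const n I"
proof (rule ring_hom_cringI)
  show "coord_const n I \<in> ring_hom Kring R"
    by (rule ring_hom_memI)
      (simp_all add: coord_const_def Const_add Const_mult Const_1 cls_hom ring_of_type_algebra_def)
qed unfold_locales

abbreviation "K \<equiv> range (coord_const n I)"

lemma subfield_K: "subfield K R"
  using const.ring.img_is_subfield(2)[OF K.carrier_is_subfield one_not_zero] by simp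

lemma subalgebra_part: "subalgebra K (part d) R"
proof -
  have "subgroup (part d) (add_monoid R)"
    using zero_part[of d] by (intro R.add.subgroupI) (auto intro: part_closed part_add part_uminus simp flip: a_inv_def
        simp del: zero_part)
  moreover have "c \<otimes>\<^bsub>R\<^esub> f \<in> part d" if "c \<in> K" "f \<in> part d" for c f
    using that part_mult[OF const_part, of f d] by auto
  ultimately show ?thesis by (simp add: subalgebra_def subalgebra_axioms_def)
qed

text \<open>A monomial is determined by its exponents at 0, ..., n, each of which is at most
  d.\<close>

lemma finite_monomials: "finite {m. Poly_Mapping.keys m \<subseteq> {..n} \<and> mdeg m = d}" (is "finite ?M")
proof -
  have "finite (({..n} \<rightarrow>\<^sub>E {..d}) :: (nat \<Rightarrow> nat) set)" by (intro finite_PiE) auto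
  moreover have "(\<lambda>m. restrict (Poly_Mapping.lookup m) {..n}) ` ?M \<subseteq> {..n} \<rightarrow>\<^sub>E {..d}"
  proof -
    have "Poly_Mapping.lookup m i \<le> mdeg m" for m i
    proof (cases "i \<in> Poly_Mapping.keys m")
      case True
      then show ?thesis unfolding mdeg_def by (intro member_le_sum) auto
    qed (simp add: in_keys_iff)
    then show ?thesis by (auto simp: PiE_def)
  qed
  moreover have "inj_on (\<lambda>m. restrict (Poly_Mapping.lookup m) {..n}) ?M"
  proof (rule inj_onI)
    fix a b :: "nat \<Rightarrow>\<^sub>0 nat"
    assume *: "a \<in> ?M" "b \<in> ?M" "restrict (Poly_Mapping.lookup a) {..n} = restrict (Poly_Mapping.lookup b) {..n}"
    show "a = b"
    proof (rule poly_mapping_eqI)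
      fix i show "Poly_Mapping.lookup a i = Poly_Mapping.lookup b i"
      proof (cases "i \<le> n")
        case True
        then show ?thesis using fun_cong[OF *(3), of i] by simp
      next
        case False
        then have "i \<notin> Poly_Mapping.keys a" "i \<notin> Poly_Mapping.keys b" using *(1,2) by auto
        then show ?thesis by (simp add: in_keys_iff)
      qed
    qed
  qed
  ultimately show ?thesis using finite_imageD finite_subset by blast
qed

lemma finite_dimension_part: "R.finite_dimension K (part d)"
proof -
  obtain ms where ms: "set ms = {m. Poly_Mapping.keys m \<subseteq> {..n} \<and> mdeg m = d}"
    using finite_list[OF finite_monomials] by blast
  define Us where "Us = map (\<lambda>m. cls (Poly_Mapping.single m 1)) ms"
  have Us: "set Us \<subseteq> carrier R"
    using ms by (auto simp: Us_def mem_mpoly_ring intro!: cls_closed)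
  have "part d \<subseteq> R.Span K Us"
  proof
    fix f assume "f \<in> part d"
    then obtain p where p: "p \<in> forms n d" "p \<in> carrier P" "f = cls p" by (rule part_cases)
    have mon: "cls (Poly_Mapping.single m c) \<in> R.Span K Us" if m: "m \<in> Poly_Mapping.keys p" for m c
    proof -
      have "m \<in> set ms" using p m ms by (auto simp: forms_def mem_mpoly_ring)
      then have "cls (Poly_Mapping.single m 1) \<in> R.Span K Us" 
        using R.Span_base_incl[OF subfield_K Us] by (auto simp: Us_def)
      then have "coord_const n I c \<otimes>\<^bsub>R\<^esub> cls (Poly_Mapping.single m 1) \<in> R.Span K Us"
        using R.Span_smult_closed[OF subfield_K Us] by blast
      moreover have "Poly_Mapping.single m 1 \<in> carrier P"
        using \<open>m \<in> set ms\<close> ms by (auto simp: mem_mpoly_ring)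
      then have "coord_const n I c \<otimes>\<^bsub>R\<^esub> cls (Poly_Mapping.single m 1) = cls (Poly_Mapping.single m c)"
        using cls_hom(2)[of "Const c" "Poly_Mapping.single m 1"] Const_closed[of c n]
        by (simp add: coord_const_def Const_def mult_single)
      ultimately show ?thesis by metis
    qed
    have single: "Poly_Mapping.single m c \<in> carrier P" if "m \<in> Poly_Mapping.keys p" for m c
      using that p by (auto simp: mem_mpoly_ring)
    have "f = (\<Oplus>\<^bsub>R\<^esub>m\<in>Poly_Mapping.keys p. cls (Poly_Mapping.single m (Poly_Mapping.lookup p m)))"
      using p mpoly_sum_monomials[of p] cls_sum[OF finite_keys, of p "\<lambda>m. Poly_Mapping.single m (Poly_Mapping.lookup p m)"] single
      by metis
    also have "\<dots> \<in> R.Span K Us"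
    proof -
      have "(\<Oplus>\<^bsub>R\<^esub>m\<in>A. g m) \<in> R.Span K Us" if "finite A" "\<And>m. m \<in> A \<Longrightarrow> g m \<in> R.Span K Us"
        for A and g :: "(nat \<Rightarrow>\<^sub>0 nat) \<Rightarrow> 'k mpoly set"
        using that
      proof (induction A rule: finite_induct)
        case empty
        then show ?case using R.Span_subgroup_props(2)[OF subfield_K Us] by simp
      next
        case (insert a A)
        then have "g \<in> insert a A \<rightarrow> carrier R" using R.Span_in_carrier[OF subfieldE(3)[OF subfield_K] Us] by blast
        then show ?case
          using insert R.Span_subgroup_props(3)[OF subfield_K Us] by (simp add: R.finsum_insert Pi_def)
      qed
      then show ?thesis using mon by simp
    qed
    finally show "f \<in> R.Span K Us" .
  qed
  then show ?thesis
    using R.subalbegra_incl_imp_finite_dimension[OF subfield_K R.Span_finite_dimension[OF subfield_K Us] subalgebra_part]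
    by blast
qed

section \<open>Dehomogenization and the map $\psi$\<close>

abbreviation "S \<equiv> deh_ring n I"
abbreviation "U \<equiv> Sx0 n I"
abbreviation "dh \<equiv> deh n I"

lemma ideal_deh: "ideal (deh_ideal n I) R"
  unfolding deh_ideal_def by (rule R.cgenideal_ideal) simp

sublocale S: cring S
  unfolding deh_ring_def by (rule ideal.quotient_is_cring[OF ideal_deh R.cring_axioms])

sublocale dh: ring_hom_cring R S dh
proof -
  have "dh = (\<lambda>f. deh_ideal n I +>\<^bsub>R\<^esub> f)" by (simp add: deh_def fun_eq_iff)
  then show "ring_hom_cring R S dh"
    unfolding deh_ring_def using ideal.rcos_ring_hom_cring[OF ideal_deh R.cring_axioms] by simp
qed

lemma carrier_S: "carrier S = dh ` carrier R"
  unfolding deh_ring_def deh_def[abs_def] FactRing_simps by auto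

lemma dh_eq_zeroD:
  assumes "f \<in> carrier R" "dh f = \<zero>\<^bsub>S\<^esub>"
  obtains g where "g \<in> carrier R" "f = g \<otimes>\<^bsub>R\<^esub> x \<ominus>\<^bsub>R\<^esub> g"
proof -
  have "deh_ideal n I +>\<^bsub>R\<^esub> f = deh_ideal n I"
    using assms(2) by (simp add: deh_def deh_ring_def FactRing_def)
  then have "f \<in> deh_ideal n I"
    using ideal.rcos_const_imp_mem[OF ideal_deh assms(1)] by blast
  then obtain g where g: "g \<in> carrier R" "f = g \<otimes>\<^bsub>R\<^esub> (x \<ominus>\<^bsub>R\<^esub> \<one>\<^bsub>R\<^esub>)"
    by (auto simp: deh_ideal_def cgenideal_def)
  then have "f = g \<otimes>\<^bsub>R\<^esub> x \<ominus>\<^bsub>R\<^esub> g"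
    by (simp add: a_minus_def R.r_distr R.r_minus)
  with g(1) show ?thesis by (rule that)
qed

lemma dh_x0 [simp]: "dh x = \<one>\<^bsub>S\<^esub>"
proof -
  have "x \<ominus>\<^bsub>R\<^esub> \<one>\<^bsub>R\<^esub> \<in> deh_ideal n I"
    unfolding deh_ideal_def by (rule R.cgenideal_self) simp
  then have "dh x = dh \<one>\<^bsub>R\<^esub>"
    using R.quotient_eq_iff_same_a_r_cos[OF ideal_deh, of x "\<one>\<^bsub>R\<^esub>"] by (simp add: deh_def)
  then show ?thesis by simp
qed

text \<open>In degrees, f = (x_0 - 1) g reads g_e = x_0 g_{e-1}, with an extra -f for e = d. Hence
  g_e = 0 below d and g_{d+j} = x_0^j g_d above. As g has finitely many components and x_0 is a
  non-zerodivisor, g_d = 0, and degree d then gives f = 0.\<close>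

lemma dh_part_eq_zero:
  assumes f: "f \<in> part d" and "dh f = \<zero>\<^bsub>S\<^esub>"
  shows "f = \<zero>\<^bsub>R\<^esub>"
proof -
  obtain g where g: "g \<in> carrier R" "f = g \<otimes>\<^bsub>R\<^esub> x \<ominus>\<^bsub>R\<^esub> g"
    using part_closed[OF f] assms(2) by (rule dh_eq_zeroD)
  have fc: "f \<in> carrier R" by (rule part_closed[OF f])
  \<comment> \<open>The equation is solved for g, so that comparing components gives a
    recursion.\<close>
  have "g = g \<otimes>\<^bsub>R\<^esub> x \<ominus>\<^bsub>R\<^esub> (g \<otimes>\<^bsub>R\<^esub> x \<ominus>\<^bsub>R\<^esub> g)"
    using g(1) x0_closed by algebra
  then have g': "g = g \<otimes>\<^bsub>R\<^esub> x \<ominus>\<^bsub>R\<^esub> f" using g(2) by simp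
  have comp_g: "component e g =
      (if 1 \<le> e then component (e - 1) g \<otimes>\<^bsub>R\<^esub> x else \<zero>\<^bsub>R\<^esub>) \<ominus>\<^bsub>R\<^esub> (if e = d then f else \<zero>\<^bsub>R\<^esub>)" for e
    using arg_cong[OF g', of "component e"] g(1) fc
    by (simp add: component_minus component_mult_part[OF _ x0_part] component_of_part[OF f])
  have below: "component e g = \<zero>\<^bsub>R\<^esub>" if "e < d" for e
    using that
  proof (induction e)
    case 0
    then show ?case using comp_g[of 0] by (simp add: a_minus_def)
  next
    case (Suc e)
    then have IH: "component e g = \<zero>\<^bsub>R\<^esub>" by simp
    show ?case using comp_g[of "Suc e"] Suc.prems by (simp add: IH a_minus_def)
  qed
  have above: "component (d + j) g = x [^]\<^bsub>R\<^esub> j \<otimes>\<^bsub>R\<^esub> component d g" for j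
  proof (induction j)
    case 0
    show ?case using g(1) by simp
  next
    case (Suc j)
    have "component (d + Suc j) g = component (d + j) g \<otimes>\<^bsub>R\<^esub> x"
      using comp_g[of "d + Suc j"] g(1) by (simp add: a_minus_def)
    also have "\<dots> = x [^]\<^bsub>R\<^esub> Suc j \<otimes>\<^bsub>R\<^esub> component d g"
      unfolding Suc using g(1) by (simp add: R.m_ac)
    finally show ?case .
  qed
  obtain N where N: "\<And>d. d \<ge> N \<Longrightarrow> component d g = \<zero>\<^bsub>R\<^esub>"
    using component_bound[OF g(1)] by metis
  have "x [^]\<^bsub>R\<^esub> N \<otimes>\<^bsub>R\<^esub> component d g = \<zero>\<^bsub>R\<^esub>"
    unfolding above[symmetric] by (rule N) simp
  then have "x [^]\<^bsub>R\<^esub> N \<otimes>\<^bsub>R\<^esub> component d g = x [^]\<^bsub>R\<^esub> N \<otimes>\<^bsub>R\<^esub> \<zero>\<^bsub>R\<^esub>"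
    by simp
  then have "component d g = \<zero>\<^bsub>R\<^esub>"
    by (rule x0_pow_cancel[rotated 2]) (use g(1) in simp_all)
  moreover have "(if 1 \<le> d then component (d - 1) g \<otimes>\<^bsub>R\<^esub> x else \<zero>\<^bsub>R\<^esub>) = \<zero>\<^bsub>R\<^esub>"
    using below[of "d - 1"] by simp
  ultimately have "\<ominus>\<^bsub>R\<^esub> f = \<zero>\<^bsub>R\<^esub>"
    using comp_g[of d] fc by (simp add: a_minus_def)
  then have "\<ominus>\<^bsub>R\<^esub> (\<ominus>\<^bsub>R\<^esub> f) = \<ominus>\<^bsub>R\<^esub> \<zero>\<^bsub>R\<^esub>" by simp
  then show ?thesis using fc by simp
qed

lemma dh_eqD:
  assumes f: "f \<in> part d" and g: "g \<in> part d" and "dh f = dh g"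
  shows "f = g"
proof -
  have "dh (f \<ominus>\<^bsub>R\<^esub> g) = \<zero>\<^bsub>S\<^esub>"
    using assms(3) part_closed[OF f] part_closed[OF g] by (simp add: a_minus_def S.r_neg)
  moreover have "f \<ominus>\<^bsub>R\<^esub> g \<in> part d"
    using part_add[OF f part_uminus[OF g]] by (simp add: a_minus_def)
  ultimately have "f \<ominus>\<^bsub>R\<^esub> g = \<zero>\<^bsub>R\<^esub>" by (intro dh_part_eq_zero)
  then show ?thesis using part_closed[OF f] part_closed[OF g] by simp
qed

lemma dh_inj_part: "inj_on dh (part d)"
  by (rule inj_onI) (rule dh_eqD)

lemma finsum_part:
  "finite A \<Longrightarrow> (\<And>i. i \<in> A \<Longrightarrow> f i \<in> part d) \<Longrightarrow> (\<Oplus>\<^bsub>R\<^esub>i\<in>A. f i) \<in> part d"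
proof (induction A rule: finite_induct)
  case (insert a A)
  then have "f \<in> A \<rightarrow> carrier R" "f a \<in> carrier R" by (auto intro: part_closed)
  then show ?case using insert by (simp add: R.finsum_insert part_add)
qed simp

text \<open>Homogenization: padding each component of a representative of s with a power of x_0 up
  to a common degree M changes nothing in S, where x_0 is 1. Division by x_0^{M-d}, possible from
  \<open>k0\<close> on, brings the form down to degree d.\<close>

lemma dh_surj_part:
  assumes "k0 \<le> d" "s \<in> carrier S"
  obtains f where "f \<in> part d" "s = dh f"
proof -
  obtain g where g: "g \<in> carrier R" "s = dh g" using assms(2) unfolding carrier_S by blast
  obtain N where N: "\<And>M. M \<ge> N \<Longrightarrow> g = (\<Oplus>\<^bsub>R\<^esub>d\<in>{..<M}. component d g)"
    using component_bound[OF g(1)] by metis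
  define M where "M = max N d"
  define h where "h = (\<Oplus>\<^bsub>R\<^esub>e\<in>{..<M}. x [^]\<^bsub>R\<^esub> (M - e) \<otimes>\<^bsub>R\<^esub> component e g)"
  have "h \<in> part M"
    unfolding h_def
  proof (rule finsum_part)
    fix e assume "e \<in> {..<M}"
    then show "x [^]\<^bsub>R\<^esub> (M - e) \<otimes>\<^bsub>R\<^esub> component e g \<in> part M"
      using part_mult[OF x0_pow_part component_part[OF g(1)], of "M - e" e] by simp
  qed simp
  moreover have "M = d + (M - d)" by (simp add: M_def)
  ultimately have "h \<in> part (d + (M - d))" by simp
  then obtain f where f: "f \<in> part d" "h = x [^]\<^bsub>R\<^esub> (M - d) \<otimes>\<^bsub>R\<^esub> f"
    using part_above_k0[OF assms(1)] by blast
  have "dh h = (\<Oplus>\<^bsub>S\<^esub>e\<in>{..<M}. dh (component e g))"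
    unfolding h_def using g(1) by (subst dh.hom_finsum) (simp_all add: Pi_def o_def)
  also have "\<dots> = dh (\<Oplus>\<^bsub>R\<^esub>e\<in>{..<M}. component e g)"
    using g(1) by (subst dh.hom_finsum) (simp_all add: Pi_def o_def)
  also have "\<dots> = s"
    using N[of M] g(2) by (simp add: M_def)
  finally have "s = dh f" using f part_closed[OF f(1)] by simp
  with f(1) show ?thesis by (rule that)
qed

section \<open>The dimension of S and the Hilbert function\<close>

lemma S_one_not_zero: "\<one>\<^bsub>S\<^esub> \<noteq> \<zero>\<^bsub>S\<^esub>"
  using dh_part_eq_zero[OF one_part] one_not_zero by auto

abbreviation "KS \<equiv> range (deh_const n I)"

lemma KS_eq: "KS = dh ` K"
  by (auto simp: deh_const_def)

lemma subfield_KS: "subfield KS S"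
  unfolding KS_eq by (rule dh.ring.img_is_subfield(2)[OF subfield_K S_one_not_zero])

lemma dimension_dh_part: "S.dimension (HF n I i) KS (dh ` part i)"
proof -
  have "R.dimension (HF n I i) K (part i)"
    using R.finite_dimensionE[OF subfield_K finite_dimension_part] by (simp add: HF_def over_def)
  then show ?thesis
    unfolding KS_eq by (rule dh.ring.inj_hom_dimension[OF subfield_K S_one_not_zero dh_inj_part])
qed

lemma dh_part_eq_carrier: "k0 \<le> i \<Longrightarrow> dh ` part i = carrier S"
  using dh_surj_part[of i] part_closed by (auto simp: image_iff)

text \<open>From \<open>k0\<close> on, dehomogenization maps R_i bijectively to S. Finiteness of the
  dimension of S is inherited from R_i in this way.\<close>

lemma HF_above_k0:
  assumes "k0 \<le> i"
  shows "HF n I i = scheme_degree n I" "S.dimension (scheme_degree n I) KS (carrier S)"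
proof -
  have "S.dimension (HF n I i) KS (carrier S)"
    using dimension_dh_part[of i] dh_part_eq_carrier[OF assms] by simp
  moreover from this show "HF n I i = scheme_degree n I"
    using S.dimI[OF subfield_KS] by (simp add: scheme_degree_def over_def)
  ultimately show "S.dimension (scheme_degree n I) KS (carrier S)" by simp
qed

lemma dimension_S: "S.dimension (scheme_degree n I) KS (carrier S)"
  by (rule HF_above_k0(2)[OF order_refl])

text \<open>Below \<open>k0\<close> division by x_0 is not at hand, so surjectivity comes from
  counting: the image of R_i has the dimension of S, and a basis of it is a basis of S.\<close>

lemma dh_part_reg_index:
  assumes "reg_index n I \<le> i"
  shows "dh ` part i = carrier S"
proof -
  \<comment> \<open>\<open>k0\<close> witnesses that the condition under \<open>LEAST\<close> can be
    met.\<close>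
  have "\<forall>i\<ge>k0. HF n I i = scheme_degree n I" using HF_above_k0(1) by blast
  then have "\<forall>i\<ge>reg_index n I. HF n I i = scheme_degree n I"
    unfolding reg_index_def by (rule LeastI)
  then have "S.dimension (scheme_degree n I) KS (dh ` part i)"
    using dimension_dh_part[of i] assms by simp
  then obtain Vs where Vs: "set Vs \<subseteq> carrier S" "S.independent KS Vs"
    "length Vs = scheme_degree n I" "S.Span KS Vs = dh ` part i"
    using S.exists_base[OF subfield_KS] by blast
  then show ?thesis
    using S.independent_length_eq_dimension[OF subfield_KS dimension_S Vs(2,1)] by simp
qed

section \<open>The homomorphism psi\<close>

sublocale U: UP_cring S U
  by (intro UP_cring.intro S.cring_axioms)

lemma carrier_U: "carrier U = up S"
  unfolding UP_def by simp

lemma coeff_U: "f \<in> carrier U \<Longrightarrow> up_ring.coeff U f d = f d"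
  unfolding UP_def by simp

lemma psi_closed [simp]:
  assumes "f \<in> carrier R"
  shows "psi n I f \<in> carrier U"
proof -
  obtain N where "\<And>d. d \<ge> N \<Longrightarrow> component d f = \<zero>\<^bsub>R\<^esub>"
    using component_bound[OF assms] by metis
  then have bound: "bound \<zero>\<^bsub>S\<^esub> N (psi n I f)" by (intro bound.intro) (simp add: psi_def)
  have "psi n I f \<in> up S"
  proof (rule mem_upI)
    show "psi n I f d \<in> carrier S" for d using assms by (simp add: psi_def)
    show "\<exists>N. bound \<zero>\<^bsub>S\<^esub> N (psi n I f)" using bound by (rule exI)
  qed
  then show ?thesis by (simp add: carrier_U)
qed

lemma coeff_psi [simp]: "f \<in> carrier R \<Longrightarrow> up_ring.coeff U (psi n I f) d = dh (component d f)"
  by (simp add: coeff_U) (simp add: psi_def)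

lemma psi_of_part:
  assumes "f \<in> part d"
  shows "psi n I f = up_ring.monom U (dh f) d"
  using assms part_closed[OF assms]
  by (intro U.up_eqI) (simp_all add: component_of_part[OF assms])

sublocale psi: ring_hom_cring R U "psi n I"
proof (rule ring_hom_cringI)
  show "psi n I \<in> ring_hom R U"
  proof (rule ring_hom_memI)
    fix f g assume fg: "f \<in> carrier R" "g \<in> carrier R"
    show "psi n I (f \<oplus>\<^bsub>R\<^esub> g) = psi n I f \<oplus>\<^bsub>U\<^esub> psi n I g"
      using fg by (intro U.up_eqI) (simp_all add: component_add)
    have "dh (\<Oplus>\<^bsub>R\<^esub>i\<in>{..d}. component i f \<otimes>\<^bsub>R\<^esub> component (d - i) g) =
        (\<Oplus>\<^bsub>S\<^esub>i\<in>{..d}. dh (component i f) \<otimes>\<^bsub>S\<^esub> dh (component (d - i) g))" for d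
      using fg by (subst dh.hom_finsum) (simp_all add: Pi_def o_def)
    then show "psi n I (f \<otimes>\<^bsub>R\<^esub> g) = psi n I f \<otimes>\<^bsub>U\<^esub> psi n I g"
      using fg by (intro U.up_eqI) (simp_all add: component_mult)
  next
    show "psi n I \<one>\<^bsub>R\<^esub> = \<one>\<^bsub>U\<^esub>"
      using psi_of_part[OF one_part] by simp
  qed simp
qed unfold_locales

lemma psi_inj: "inj_on (psi n I) (carrier R)"
proof (rule inj_onI, rule component_eqI)
  fix f g d assume fg: "f \<in> carrier R" "g \<in> carrier R" "psi n I f = psi n I g"
  then have "dh (component d f) = dh (component d g)" by (metis coeff_psi)
  then show "component d f = component d g"
    using fg by (intro dh_eqD[OF component_part component_part])
qed

lemma psi_x0_pow: "psi n I (x [^]\<^bsub>R\<^esub> (d::nat)) = up_ring.monom U \<one>\<^bsub>S\<^esub> d"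
  using psi_of_part[OF x0_pow_part] by simp

lemma psi_x0: "psi n I x = up_ring.monom U \<one>\<^bsub>S\<^esub> 1"
  using psi_of_part[OF x0_part] by simp

lemma psi_const: "psi n I (coord_const n I c) = Sx0_const n I c"
  using psi_of_part[OF const_part] by (simp add: Sx0_const_def deh_const_def)

lemma psi_struct:
  assumes p: "p \<in> carrier (Kx0 TYPE('k))"
  shows "psi n I (coord_struct n I p) = Sx0_struct n I p"
proof -
  have "psi n I (coord_struct n I p) = (\<Oplus>\<^bsub>U\<^esub>i\<in>{..deg Kring p}.
      psi n I (coord_const n I (up_ring.coeff (UP Kring) p i) \<otimes>\<^bsub>R\<^esub> x [^]\<^bsub>R\<^esub> i))"
    using p unfolding coord_struct_def UnivPoly.eval_def
    by (simp add: psi.hom_finsum Pi_def o_def)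
  also have "\<dots> = Sx0_struct n I p"
    using p unfolding Sx0_struct_def UnivPoly.eval_def
    by (simp add: psi_const psi_x0)
  finally show ?thesis .
qed

lemma coord_struct_closed:
  "p \<in> carrier (Kx0 TYPE('k)) \<Longrightarrow> coord_struct n I p \<in> carrier R"
  unfolding coord_struct_def UnivPoly.eval_def by (simp add: Pi_def)

lemma psi_graded_algebra_hom:
  "graded_algebra_hom (Kx0 TYPE('k)) R (coord_struct n I) part U (Sx0_struct n I) (Sx0_part n I) (psi n I)"
  using part_closed psi_of_part
  by (auto simp: graded_algebra_hom_def psi_struct Sx0_part_def intro: psi.homh)

lemma psi_vector_space_iso:
  assumes "reg_index n I \<le> i"
  shows "vector_space_iso R (coord_const n I) (part i) U (Sx0_const n I) (Sx0_part n I i) (psi n I)"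
proof -
  have "psi n I ` part i = (\<lambda>s. up_ring.monom U s i) ` dh ` part i"
    using psi_of_part by (simp add: image_image cong: image_cong)
  then have "psi n I ` part i = Sx0_part n I i"
    by (simp add: dh_part_reg_index[OF assms] Sx0_part_def)
  moreover have "inj_on (psi n I) (part i)"
    by (rule inj_on_subset[OF psi_inj]) (rule subsetI, rule part_closed)
  ultimately have "bij_betw (psi n I) (part i) (Sx0_part n I i)"
    by (simp add: bij_betw_def)
  then show ?thesis
    by (simp add: vector_space_iso_def part_closed psi_const)
qed

section \<open>The homogeneous ring of quotients\<close>

abbreviation "Q \<equiv> hquot_ring n I"
abbreviation "Z \<equiv> hom_nzd n I"
abbreviation "fr \<equiv> hfrac n I"
abbreviation "emb \<equiv> hquot_embed n I"

lemma nzd_closed: "b \<in> Z \<Longrightarrow> b \<in> carrier R"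
  unfolding hom_nzd_def by (blast intro: part_closed)

lemma nzdD: "b \<in> Z \<Longrightarrow> a \<in> carrier R \<Longrightarrow> a \<otimes>\<^bsub>R\<^esub> b = \<zero>\<^bsub>R\<^esub> \<Longrightarrow> a = \<zero>\<^bsub>R\<^esub>"
  unfolding hom_nzd_def by blast

lemma nzd_part: "b \<in> Z \<Longrightarrow> \<exists>d. b \<in> part d"
  unfolding hom_nzd_def by blast

lemma nzdI: "b \<in> part d \<Longrightarrow> (\<And>a. a \<in> carrier R \<Longrightarrow> a \<otimes>\<^bsub>R\<^esub> b = \<zero>\<^bsub>R\<^esub> \<Longrightarrow> a = \<zero>\<^bsub>R\<^esub>) \<Longrightarrow> b \<in> Z"
  unfolding hom_nzd_def by blast

lemma one_nzd: "\<one>\<^bsub>R\<^esub> \<in> Z"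
  by (rule nzdI[OF one_part]) simp

lemma x0_pow_nzd: "x [^]\<^bsub>R\<^esub> (d::nat) \<in> Z"
proof (rule nzdI[OF x0_pow_part])
  fix a assume "a \<in> carrier R" "a \<otimes>\<^bsub>R\<^esub> x [^]\<^bsub>R\<^esub> d = \<zero>\<^bsub>R\<^esub>"
  then show "a = \<zero>\<^bsub>R\<^esub>"
    using x0_pow_cancel[of a "\<zero>\<^bsub>R\<^esub>" d] by (simp add: R.m_comm)
qed

lemma nzd_mult:
  assumes b: "b \<in> Z" and c: "c \<in> Z"
  shows "b \<otimes>\<^bsub>R\<^esub> c \<in> Z"
proof -
  obtain d e where "b \<in> part d" "c \<in> part e" using nzd_part[OF b] nzd_part[OF c] by blast
  then have "b \<otimes>\<^bsub>R\<^esub> c \<in> part (d + e)" by (rule part_mult)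
  moreover have "a = \<zero>\<^bsub>R\<^esub>" if a: "a \<in> carrier R" "a \<otimes>\<^bsub>R\<^esub> (b \<otimes>\<^bsub>R\<^esub> c) = \<zero>\<^bsub>R\<^esub>" for a
  proof -
    have "(a \<otimes>\<^bsub>R\<^esub> b) \<otimes>\<^bsub>R\<^esub> c = \<zero>\<^bsub>R\<^esub>"
      using a nzd_closed[OF b] nzd_closed[OF c] by (simp add: R.m_assoc)
    then have "a \<otimes>\<^bsub>R\<^esub> b = \<zero>\<^bsub>R\<^esub>" by (rule nzdD[OF c, rotated]) (simp add: a nzd_closed[OF b])
    then show ?thesis by (rule nzdD[OF b a(1)])
  qed
  ultimately show ?thesis by (rule nzdI)
qed

lemma nzd_cancel:
  assumes "a \<in> carrier R" "c \<in> carrier R" "b \<in> Z" "a \<otimes>\<^bsub>R\<^esub> b = c \<otimes>\<^bsub>R\<^esub> b"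
  shows "a = c"
proof -
  have b: "b \<in> carrier R" by (rule nzd_closed[OF assms(3)])
  have "(a \<ominus>\<^bsub>R\<^esub> c) \<otimes>\<^bsub>R\<^esub> b = \<zero>\<^bsub>R\<^esub>"
    using assms(1,2) b by (simp add: a_minus_def R.l_distr R.l_minus assms(4) R.r_neg)
  then have "a \<ominus>\<^bsub>R\<^esub> c = \<zero>\<^bsub>R\<^esub>"
    by (rule nzdD[OF assms(3), rotated]) (simp add: assms(1,2))
  then show ?thesis using assms(1,2) by simp
qed

lemma hfrac_mem_iff:
  "(c, d) \<in> fr a b \<longleftrightarrow> c \<in> carrier R \<and> d \<in> Z \<and> a \<otimes>\<^bsub>R\<^esub> d = c \<otimes>\<^bsub>R\<^esub> b"
  by (simp add: hfrac_def)

lemma hfrac_eq_iff: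
  assumes a: "a \<in> carrier R" and b: "b \<in> Z" and c: "c \<in> carrier R" and d: "d \<in> Z"
  shows "fr a b = fr c d \<longleftrightarrow> a \<otimes>\<^bsub>R\<^esub> d = c \<otimes>\<^bsub>R\<^esub> b"
proof
  assume eq: "fr a b = fr c d"
  have "(c, d) \<in> fr a b" unfolding eq using c d by (simp add: hfrac_mem_iff)
  then show "a \<otimes>\<^bsub>R\<^esub> d = c \<otimes>\<^bsub>R\<^esub> b" by (simp add: hfrac_mem_iff)
next
  have sub: "fr a b \<subseteq> fr c d"
    if a: "a \<in> carrier R" and b: "b \<in> Z" and c: "c \<in> carrier R" and d: "d \<in> Z"
      and eq: "a \<otimes>\<^bsub>R\<^esub> d = c \<otimes>\<^bsub>R\<^esub> b" for a b c d
  proof (rule subrelI)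
    fix e f assume "(e, f) \<in> fr a b"
    then have e: "e \<in> carrier R" and f: "f \<in> Z" and eq': "a \<otimes>\<^bsub>R\<^esub> f = e \<otimes>\<^bsub>R\<^esub> b"
      by (simp_all add: hfrac_mem_iff)
    note [simp] = nzd_closed[OF b] nzd_closed[OF d] nzd_closed[OF f] a c e
    \<comment> \<open>Transitivity of the fraction relation: the identity is proved after
      multiplication by b, which is then cancelled as a non-zerodivisor.\<close>
    have "(c \<otimes>\<^bsub>R\<^esub> f) \<otimes>\<^bsub>R\<^esub> b = (c \<otimes>\<^bsub>R\<^esub> b) \<otimes>\<^bsub>R\<^esub> f" by (simp add: R.m_ac)
    also have "\<dots> = (a \<otimes>\<^bsub>R\<^esub> f) \<otimes>\<^bsub>R\<^esub> d" by (simp add: R.m_ac flip: eq)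
    also have "\<dots> = (e \<otimes>\<^bsub>R\<^esub> d) \<otimes>\<^bsub>R\<^esub> b" unfolding eq' by (simp add: R.m_ac)
    finally have "c \<otimes>\<^bsub>R\<^esub> f = e \<otimes>\<^bsub>R\<^esub> d" by (rule nzd_cancel[OF _ _ b, rotated 2]) simp_all
    then show "(e, f) \<in> fr c d" using f by (simp add: hfrac_mem_iff)
  qed
  assume "a \<otimes>\<^bsub>R\<^esub> d = c \<otimes>\<^bsub>R\<^esub> b"
  then show "fr a b = fr c d"
    using sub[OF a b c d] sub[OF c d a b] by auto
qed

lemma hfrac_memD:
  assumes "(c, d) \<in> fr a b" "a \<in> carrier R" "b \<in> Z"
  shows "c \<in> carrier R" "d \<in> Z" "fr c d = fr a b"
proof -
  show c: "c \<in> carrier R" and d: "d \<in> Z" using assms(1) by (simp_all add: hfrac_mem_iff)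
  show "fr c d = fr a b"
    using assms(1) hfrac_eq_iff[OF assms(2,3) c d] by (simp add: hfrac_mem_iff)
qed

lemma hfrac_self: "a \<in> carrier R \<Longrightarrow> b \<in> Z \<Longrightarrow> (a, b) \<in> fr a b"
  by (simp add: hfrac_mem_iff)

text \<open>Sums and products in Q are unions over all pairs of representatives. Once the resulting
  class does not depend on the representatives, the union collapses to that class.\<close>

lemma hfrac_UN_UN_eqI:
  assumes ab: "a \<in> carrier R" "b \<in> Z" and cd: "c \<in> carrier R" "d \<in> Z"
    and eq: "\<And>a' b' c' d'. (a', b') \<in> fr a b \<Longrightarrow> (c', d') \<in> fr c d \<Longrightarrow> F a' b' c' d' = F a b c d"
  shows "(\<Union>(a, b)\<in>fr a b. \<Union>(c, d)\<in>fr c d. F a b c d) = F a b c d"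
proof -
  have "(\<Union>(c', d')\<in>fr c d. F a' b' c' d') = F a b c d" if "(a', b') \<in> fr a b" for a' b'
    using eq[OF that] hfrac_self[OF cd] by auto
  then show ?thesis using hfrac_self[OF ab] by auto
qed

lemma Q_simps:
  "carrier Q = {fr a b | a b. a \<in> carrier R \<and> b \<in> Z}"
  "\<one>\<^bsub>Q\<^esub> = fr \<one>\<^bsub>R\<^esub> \<one>\<^bsub>R\<^esub>"
  "\<zero>\<^bsub>Q\<^esub> = fr \<zero>\<^bsub>R\<^esub> \<one>\<^bsub>R\<^esub>"
  by (simp_all add: hquot_ring_def)

lemma hfrac_mult:
  assumes a: "a \<in> carrier R" and b: "b \<in> Z" and c: "c \<in> carrier R" and d: "d \<in> Z"
  shows "fr a b \<otimes>\<^bsub>Q\<^esub> fr c d = fr (a \<otimes>\<^bsub>R\<^esub> c) (b \<otimes>\<^bsub>R\<^esub> d)"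
proof -
  have "fr (a' \<otimes>\<^bsub>R\<^esub> c') (b' \<otimes>\<^bsub>R\<^esub> d') = fr (a \<otimes>\<^bsub>R\<^esub> c) (b \<otimes>\<^bsub>R\<^esub> d)"
    if 1: "(a', b') \<in> fr a b" and 2: "(c', d') \<in> fr c d" for a' b' c' d'
  proof -
    note 1 = hfrac_memD[OF 1 a b] and 2 = hfrac_memD[OF 2 c d]
    note [simp] = a c 1(1) 2(1) b[THEN nzd_closed] d[THEN nzd_closed] 1(2)[THEN nzd_closed] 2(2)[THEN nzd_closed]
    have "a' \<otimes>\<^bsub>R\<^esub> b = a \<otimes>\<^bsub>R\<^esub> b'" "c' \<otimes>\<^bsub>R\<^esub> d = c \<otimes>\<^bsub>R\<^esub> d'"
      using 1 2 a b c d by (simp_all add: hfrac_eq_iff)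
    then have "(a' \<otimes>\<^bsub>R\<^esub> b) \<otimes>\<^bsub>R\<^esub> (c' \<otimes>\<^bsub>R\<^esub> d) = (a \<otimes>\<^bsub>R\<^esub> b') \<otimes>\<^bsub>R\<^esub> (c \<otimes>\<^bsub>R\<^esub> d')" by simp
    then have "(a' \<otimes>\<^bsub>R\<^esub> c') \<otimes>\<^bsub>R\<^esub> (b \<otimes>\<^bsub>R\<^esub> d) = (a \<otimes>\<^bsub>R\<^esub> c) \<otimes>\<^bsub>R\<^esub> (b' \<otimes>\<^bsub>R\<^esub> d')"
      by (simp add: R.m_ac)
    then show ?thesis
      using hfrac_eq_iff[of "a' \<otimes>\<^bsub>R\<^esub> c'" "b' \<otimes>\<^bsub>R\<^esub> d'" "a \<otimes>\<^bsub>R\<^esub> c" "b \<otimes>\<^bsub>R\<^esub> d"]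
        nzd_mult[OF b d] nzd_mult[OF 1(2) 2(2)] by simp
  qed
  then show ?thesis
    unfolding hquot_ring_def monoid.simps by (rule hfrac_UN_UN_eqI[OF a b c d])
qed

lemma hfrac_add:
  assumes a: "a \<in> carrier R" and b: "b \<in> Z" and c: "c \<in> carrier R" and d: "d \<in> Z"
  shows "fr a b \<oplus>\<^bsub>Q\<^esub> fr c d = fr (a \<otimes>\<^bsub>R\<^esub> d \<oplus>\<^bsub>R\<^esub> c \<otimes>\<^bsub>R\<^esub> b) (b \<otimes>\<^bsub>R\<^esub> d)"
proof -
  have "fr (a' \<otimes>\<^bsub>R\<^esub> d' \<oplus>\<^bsub>R\<^esub> c' \<otimes>\<^bsub>R\<^esub> b') (b' \<otimes>\<^bsub>R\<^esub> d') = fr (a \<otimes>\<^bsub>R\<^esub> d \<oplus>\<^bsub>R\<^esub> c \<otimes>\<^bsub>R\<^esub> b) (b \<otimes>\<^bsub>R\<^esub> d)"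
    if 1: "(a', b') \<in> fr a b" and 2: "(c', d') \<in> fr c d" for a' b' c' d'
  proof -
    note 1 = hfrac_memD[OF 1 a b] and 2 = hfrac_memD[OF 2 c d]
    note [simp] = a c 1(1) 2(1) b[THEN nzd_closed] d[THEN nzd_closed] 1(2)[THEN nzd_closed] 2(2)[THEN nzd_closed]
    have eq: "a' \<otimes>\<^bsub>R\<^esub> b = a \<otimes>\<^bsub>R\<^esub> b'" "c' \<otimes>\<^bsub>R\<^esub> d = c \<otimes>\<^bsub>R\<^esub> d'"
      using 1 2 a b c d by (simp_all add: hfrac_eq_iff)
    have "(a' \<otimes>\<^bsub>R\<^esub> d' \<oplus>\<^bsub>R\<^esub> c' \<otimes>\<^bsub>R\<^esub> b') \<otimes>\<^bsub>R\<^esub> (b \<otimes>\<^bsub>R\<^esub> d) =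
        (a' \<otimes>\<^bsub>R\<^esub> b) \<otimes>\<^bsub>R\<^esub> (d' \<otimes>\<^bsub>R\<^esub> d) \<oplus>\<^bsub>R\<^esub> (c' \<otimes>\<^bsub>R\<^esub> d) \<otimes>\<^bsub>R\<^esub> (b' \<otimes>\<^bsub>R\<^esub> b)"
      by (simp add: R.l_distr R.r_distr R.m_ac)
    also have "\<dots> = (a \<otimes>\<^bsub>R\<^esub> d \<oplus>\<^bsub>R\<^esub> c \<otimes>\<^bsub>R\<^esub> b) \<otimes>\<^bsub>R\<^esub> (b' \<otimes>\<^bsub>R\<^esub> d')"
      unfolding eq by (simp add: R.l_distr R.r_distr R.m_ac)
    finally show ?thesis
      using hfrac_eq_iff[of "a' \<otimes>\<^bsub>R\<^esub> d' \<oplus>\<^bsub>R\<^esub> c' \<otimes>\<^bsub>R\<^esub> b'" "b' \<otimes>\<^bsub>R\<^esub> d'" "a \<otimes>\<^bsub>R\<^esub> d \<oplus>\<^bsub>R\<^esub> c \<otimes>\<^bsub>R\<^esub> b" "b \<otimes>\<^bsub>R\<^esub> d"]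
        nzd_mult[OF b d] nzd_mult[OF 1(2) 2(2)] by simp
  qed
  then show ?thesis
    unfolding hquot_ring_def ring_record_simps by (rule hfrac_UN_UN_eqI[OF a b c d])
qed

lemma hfrac_closed: "a \<in> carrier R \<Longrightarrow> b \<in> Z \<Longrightarrow> fr a b \<in> carrier Q"
  unfolding Q_simps by blast

lemma Q_cases:
  assumes "z \<in> carrier Q" obtains a b where "a \<in> carrier R" "b \<in> Z" "z = fr a b"
  using assms unfolding Q_simps by blast

lemma cring_Q: "cring Q"
proof -
  note frac = hfrac_mult hfrac_add hfrac_eq_iff hfrac_closed Q_simps(2,3) nzd_mult one_nzd
    nzd_closed
  note norm = R.l_distr R.r_distr R.m_ac R.a_ac
  show ?thesis
  proof (rule cringI)
    show "abelian_group Q"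
    proof (rule abelian_groupI)
      fix u assume "u \<in> carrier Q"
      then obtain a b where u: "a \<in> carrier R" "b \<in> Z" "u = fr a b" by (rule Q_cases)
      show "\<zero>\<^bsub>Q\<^esub> \<oplus>\<^bsub>Q\<^esub> u = u"
        using u(1,2) unfolding u(3) by (simp add: frac)
      have "fr (\<ominus>\<^bsub>R\<^esub> a) b \<oplus>\<^bsub>Q\<^esub> u = \<zero>\<^bsub>Q\<^esub>"
        using u(1,2) unfolding u(3) by (simp add: frac R.l_minus R.l_neg)
      then show "\<exists>y\<in>carrier Q. y \<oplus>\<^bsub>Q\<^esub> u = \<zero>\<^bsub>Q\<^esub>"
        by (rule bexI) (simp add: u frac)
      fix v assume "v \<in> carrier Q"
      then obtain c d where v: "c \<in> carrier R" "d \<in> Z" "v = fr c d" by (rule Q_cases)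
      show "u \<oplus>\<^bsub>Q\<^esub> v \<in> carrier Q"
        using u(1,2) v(1,2) unfolding u(3) v(3) by (simp add: frac)
      show "u \<oplus>\<^bsub>Q\<^esub> v = v \<oplus>\<^bsub>Q\<^esub> u"
        using u(1,2) v(1,2) unfolding u(3) v(3) by (simp add: frac norm)
      fix w assume "w \<in> carrier Q"
      then obtain e f where w: "e \<in> carrier R" "f \<in> Z" "w = fr e f" by (rule Q_cases)
      show "(u \<oplus>\<^bsub>Q\<^esub> v) \<oplus>\<^bsub>Q\<^esub> w = u \<oplus>\<^bsub>Q\<^esub> (v \<oplus>\<^bsub>Q\<^esub> w)"
        using u(1,2) v(1,2) w(1,2) unfolding u(3) v(3) w(3) by (simp add: frac norm)
    qed (simp add: frac)
    show "Group.comm_monoid Q"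
    proof (rule comm_monoidI)
      fix u assume "u \<in> carrier Q"
      then obtain a b where u: "a \<in> carrier R" "b \<in> Z" "u = fr a b" by (rule Q_cases)
      show "\<one>\<^bsub>Q\<^esub> \<otimes>\<^bsub>Q\<^esub> u = u"
        using u(1,2) unfolding u(3) by (simp add: frac)
      fix v assume "v \<in> carrier Q"
      then obtain c d where v: "c \<in> carrier R" "d \<in> Z" "v = fr c d" by (rule Q_cases)
      show "u \<otimes>\<^bsub>Q\<^esub> v \<in> carrier Q"
        using u(1,2) v(1,2) unfolding u(3) v(3) by (simp add: frac)
      show "u \<otimes>\<^bsub>Q\<^esub> v = v \<otimes>\<^bsub>Q\<^esub> u"
        using u(1,2) v(1,2) unfolding u(3) v(3) by (simp add: frac norm)
      fix w assume "w \<in> carrier Q"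
      then obtain e f where w: "e \<in> carrier R" "f \<in> Z" "w = fr e f" by (rule Q_cases)
      show "(u \<otimes>\<^bsub>Q\<^esub> v) \<otimes>\<^bsub>Q\<^esub> w = u \<otimes>\<^bsub>Q\<^esub> (v \<otimes>\<^bsub>Q\<^esub> w)"
        using u(1,2) v(1,2) w(1,2) unfolding u(3) v(3) w(3) by (simp add: frac norm)
    qed (simp add: frac)
    fix u v w assume "u \<in> carrier Q" "v \<in> carrier Q" "w \<in> carrier Q"
    then obtain a b c d e f where u: "a \<in> carrier R" "b \<in> Z" "u = fr a b"
      and v: "c \<in> carrier R" "d \<in> Z" "v = fr c d" and w: "e \<in> carrier R" "f \<in> Z" "w = fr e f"
      by (metis Q_cases)
    show "(u \<oplus>\<^bsub>Q\<^esub> v) \<otimes>\<^bsub>Q\<^esub> w = u \<otimes>\<^bsub>Q\<^esub> w \<oplus>\<^bsub>Q\<^esub> v \<otimes>\<^bsub>Q\<^esub> w"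
      using u(1,2) v(1,2) w(1,2) unfolding u(3) v(3) w(3) by (simp add: frac norm)
  qed
qed

sublocale Q: cring Q by (rule cring_Q)

sublocale emb: ring_hom_cring R Q emb
proof (rule ring_hom_cringI)
  show "emb \<in> ring_hom R Q"
    by (rule ring_hom_memI)
      (simp_all add: hquot_embed_def hfrac_closed hfrac_mult hfrac_add Q_simps(2) one_nzd)
qed unfold_locales

lemma hfrac_mult_denominator:
  assumes "a \<in> carrier R" "b \<in> Z"
  shows "emb b \<otimes>\<^bsub>Q\<^esub> fr a b = emb a"
  using assms by (simp add: hquot_embed_def hfrac_mult hfrac_eq_iff nzd_mult nzd_closed one_nzd R.m_comm)

text \<open>In a finite-dimensional algebra a non-zerodivisor is a unit. That t =
  \<open>dh b\<close> is a non-zerodivisor of S follows by lifting s with t s = 0 to R_{k0}, where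
  the product with b already vanishes. Comparing dehomogenizations in degree j + k0 then gives b c =
  x_0^{j+k0}, the divisibility that the name refers to.\<close>

lemma nzd_divides_x0_pow:
  assumes b: "b \<in> Z" "b \<in> part j"
  obtains c where "c \<in> part k0" "dh b \<otimes>\<^bsub>S\<^esub> dh c = \<one>\<^bsub>S\<^esub>"
proof -
  note bR = part_closed[OF b(2)]
  define t where "t = dh b"
  have t: "t \<in> carrier S" using bR by (simp add: t_def)
  have t_nzd: "s = \<zero>\<^bsub>S\<^esub>" if s: "s \<in> carrier S" "t \<otimes>\<^bsub>S\<^esub> s = \<zero>\<^bsub>S\<^esub>" for s
  proof -
    obtain a where a: "a \<in> part k0" "s = dh a" using dh_surj_part[OF order_refl s(1)] by metis
    have "dh (a \<otimes>\<^bsub>R\<^esub> b) = \<zero>\<^bsub>S\<^esub>"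
      using s(2) a bR part_closed[OF a(1)] by (simp add: t_def S.m_comm)
    then have "a \<otimes>\<^bsub>R\<^esub> b = \<zero>\<^bsub>R\<^esub>" by (rule dh_part_eq_zero[OF part_mult[OF a(1) b(2)]])
    then have "a = \<zero>\<^bsub>R\<^esub>" by (rule nzdD[OF b(1) part_closed[OF a(1)]])
    then show ?thesis using a(2) by simp
  qed
  have t_pow_nzd: "s = \<zero>\<^bsub>S\<^esub>" if "s \<in> carrier S" "t [^]\<^bsub>S\<^esub> (i::nat) \<otimes>\<^bsub>S\<^esub> s = \<zero>\<^bsub>S\<^esub>" for s i
    using that
  proof (induction i arbitrary: s)
    case (Suc i)
    then have "t [^]\<^bsub>S\<^esub> i \<otimes>\<^bsub>S\<^esub> (t \<otimes>\<^bsub>S\<^esub> s) = \<zero>\<^bsub>S\<^esub>" using t by (simp add: S.m_assoc)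
    then have "t \<otimes>\<^bsub>S\<^esub> s = \<zero>\<^bsub>S\<^esub>" by (rule Suc.IH[rotated]) (simp add: t Suc.prems)
    then show ?case by (rule t_nzd[OF Suc.prems(1)])
  qed simp
  define N where "N = scheme_degree n I"
  \<comment> \<open>N + 1 powers in a space of dimension N are dependent; the split puts some t^i
    into the span of t^{i+1}, ..., t^N.\<close>
  obtain Vs u Ws where split: "map (\<lambda>i. t [^]\<^bsub>S\<^esub> i) [0..<Suc N] = Vs @ u # Ws" and u: "u \<in> S.Span KS Ws"
    by (rule S.dependent_list_split[OF subfield_KS dimension_S, of "map (\<lambda>i. t [^]\<^bsub>S\<^esub> i) [0..<Suc N]"])
      (use t in \<open>auto simp: N_def simp del: upt_Suc\<close>)
  define i where "i = length Vs"
  have len: "i + Suc (length Ws) = Suc N"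
    using arg_cong[OF split, of length] by (simp add: i_def)
  have nth: "(Vs @ u # Ws) ! j = t [^]\<^bsub>S\<^esub> j" if "j < Suc N" for j
    unfolding split[symmetric] using that by (simp del: upt_Suc)
  have u_eq: "u = t [^]\<^bsub>S\<^esub> i" using nth[of i] len by (simp add: i_def)
  \<comment> \<open>All higher powers lie in the ideal (t^{i+1}), hence so does t^i, without the
    coefficients of the dependence being named. Cancelling t^i from t^i = c t^{i+1} leaves t c =
    1.\<close>
  let ?J = "PIdl\<^bsub>S\<^esub> (t [^]\<^bsub>S\<^esub> Suc i)"
  have J: "ideal ?J S" by (rule S.cgenideal_ideal) (simp add: t)
  have "set Ws \<subseteq> ?J"
  proof
    fix w assume "w \<in> set Ws"
    then obtain l where l: "l < length Ws" "w = Ws ! l" by (auto simp: in_set_conv_nth)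
    then have "w = t [^]\<^bsub>S\<^esub> (Suc i + l)"
      using nth[of "Suc i + l"] len by (simp add: i_def nth_append)
    then have "w = t [^]\<^bsub>S\<^esub> l \<otimes>\<^bsub>S\<^esub> t [^]\<^bsub>S\<^esub> Suc i" by (simp only: S.nat_pow_mult[OF t] add.commute)
    moreover have "t [^]\<^bsub>S\<^esub> l \<in> carrier S" using t by simp
    ultimately show "w \<in> ?J" unfolding cgenideal_def by blast
  qed
  then have "S.Span KS Ws \<subseteq> ?J"
    by (rule S.subalgebra_Span_incl[OF subfield_KS S.ideal_is_subalgebra[OF subfieldE(3)[OF subfield_KS] J]])
  then obtain c where c: "c \<in> carrier S" "t [^]\<^bsub>S\<^esub> i = c \<otimes>\<^bsub>S\<^esub> t [^]\<^bsub>S\<^esub> Suc i"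
    using u unfolding u_eq cgenideal_def by blast
  have "t [^]\<^bsub>S\<^esub> i \<otimes>\<^bsub>S\<^esub> (\<one>\<^bsub>S\<^esub> \<ominus>\<^bsub>S\<^esub> t \<otimes>\<^bsub>S\<^esub> c) = t [^]\<^bsub>S\<^esub> i \<ominus>\<^bsub>S\<^esub> c \<otimes>\<^bsub>S\<^esub> t [^]\<^bsub>S\<^esub> Suc i"
    using t c(1) by (simp add: a_minus_def S.r_distr S.r_minus S.m_ac)
  also have "\<dots> = \<zero>\<^bsub>S\<^esub>" unfolding c(2)[symmetric] using t by simp
  finally have "\<one>\<^bsub>S\<^esub> \<ominus>\<^bsub>S\<^esub> t \<otimes>\<^bsub>S\<^esub> c = \<zero>\<^bsub>S\<^esub>" by (rule t_pow_nzd[rotated]) (simp add: t c(1))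
  then have "t \<otimes>\<^bsub>S\<^esub> c = \<one>\<^bsub>S\<^esub>" using t c(1) by (metis S.m_closed S.one_closed S.r_right_minus_eq)
  moreover obtain c' where "c' \<in> part k0" "c = dh c'" using dh_surj_part[OF order_refl c(1)] by metis
  ultimately show ?thesis using that by (simp add: t_def)
qed

section \<open>The ring $\widetilde R$\<close>

text \<open>Zero has no case of its own: it is the monomial with coefficient 0.\<close>

lemma U_induct [consumes 1, case_names monom add]:
  assumes F: "F \<in> carrier U"
    and monom: "\<And>s d. s \<in> carrier S \<Longrightarrow> Pr (up_ring.monom U s d)"
    and add: "\<And>F G. F \<in> carrier U \<Longrightarrow> G \<in> carrier U \<Longrightarrow> Pr F \<Longrightarrow> Pr G \<Longrightarrow> Pr (F \<oplus>\<^bsub>U\<^esub> G)"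
  shows "Pr F"
proof -
  have sum: "Pr (\<Oplus>\<^bsub>U\<^esub>i\<in>{..d}. up_ring.monom U (up_ring.coeff U F i) i)" for d :: nat
  proof (induction d)
    case 0
    then show ?case using monom[of "up_ring.coeff U F 0" 0] F by (simp add: U.coeff_closed)
  next
    case (Suc d)
    have "(\<Oplus>\<^bsub>U\<^esub>i\<in>{..Suc d}. up_ring.monom U (up_ring.coeff U F i) i) =
        up_ring.monom U (up_ring.coeff U F (Suc d)) (Suc d) \<oplus>\<^bsub>U\<^esub>
        (\<Oplus>\<^bsub>U\<^esub>i\<in>{..d}. up_ring.monom U (up_ring.coeff U F i) i)"
      using F by (simp add: U.coeff_closed Pi_def)
    moreover have "Pr \<dots>"
      using F Suc by (intro add monom U.P.finsum_closed) (simp_all add: U.coeff_closed Pi_def)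
    ultimately show ?case by simp
  qed
  show ?thesis using sum[of "deg S F"] by (simp only: U.up_repr[OF F])
qed

section \<open>Multiplication by powers of x_0 in S[x_0]\<close>

abbreviation "T d \<equiv> up_ring.monom U \<one>\<^bsub>S\<^esub> d"

lemma coeff_T_mult:
  assumes "F \<in> carrier U"
  shows "up_ring.coeff U (F \<otimes>\<^bsub>U\<^esub> T d) (d + i) = up_ring.coeff U F i"
proof -
  have "F \<otimes>\<^bsub>U\<^esub> T d = T d \<otimes>\<^bsub>U\<^esub> F" using assms by (simp add: U.P.m_comm)
  moreover have "up_ring.coeff U (T d \<otimes>\<^bsub>U\<^esub> F) (i + d) = \<one>\<^bsub>S\<^esub> \<otimes>\<^bsub>S\<^esub> up_ring.coeff U F i"
    by (rule U.coeff_monom_mult) (use assms in simp_all)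
  ultimately show ?thesis
    using U.coeff_closed[OF assms, of i] by (simp add: add.commute)
qed

lemma T_cancel:
  assumes "F \<in> carrier U" "G \<in> carrier U" "F \<otimes>\<^bsub>U\<^esub> T d = G \<otimes>\<^bsub>U\<^esub> T d"
  shows "F = G"
proof (rule U.up_eqI[OF _ assms(1,2)])
  show "up_ring.coeff U F i = up_ring.coeff U G i" for i
    using coeff_T_mult[OF assms(1), of d i] coeff_T_mult[OF assms(2), of d i] assms(3) by simp
qed

lemma monom_mult_T: "s \<in> carrier S \<Longrightarrow> up_ring.monom U s d \<otimes>\<^bsub>U\<^esub> T e = up_ring.monom U s (d + e)"
  using U.monom_mult[of s "\<one>\<^bsub>S\<^esub>" d e] by simp

text \<open>The conductor of $\psi(R)$ in $S[x_0]$ contains $x_0^{k_0}$.\<close>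

lemma ex_lift:
  assumes "F \<in> carrier U"
  shows "\<exists>f\<in>carrier R. psi n I f = F \<otimes>\<^bsub>U\<^esub> T k0"
  using assms
proof (induction rule: U_induct)
  case (monom s d)
  \<comment> \<open>The degree of the lift of s supplies exactly the factor x_0^{k0}.\<close>
  obtain a where a: "a \<in> part k0" "s = dh a" using dh_surj_part[OF order_refl monom] by metis
  have "psi n I (x [^]\<^bsub>R\<^esub> d \<otimes>\<^bsub>R\<^esub> a) = up_ring.monom U s (d + k0)"
    using psi_of_part[OF part_mult[OF x0_pow_part a(1)], of d] a part_closed[OF a(1)] by simp
  then show ?case
    using monom_mult_T[OF monom] part_closed[OF a(1)] by (intro bexI[of _ "x [^]\<^bsub>R\<^esub> d \<otimes>\<^bsub>R\<^esub> a"]) simp_all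
next
  case (add F G)
  then obtain f g where fg: "f \<in> carrier R" "g \<in> carrier R"
    "psi n I f = F \<otimes>\<^bsub>U\<^esub> T k0" "psi n I g = G \<otimes>\<^bsub>U\<^esub> T k0" by blast
  then have "psi n I (f \<oplus>\<^bsub>R\<^esub> g) = (F \<oplus>\<^bsub>U\<^esub> G) \<otimes>\<^bsub>U\<^esub> T k0"
    using add by (simp add: U.P.l_distr)
  then show ?case using fg by (intro bexI[of _ "f \<oplus>\<^bsub>R\<^esub> g"]) simp_all
qed

section \<open>The embedding of S[x_0] in the ring of quotients\<close>

definition lift :: "(nat \<Rightarrow> 'k mpoly set set) \<Rightarrow> 'k mpoly set" where
  "lift F = (SOME f. f \<in> carrier R \<and> psi n I f = F \<otimes>\<^bsub>U\<^esub> T k0)"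

lemma lift:
  assumes "F \<in> carrier U"
  shows "lift F \<in> carrier R" "psi n I (lift F) = F \<otimes>\<^bsub>U\<^esub> T k0"
  using someI_ex[OF ex_lift[OF assms, unfolded Bex_def]] by (simp_all add: lift_def)

lemma psi_eqD: "f \<in> carrier R \<Longrightarrow> g \<in> carrier R \<Longrightarrow> psi n I f = psi n I g \<Longrightarrow> f = g"
  using psi_inj by (rule inj_onD)

lemma lift_unique:
  "F \<in> carrier U \<Longrightarrow> f \<in> carrier R \<Longrightarrow> psi n I f = F \<otimes>\<^bsub>U\<^esub> T k0 \<Longrightarrow> lift F = f"
  by (rule psi_eqD) (simp_all add: lift)

lemma lift_add:
  assumes "F \<in> carrier U" "G \<in> carrier U"
  shows "lift (F \<oplus>\<^bsub>U\<^esub> G) = lift F \<oplus>\<^bsub>R\<^esub> lift G"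
  using assms by (intro lift_unique) (simp_all add: lift U.P.l_distr)

text \<open>Each lift carries a factor x_0^{k0}, so the product of two lifts has one more than the
  lift of the product.\<close>

lemma lift_mult:
  assumes "F \<in> carrier U" "G \<in> carrier U"
  shows "lift F \<otimes>\<^bsub>R\<^esub> lift G = lift (F \<otimes>\<^bsub>U\<^esub> G) \<otimes>\<^bsub>R\<^esub> x [^]\<^bsub>R\<^esub> k0"
proof (rule psi_eqD)
  have "psi n I (lift F \<otimes>\<^bsub>R\<^esub> lift G) = (F \<otimes>\<^bsub>U\<^esub> T k0) \<otimes>\<^bsub>U\<^esub> (G \<otimes>\<^bsub>U\<^esub> T k0)"
    using assms by (simp add: lift)
  also have "\<dots> = (F \<otimes>\<^bsub>U\<^esub> G \<otimes>\<^bsub>U\<^esub> T k0) \<otimes>\<^bsub>U\<^esub> T k0"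
    using assms by (simp add: U.P.m_ac del: U.monom_mult)
  also have "\<dots> = psi n I (lift (F \<otimes>\<^bsub>U\<^esub> G)) \<otimes>\<^bsub>U\<^esub> psi n I (x [^]\<^bsub>R\<^esub> k0)"
    using assms unfolding psi_x0_pow by (simp add: lift)
  also have "\<dots> = psi n I (lift (F \<otimes>\<^bsub>U\<^esub> G) \<otimes>\<^bsub>R\<^esub> x [^]\<^bsub>R\<^esub> k0)"
    using assms lift(1)[of "F \<otimes>\<^bsub>U\<^esub> G"] by (intro psi.hom_mult[symmetric]) simp_all
  finally show "psi n I (lift F \<otimes>\<^bsub>R\<^esub> lift G) = psi n I (lift (F \<otimes>\<^bsub>U\<^esub> G) \<otimes>\<^bsub>R\<^esub> x [^]\<^bsub>R\<^esub> k0)" .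
qed (use assms in \<open>simp_all add: lift\<close>)

lemma lift_psi:
  assumes "f \<in> carrier R"
  shows "lift (psi n I f) = f \<otimes>\<^bsub>R\<^esub> x [^]\<^bsub>R\<^esub> k0"
proof (rule lift_unique)
  have "psi n I (f \<otimes>\<^bsub>R\<^esub> x [^]\<^bsub>R\<^esub> k0) = psi n I f \<otimes>\<^bsub>U\<^esub> psi n I (x [^]\<^bsub>R\<^esub> k0)"
    using assms by (intro psi.hom_mult) simp_all
  then show "psi n I (f \<otimes>\<^bsub>R\<^esub> x [^]\<^bsub>R\<^esub> k0) = psi n I f \<otimes>\<^bsub>U\<^esub> T k0" by (simp only: psi_x0_pow)
qed (use assms in simp_all)

lemma lift_monom:
  assumes "a \<in> part k0"
  shows "lift (up_ring.monom U (dh a) d) = a \<otimes>\<^bsub>R\<^esub> x [^]\<^bsub>R\<^esub> d"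
proof (rule lift_unique)
  have "psi n I (a \<otimes>\<^bsub>R\<^esub> x [^]\<^bsub>R\<^esub> d) = up_ring.monom U (dh a) (k0 + d)"
    using psi_of_part[OF part_mult[OF assms x0_pow_part], of d] part_closed[OF assms] by simp
  then show "psi n I (a \<otimes>\<^bsub>R\<^esub> x [^]\<^bsub>R\<^esub> d) = up_ring.monom U (dh a) d \<otimes>\<^bsub>U\<^esub> T k0"
    using monom_mult_T[of "dh a" d k0] part_closed[OF assms] by (simp add: add.commute)
qed (use part_closed[OF assms] in simp_all)

text \<open>The embedding S[x_0] -> Q^h(R) that extends the one of R along psi, as
  \<open>frac_psi\<close> shows. One denominator for all F makes it a function without a choice of
  denominators.\<close>

definition frac :: "(nat \<Rightarrow> 'k mpoly set set) \<Rightarrow> ('k mpoly set \<times> 'k mpoly set) set" where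
  "frac F = fr (lift F) (x [^]\<^bsub>R\<^esub> k0)"

sublocale frac: ring_hom_cring U Q frac
proof (rule ring_hom_cringI)
  show "frac \<in> ring_hom U Q"
  proof (rule ring_hom_memI)
    fix F assume F: "F \<in> carrier U"
    show "frac F \<in> carrier Q"
      unfolding frac_def by (rule hfrac_closed[OF lift(1)[OF F] x0_pow_nzd])
    fix G assume G: "G \<in> carrier U"
    note [simp] = lift(1)[OF F] lift(1)[OF G] lift(1)[OF U.P.m_closed[OF F G]] x0_pow_nzd
      nzd_mult one_nzd
    have "frac F \<otimes>\<^bsub>Q\<^esub> frac G = fr (lift F \<otimes>\<^bsub>R\<^esub> lift G) (x [^]\<^bsub>R\<^esub> k0 \<otimes>\<^bsub>R\<^esub> x [^]\<^bsub>R\<^esub> k0)"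
      unfolding frac_def by (simp add: hfrac_mult)
    also have "\<dots> = frac (F \<otimes>\<^bsub>U\<^esub> G)"
      unfolding lift_mult[OF F G] frac_def by (simp add: hfrac_eq_iff R.m_ac)
    finally show "frac (F \<otimes>\<^bsub>U\<^esub> G) = frac F \<otimes>\<^bsub>Q\<^esub> frac G" by simp
    show "frac (F \<oplus>\<^bsub>U\<^esub> G) = frac F \<oplus>\<^bsub>Q\<^esub> frac G"
      unfolding frac_def lift_add[OF F G] by (simp add: hfrac_add hfrac_eq_iff R.m_ac R.l_distr R.r_distr)
  next
    have "lift \<one>\<^bsub>U\<^esub> = x [^]\<^bsub>R\<^esub> k0" using lift_psi[of "\<one>\<^bsub>R\<^esub>"] by simp
    then show "frac \<one>\<^bsub>U\<^esub> = \<one>\<^bsub>Q\<^esub>"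
      by (simp add: frac_def Q_simps hfrac_eq_iff x0_pow_nzd one_nzd)
  qed
qed unfold_locales

lemma frac_psi: "f \<in> carrier R \<Longrightarrow> frac (psi n I f) = emb f"
  by (simp add: frac_def lift_psi hquot_embed_def hfrac_eq_iff x0_pow_nzd one_nzd)

lemma frac_inj: "inj_on frac (carrier U)"
proof (rule inj_onI)
  fix F G assume FG: "F \<in> carrier U" "G \<in> carrier U" "frac F = frac G"
  then have "lift F \<otimes>\<^bsub>R\<^esub> x [^]\<^bsub>R\<^esub> k0 = lift G \<otimes>\<^bsub>R\<^esub> x [^]\<^bsub>R\<^esub> k0"
    by (simp add: frac_def hfrac_eq_iff lift(1) x0_pow_nzd)
  then have "lift F = lift G" by (rule nzd_cancel[OF lift(1) lift(1) x0_pow_nzd, OF FG(1,2)])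
  then have "F \<otimes>\<^bsub>U\<^esub> T k0 = G \<otimes>\<^bsub>U\<^esub> T k0"
    using lift(2)[OF FG(1)] lift(2)[OF FG(2)] by metis
  then show "F = G" by (rule T_cancel[OF FG(1,2)])
qed

lemma frac_monom:
  assumes "a \<in> part k0"
  shows "frac (up_ring.monom U (dh a) d) = fr (a \<otimes>\<^bsub>R\<^esub> x [^]\<^bsub>R\<^esub> d) (x [^]\<^bsub>R\<^esub> k0)"
  by (simp add: frac_def lift_monom[OF assms])

lemma frac_monom_part:
  assumes "s \<in> carrier S"
  shows "frac (up_ring.monom U s d) \<in> hquot_part n I (int d)"
proof -
  obtain a where a: "a \<in> part k0" "s = dh a" using dh_surj_part[OF order_refl assms] by metis
  have "a \<otimes>\<^bsub>R\<^esub> x [^]\<^bsub>R\<^esub> d \<in> part (k0 + d)" by (rule part_mult[OF a(1) x0_pow_part])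
  moreover have "int d = int (k0 + d) - int k0" by simp
  ultimately show ?thesis
    using x0_pow_nzd[of k0] x0_pow_part[of k0] frac_monom[OF a(1), of d]
    unfolding hquot_part_def a(2) by blast
qed

text \<open>As \<open>dh b\<close> is invertible in S, the fraction a/b becomes (\<open>dh a\<close>
  / \<open>dh b\<close>) x_0^{i-j}. Together with \<open>frac_monom_part\<close> this identifies the
  part of Q of degree d with S x_0^d.\<close>

lemma hquot_part_frac:
  assumes "z \<in> hquot_part n I (int d)"
  obtains s where "s \<in> carrier S" "z = frac (up_ring.monom U s d)"
proof -
  obtain a b i j where ab: "z = fr a b" "a \<in> part i" "b \<in> Z" "b \<in> part j"
    and "int d = int i - int j"
    using assms unfolding hquot_part_def by blast
  then have ij: "i = d + j" by linarith
  obtain c where c: "c \<in> part k0" "dh b \<otimes>\<^bsub>S\<^esub> dh c = \<one>\<^bsub>S\<^esub>"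
    using nzd_divides_x0_pow[OF ab(3,4)] by blast
  note [simp] = part_closed[OF ab(2)] part_closed[OF ab(4)] part_closed[OF c(1)]
  have s: "dh a \<otimes>\<^bsub>S\<^esub> dh c \<in> carrier S" by simp
  \<comment> \<open>A form of degree \<open>k0\<close> that dehomogenizes to the quotient of
    \<open>dh a\<close> by \<open>dh b\<close>.\<close>
  obtain a' where a': "a' \<in> part k0" "dh a \<otimes>\<^bsub>S\<^esub> dh c = dh a'"
    using dh_surj_part[OF order_refl s] by metis
  note [simp] = part_closed[OF a'(1)]
  \<comment> \<open>Both sides are forms of degree i + k0, so they may be compared in S.\<close>
  have "a \<otimes>\<^bsub>R\<^esub> x [^]\<^bsub>R\<^esub> k0 = (a' \<otimes>\<^bsub>R\<^esub> x [^]\<^bsub>R\<^esub> d) \<otimes>\<^bsub>R\<^esub> b"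
  proof (rule dh_eqD)
    show "a \<otimes>\<^bsub>R\<^esub> x [^]\<^bsub>R\<^esub> k0 \<in> part (i + k0)" by (rule part_mult[OF ab(2) x0_pow_part])
    have "k0 + d + j = i + k0" by (simp add: ij)
    then show "(a' \<otimes>\<^bsub>R\<^esub> x [^]\<^bsub>R\<^esub> d) \<otimes>\<^bsub>R\<^esub> b \<in> part (i + k0)"
      using part_mult[OF part_mult[OF a'(1) x0_pow_part] ab(4), of d] by metis
    have "dh ((a' \<otimes>\<^bsub>R\<^esub> x [^]\<^bsub>R\<^esub> d) \<otimes>\<^bsub>R\<^esub> b) = dh a \<otimes>\<^bsub>S\<^esub> (dh b \<otimes>\<^bsub>S\<^esub> dh c)"
      by (simp add: S.m_ac flip: a'(2))
    then show "dh (a \<otimes>\<^bsub>R\<^esub> x [^]\<^bsub>R\<^esub> k0) = dh ((a' \<otimes>\<^bsub>R\<^esub> x [^]\<^bsub>R\<^esub> d) \<otimes>\<^bsub>R\<^esub> b)"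
      by (simp add: c(2))
  qed
  then have "z = frac (up_ring.monom U (dh a') d)"
    unfolding ab(1) frac_monom[OF a'(1)] using ab(3) by (simp add: hfrac_eq_iff x0_pow_nzd)
  then show ?thesis by (rule that[rotated]) simp
qed

text \<open>The generators of degree d \<ge> 0 are the images of the monomials s x_0^d. The image of
  S[x_0] is a subring, and every polynomial is a sum of monomials.\<close>

lemma R_tilde_eq: "R_tilde n I = frac ` carrier U"
proof
  show "R_tilde n I \<subseteq> frac ` carrier U"
  proof
    fix z assume "z \<in> R_tilde n I"
    then show "z \<in> frac ` carrier U"
      unfolding R_tilde_def
    proof (induction rule: generate_ring.induct)
      case one
      show ?case using frac.hom_one U.P.one_closed by (metis imageI)
    next
      case (incl z)
      then obtain k :: int where "0 \<le> k" "z \<in> hquot_part n I k" by auto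
      then have "z \<in> hquot_part n I (int (nat k))" by simp
      then obtain s where "s \<in> carrier S" "z = frac (up_ring.monom U s (nat k))"
        by (rule hquot_part_frac)
      then show ?case by simp
    next
      case (a_inv z)
      then obtain F where F: "F \<in> carrier U" "z = frac F" by blast
      have "\<ominus>\<^bsub>Q\<^esub> z = frac (\<ominus>\<^bsub>U\<^esub> F)" using F by simp
      then show ?case using F by blast
    next
      case (eng_add z w)
      then obtain F G where F: "F \<in> carrier U" "z = frac F" and G: "G \<in> carrier U" "w = frac G" by blast
      have "z \<oplus>\<^bsub>Q\<^esub> w = frac (F \<oplus>\<^bsub>U\<^esub> G)" using F G by simp
      then show ?case using F(1) G(1) by blast
    next
      case (eng_mult z w)
      then obtain F G where F: "F \<in> carrier U" "z = frac F" and G: "G \<in> carrier U" "w = frac G" by blast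
      have "z \<otimes>\<^bsub>Q\<^esub> w = frac (F \<otimes>\<^bsub>U\<^esub> G)" using F G by simp
      then show ?case using F(1) G(1) by blast
    qed
  qed
  have "frac F \<in> R_tilde n I" if "F \<in> carrier U" for F
    using that
  proof (induction rule: U_induct)
    case (monom s d)
    have "frac (up_ring.monom U s d) \<in> (\<Union>k\<in>{0..}. hquot_part n I k)"
      using frac_monom_part[OF monom, of d] by (intro UN_I[of "int d"]) simp_all
    then show ?case unfolding R_tilde_def by (rule generate_ring.incl)
  next
    case (add F G)
    then show ?case unfolding R_tilde_def by (simp add: generate_ring.eng_add)
  qed
  then show "frac ` carrier U \<subseteq> R_tilde n I" by blast
qed

text \<open>The inverse of \<open>frac\<close> serves as h. Its compatibility with K[x_0] reduces to
  that of psi, because \<open>frac\<close> after psi is the embedding of R.\<close>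

lemma R_tilde_iso:
  "\<exists>h. h \<in> ring_iso (R_tilde_ring n I) U \<and>
     graded_algebra_hom (Kx0 TYPE('k)) (R_tilde_ring n I) (R_tilde_struct n I) (R_tilde_part n I)
       U (Sx0_struct n I) (Sx0_part n I) h"
proof -
  define h where "h = inv_into (carrier U) frac"
  have h_frac: "h (frac F) = F" if "F \<in> carrier U" for F
    unfolding h_def by (rule inv_into_f_f[OF frac_inj that])
  have bij: "bij_betw h (R_tilde n I) (carrier U)"
    unfolding h_def R_tilde_eq by (intro bij_betw_inv_into inj_on_imp_bij_betw frac_inj)
  have hom: "h \<in> ring_hom (R_tilde_ring n I) U"
  proof (rule ring_hom_memI)
    fix z assume "z \<in> carrier (R_tilde_ring n I)"
    then obtain F where F: "F \<in> carrier U" "z = frac F" by (auto simp: R_tilde_ring_def R_tilde_eq)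
    show "h z \<in> carrier U" by (simp add: F h_frac)
    fix w assume "w \<in> carrier (R_tilde_ring n I)"
    then obtain G where G: "G \<in> carrier U" "w = frac G" by (auto simp: R_tilde_ring_def R_tilde_eq)
    have "frac F \<otimes>\<^bsub>Q\<^esub> frac G = frac (F \<otimes>\<^bsub>U\<^esub> G)" "frac F \<oplus>\<^bsub>Q\<^esub> frac G = frac (F \<oplus>\<^bsub>U\<^esub> G)"
      using F(1) G(1) by simp_all
    then show "h (z \<otimes>\<^bsub>R_tilde_ring n I\<^esub> w) = h z \<otimes>\<^bsub>U\<^esub> h w"
      and "h (z \<oplus>\<^bsub>R_tilde_ring n I\<^esub> w) = h z \<oplus>\<^bsub>U\<^esub> h w"
      using F(1) G(1) unfolding F(2) G(2) by (simp_all add: R_tilde_ring_def h_frac del: frac.hom_mult frac.hom_add)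
  next
    show "h \<one>\<^bsub>R_tilde_ring n I\<^esub> = \<one>\<^bsub>U\<^esub>"
      using h_frac[OF U.P.one_closed] by (simp add: R_tilde_ring_def)
  qed
  have "h ` R_tilde_part n I d \<subseteq> Sx0_part n I d" for d
  proof
    fix F assume "F \<in> h ` R_tilde_part n I d"
    then obtain z where z: "z \<in> hquot_part n I (int d)" "F = h z" by (auto simp: R_tilde_part_def)
    obtain s where "s \<in> carrier S" "z = frac (up_ring.monom U s d)" using z(1) by (rule hquot_part_frac)
    then show "F \<in> Sx0_part n I d" using z(2) by (simp add: h_frac Sx0_part_def)
  qed
  moreover have "h (R_tilde_struct n I p) = Sx0_struct n I p" if "p \<in> carrier (Kx0 TYPE('k))" for p
  proof -
    have c: "coord_struct n I p \<in> carrier R" by (rule coord_struct_closed[OF that])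
    have "h (R_tilde_struct n I p) = h (frac (psi n I (coord_struct n I p)))"
      by (simp only: R_tilde_struct_def frac_psi[OF c])
    also have "\<dots> = Sx0_struct n I p" unfolding h_frac[OF psi_closed[OF c]] by (rule psi_struct[OF that])
    finally show ?thesis .
  qed
  ultimately have "graded_algebra_hom (Kx0 TYPE('k)) (R_tilde_ring n I) (R_tilde_struct n I)
      (R_tilde_part n I) U (Sx0_struct n I) (Sx0_part n I) h"
    using hom by (simp add: graded_algebra_hom_def)
  moreover have "h \<in> ring_iso (R_tilde_ring n I) U"
    using hom bij by (simp add: ring_iso_def R_tilde_ring_def)
  ultimately show ?thesis by blast
qed

section \<open>Integral closure\<close>

lemma component_finsum:
  assumes "finite A" "\<And>i. i \<in> A \<Longrightarrow> f i \<in> carrier R"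
  shows "component e (\<Oplus>\<^bsub>R\<^esub>i\<in>A. f i) = (\<Oplus>\<^bsub>R\<^esub>i\<in>A. component e (f i))"
  using assms
  by (induction A rule: finite_induct) (simp_all add: component_add R.finsum_insert Pi_def)

lemma component_const_mult:
  assumes "c \<in> K" "f \<in> carrier R"
  shows "component e (c \<otimes>\<^bsub>R\<^esub> f) = c \<otimes>\<^bsub>R\<^esub> component e f"
proof -
  have c: "c \<in> part 0" using assms(1) const_part by blast
  show ?thesis
    using component_mult_part[OF assms(2) c, of e] part_closed[OF c] assms(2)
    by (simp add: R.m_comm)
qed

text \<open>A representative of f modulo the components of degree at least N. Staying inside R
  replaces a finite-dimensional quotient by a finite-dimensional subspace.\<close>

definition truncation :: "nat \<Rightarrow> 'k mpoly set \<Rightarrow> 'k mpoly set" where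
  "truncation N f = (\<Oplus>\<^bsub>R\<^esub>d\<in>{..<N}. component d f)"

lemma truncation_closed [simp]: "f \<in> carrier R \<Longrightarrow> truncation N f \<in> carrier R"
  by (simp add: truncation_def Pi_def)

lemma component_truncation:
  assumes f: "f \<in> carrier R" and e: "e < N"
  shows "component e (truncation N f) = component e f"
proof -
  have "component e (truncation N f) = (\<Oplus>\<^bsub>R\<^esub>d\<in>{..<N}. component e (component d f))"
    unfolding truncation_def using f by (intro component_finsum) simp_all
  also have "\<dots> = (\<Oplus>\<^bsub>R\<^esub>d\<in>{..<N}. if e = d then component d f else \<zero>\<^bsub>R\<^esub>)"
    using f by (intro R.finsum_cong') (auto simp: component_of_part[OF component_part])
  also have "\<dots> = component e f"
    using f e by (intro R.finsum_singleton) auto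
  finally show ?thesis .
qed

text \<open>E is the sum of R_0, ..., R_{N-1}: one space for all f, as
  \<open>dependent_sequence\<close> requires.\<close>

lemma finite_dimension_truncation:
  "\<exists>E. R.finite_dimension K E \<and> (\<forall>f\<in>carrier R. truncation N f \<in> E)"
proof (induction N)
  case 0
  have "R.finite_dimension K {\<zero>\<^bsub>R\<^esub>}" by (rule R.finite_dimensionI[OF R.zero_dim])
  then show ?case by (auto simp: truncation_def)
next
  case (Suc N)
  then obtain E where E: "R.finite_dimension K E" "\<And>f. f \<in> carrier R \<Longrightarrow> truncation N f \<in> E" by blast
  have "truncation (Suc N) f \<in> part N <+>\<^bsub>R\<^esub> E" if f: "f \<in> carrier R" for f
  proof -
    have "truncation (Suc N) f = component N f \<oplus>\<^bsub>R\<^esub> truncation N f"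
      using f by (simp add: truncation_def lessThan_Suc R.finsum_insert Pi_def)
    then show ?thesis
      using component_part[OF f, of N] E(2)[OF f] unfolding set_add_def' by blast
  qed
  then show ?case using R.sum_space_dim(1)[OF subfield_K finite_dimension_part E(1)] by blast
qed

lemma coeff_mult_T_below:
  assumes "F \<in> carrier U" "j < d"
  shows "up_ring.coeff U (F \<otimes>\<^bsub>U\<^esub> T d) j = \<zero>\<^bsub>S\<^esub>"
proof -
  have "up_ring.coeff U (F \<otimes>\<^bsub>U\<^esub> T d) j =
      (\<Oplus>\<^bsub>S\<^esub>i\<in>{..j}. up_ring.coeff U F i \<otimes>\<^bsub>S\<^esub> up_ring.coeff U (T d) (j - i))"
    using assms(1) by simp
  also have "\<dots> = (\<Oplus>\<^bsub>S\<^esub>i\<in>{..j}. \<zero>\<^bsub>S\<^esub>)"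
    using assms by (intro S.finsum_cong') (auto simp: U.coeff_closed)
  finally show ?thesis by simp
qed

lemma divide_T:
  assumes F: "F \<in> carrier U" and low: "\<And>j. j < d \<Longrightarrow> up_ring.coeff U F j = \<zero>\<^bsub>S\<^esub>"
  obtains G where "G \<in> carrier U" "F = G \<otimes>\<^bsub>U\<^esub> T d"
proof -
  define G where "G = (\<lambda>i. F (d + i))"
  have F': "F \<in> up S" using F by (simp add: carrier_U)
  obtain N where N: "bound \<zero>\<^bsub>S\<^esub> N F" using S.bound_upD[OF F'] by blast
  have "G \<in> up S"
  proof (rule mem_upI)
    show "G i \<in> carrier S" for i unfolding G_def by (rule mem_upD[OF F'])
    have "bound \<zero>\<^bsub>S\<^esub> N G" unfolding G_def by (intro bound.intro bound.bound[OF N]) simp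
    then show "\<exists>N. bound \<zero>\<^bsub>S\<^esub> N G" by (rule exI)
  qed
  then have G: "G \<in> carrier U" by (simp add: carrier_U)
  have "F = G \<otimes>\<^bsub>U\<^esub> T d"
  proof (rule U.up_eqI[OF _ F])
    show "G \<otimes>\<^bsub>U\<^esub> T d \<in> carrier U" using G by simp
    fix j show "up_ring.coeff U F j = up_ring.coeff U (G \<otimes>\<^bsub>U\<^esub> T d) j"
    proof (cases "j < d")
      case True
      then show ?thesis using low coeff_mult_T_below[OF G] by metis
    next
      case False
      then obtain i where j: "j = d + i" using le_Suc_ex not_less by blast
      show ?thesis unfolding j coeff_T_mult[OF G] by (simp add: coeff_U F G) (simp add: G_def)
    qed
  qed
  with G show ?thesis by (rule that)
qed

section \<open>Integral equations over R\<close>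

abbreviation "IC \<equiv> integral_closure Q (emb ` carrier R)"

lemma ICI:
  fixes m :: nat
  assumes "z \<in> carrier Q" "b \<in> {..<m} \<rightarrow> carrier R"
    and "z [^]\<^bsub>Q\<^esub> m \<oplus>\<^bsub>Q\<^esub> (\<Oplus>\<^bsub>Q\<^esub>i\<in>{..<m}. emb (b i) \<otimes>\<^bsub>Q\<^esub> z [^]\<^bsub>Q\<^esub> i) = \<zero>\<^bsub>Q\<^esub>"
  shows "z \<in> IC"
proof -
  have "(\<lambda>i. emb (b i)) \<in> {..<m} \<rightarrow> emb ` carrier R" using assms(2) by blast
  then show ?thesis
    unfolding integral_closure_def using assms(1,3) by (intro CollectI conjI exI[of _ m] exI[of _ "\<lambda>i. emb (b i)"])
qed

text \<open>The coefficients are named in R rather than in its image, so that psi can be applied to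
  them.\<close>

lemma ICE:
  assumes "z \<in> IC"
  obtains m :: nat and b where "z \<in> carrier Q" "b \<in> {..<m} \<rightarrow> carrier R"
    "z [^]\<^bsub>Q\<^esub> m \<oplus>\<^bsub>Q\<^esub> (\<Oplus>\<^bsub>Q\<^esub>i\<in>{..<m}. emb (b i) \<otimes>\<^bsub>Q\<^esub> z [^]\<^bsub>Q\<^esub> i) = \<zero>\<^bsub>Q\<^esub>"
proof -
  obtain m :: nat and a where z: "z \<in> carrier Q" and a: "a \<in> {..<m} \<rightarrow> emb ` carrier R"
    and eq: "z [^]\<^bsub>Q\<^esub> m \<oplus>\<^bsub>Q\<^esub> (\<Oplus>\<^bsub>Q\<^esub>i\<in>{..<m}. a i \<otimes>\<^bsub>Q\<^esub> z [^]\<^bsub>Q\<^esub> i) = \<zero>\<^bsub>Q\<^esub>"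
    using assms unfolding integral_closure_def by (elim CollectE conjE exE) (rule that)
  have "\<forall>i\<in>{..<m}. \<exists>r\<in>carrier R. a i = emb r" using a by blast
  then obtain b where b: "\<forall>i\<in>{..<m}. b i \<in> carrier R \<and> a i = emb (b i)"
    unfolding Bex_def by (rule bchoice[THEN exE])
  have "(\<Oplus>\<^bsub>Q\<^esub>i\<in>{..<m}. emb (b i) \<otimes>\<^bsub>Q\<^esub> z [^]\<^bsub>Q\<^esub> i) = (\<Oplus>\<^bsub>Q\<^esub>i\<in>{..<m}. a i \<otimes>\<^bsub>Q\<^esub> z [^]\<^bsub>Q\<^esub> i)"
    using b z by (intro Q.finsum_cong') auto
  then show ?thesis using z b eq by (intro that[of b m]) auto
qed

text \<open>Modulo a power of $x_0$ that lies in the conductor, $S[x_0]$ is a finite-dimensional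
  $K$-algebra, so every element satisfies a monic equation up to an element of $\psi(R)$.\<close>

lemma frac_integral:
  assumes F: "F \<in> carrier U"
  shows "frac F \<in> IC"
proof -
  \<comment> \<open>Lifting costs \<open>k0\<close> degrees and divisibility of the defect by
    x_0^{k0} another \<open>k0\<close>, so components in degrees below 2 k0 must vanish. The extra 1
    ensures k0 < N even for k0 = 0, which excludes m = 0.\<close>
  define N where "N = Suc (2 * k0)"
  define v where "v i = lift (F [^]\<^bsub>U\<^esub> i)" for i :: nat
  have Fi: "F [^]\<^bsub>U\<^esub> i \<in> carrier U" for i :: nat using F by simp
  have v: "v i \<in> carrier R" "psi n I (v i) = F [^]\<^bsub>U\<^esub> i \<otimes>\<^bsub>U\<^esub> T k0" for i
    unfolding v_def by (rule lift[OF Fi])+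
  obtain E where E: "R.finite_dimension K E" "\<forall>f\<in>carrier R. truncation N f \<in> E"
    using finite_dimension_truncation by blast
  have "truncation N (v i) \<in> E" for i using E(2) v(1) by blast
  then obtain m c where c: "c \<in> {..<m} \<rightarrow> K"
    and dep: "truncation N (v m) \<oplus>\<^bsub>R\<^esub> (\<Oplus>\<^bsub>R\<^esub>i\<in>{..<m}. c i \<otimes>\<^bsub>R\<^esub> truncation N (v i)) = \<zero>\<^bsub>R\<^esub>"
    by (rule R.dependent_sequence[OF subfield_K E(1), of "\<lambda>i. truncation N (v i)"])
  have cK: "c i \<in> K" and cR: "c i \<in> carrier R" if "i < m" for i
  proof -
    show "c i \<in> K" by (rule funcset_mem[OF c]) (simp add: that)
    then show "c i \<in> carrier R" by (rule subsetD[OF subfieldE(3)[OF subfield_K]])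
  qed
  define w where "w = v m \<oplus>\<^bsub>R\<^esub> (\<Oplus>\<^bsub>R\<^esub>i\<in>{..<m}. c i \<otimes>\<^bsub>R\<^esub> v i)"
  have sum_closed: "(\<Oplus>\<^bsub>R\<^esub>i\<in>{..<m}. c i \<otimes>\<^bsub>R\<^esub> v i) \<in> carrier R"
    using cR v(1) by (intro R.finsum_closed) auto
  have w: "w \<in> carrier R" unfolding w_def using v(1) sum_closed by simp
  \<comment> \<open>Components commute with these combinations because each \<open>c i\<close> has
    degree 0. The fact is applied to the v i and to their truncations.\<close>
  have comp_comb: "component e (g m \<oplus>\<^bsub>R\<^esub> (\<Oplus>\<^bsub>R\<^esub>i\<in>{..<m}. c i \<otimes>\<^bsub>R\<^esub> g i)) =
      component e (g m) \<oplus>\<^bsub>R\<^esub> (\<Oplus>\<^bsub>R\<^esub>i\<in>{..<m}. c i \<otimes>\<^bsub>R\<^esub> component e (g i))"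
    if g: "\<And>i. g i \<in> carrier R" for e and g :: "nat \<Rightarrow> 'k mpoly set"
  proof -
    have "(\<Oplus>\<^bsub>R\<^esub>i\<in>{..<m}. c i \<otimes>\<^bsub>R\<^esub> g i) \<in> carrier R" using cR g by (intro R.finsum_closed) auto
    then have "component e (g m \<oplus>\<^bsub>R\<^esub> (\<Oplus>\<^bsub>R\<^esub>i\<in>{..<m}. c i \<otimes>\<^bsub>R\<^esub> g i)) =
        component e (g m) \<oplus>\<^bsub>R\<^esub> component e (\<Oplus>\<^bsub>R\<^esub>i\<in>{..<m}. c i \<otimes>\<^bsub>R\<^esub> g i)"
      by (rule component_add[OF g])
    also have "component e (\<Oplus>\<^bsub>R\<^esub>i\<in>{..<m}. c i \<otimes>\<^bsub>R\<^esub> g i) = (\<Oplus>\<^bsub>R\<^esub>i\<in>{..<m}. component e (c i \<otimes>\<^bsub>R\<^esub> g i))"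
      using cR g by (intro component_finsum) auto
    also have "\<dots> = (\<Oplus>\<^bsub>R\<^esub>i\<in>{..<m}. c i \<otimes>\<^bsub>R\<^esub> component e (g i))"
      using cR g cK by (intro R.finsum_cong') (auto simp: component_const_mult)
    finally show ?thesis .
  qed
  have low: "component e w = \<zero>\<^bsub>R\<^esub>" if "e < N" for e
  proof -
    have "component e w = component e (v m) \<oplus>\<^bsub>R\<^esub> (\<Oplus>\<^bsub>R\<^esub>i\<in>{..<m}. c i \<otimes>\<^bsub>R\<^esub> component e (v i))"
      unfolding w_def by (rule comp_comb[OF v(1)])
    also have "\<dots> = component e (truncation N (v m)) \<oplus>\<^bsub>R\<^esub>
        (\<Oplus>\<^bsub>R\<^esub>i\<in>{..<m}. c i \<otimes>\<^bsub>R\<^esub> component e (truncation N (v i)))"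
      by (simp only: component_truncation[OF v(1) that])
    also have "\<dots> = component e (truncation N (v m) \<oplus>\<^bsub>R\<^esub> (\<Oplus>\<^bsub>R\<^esub>i\<in>{..<m}. c i \<otimes>\<^bsub>R\<^esub> truncation N (v i)))"
      using v(1) by (intro comp_comb[of "\<lambda>i. truncation N (v i)", symmetric]) simp
    also have "\<dots> = \<zero>\<^bsub>R\<^esub>" unfolding dep by simp
    finally show ?thesis .
  qed
  \<comment> \<open>A coefficient of index 0 is needed to absorb the defect. For m = 0 the relation
    would make \<open>v 0\<close>, which is x_0^{k0}, vanish in degree k0 < N.\<close>
  have "m \<noteq> 0"
  proof
    assume "m = 0"
    have "v 0 = x [^]\<^bsub>R\<^esub> k0" using lift_psi[of "\<one>\<^bsub>R\<^esub>"] by (simp add: v_def)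
    then have "w = x [^]\<^bsub>R\<^esub> k0" unfolding w_def \<open>m = 0\<close> by simp
    then have "x [^]\<^bsub>R\<^esub> k0 = \<zero>\<^bsub>R\<^esub>"
      using low[of k0] component_of_part[OF x0_pow_part, of k0 k0] by (simp add: N_def)
    then have "x [^]\<^bsub>R\<^esub> k0 \<otimes>\<^bsub>R\<^esub> \<one>\<^bsub>R\<^esub> = x [^]\<^bsub>R\<^esub> k0 \<otimes>\<^bsub>R\<^esub> \<zero>\<^bsub>R\<^esub>" by simp
    then show False using x0_pow_cancel[of "\<one>\<^bsub>R\<^esub>" "\<zero>\<^bsub>R\<^esub>" k0] one_not_zero by simp
  qed
  define C where "C = (\<Oplus>\<^bsub>U\<^esub>i\<in>{..<m}. psi n I (c i) \<otimes>\<^bsub>U\<^esub> F [^]\<^bsub>U\<^esub> i)"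
  have cF: "(\<lambda>i. psi n I (c i) \<otimes>\<^bsub>U\<^esub> F [^]\<^bsub>U\<^esub> i) \<in> {..<m} \<rightarrow> carrier U" using cR F by auto
  have C: "C \<in> carrier U" unfolding C_def by (rule U.P.finsum_closed[OF cF])
  \<comment> \<open>D is the defect of the monic equation over K, before multiplication by
    x_0^{k0}.\<close>
  define D where "D = F [^]\<^bsub>U\<^esub> m \<oplus>\<^bsub>U\<^esub> C"
  have D: "D \<in> carrier U" unfolding D_def using F C by simp
  have "psi n I w = psi n I (v m) \<oplus>\<^bsub>U\<^esub> psi n I (\<Oplus>\<^bsub>R\<^esub>i\<in>{..<m}. c i \<otimes>\<^bsub>R\<^esub> v i)"
    unfolding w_def by (rule psi.hom_add[OF v(1) sum_closed])
  also have "psi n I (\<Oplus>\<^bsub>R\<^esub>i\<in>{..<m}. c i \<otimes>\<^bsub>R\<^esub> v i) = (\<Oplus>\<^bsub>U\<^esub>i\<in>{..<m}. psi n I (c i \<otimes>\<^bsub>R\<^esub> v i))"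
    using cR v(1) by (subst psi.hom_finsum) (auto simp: o_def)
  also have "\<dots> = (\<Oplus>\<^bsub>U\<^esub>i\<in>{..<m}. (psi n I (c i) \<otimes>\<^bsub>U\<^esub> F [^]\<^bsub>U\<^esub> i) \<otimes>\<^bsub>U\<^esub> T k0)"
    using cR v F by (intro U.P.finsum_cong') (auto simp: U.P.m_assoc)
  also have "\<dots> = C \<otimes>\<^bsub>U\<^esub> T k0"
    unfolding C_def using cF by (intro U.P.finsum_ldistr[symmetric]) auto
  finally have psi_w: "psi n I w = D \<otimes>\<^bsub>U\<^esub> T k0"
    unfolding D_def using v(2)[of m] F C by (simp add: U.P.l_distr)
  \<comment> \<open>The component of w in degree k0 + j corresponds to the coefficient of D at j. So
    D is divisible by x_0^{k0} and lies in psi(R).\<close>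
  have "up_ring.coeff U D j = \<zero>\<^bsub>S\<^esub>" if "j < k0" for j
    using coeff_T_mult[OF D, of k0 j] low[of "k0 + j"] w that
    unfolding psi_w[symmetric] by (simp add: N_def)
  then obtain G where G: "G \<in> carrier U" "D = G \<otimes>\<^bsub>U\<^esub> T k0" using divide_T[OF D] by metis
  define r where "r = lift G"
  have r: "r \<in> carrier R" "psi n I r = D" unfolding r_def G(2) by (rule lift[OF G(1)])+
  \<comment> \<open>The defect, now of the form \<open>psi n I r\<close>, is subtracted from the
    coefficient of index 0.\<close>
  define b where "b i = c i \<oplus>\<^bsub>R\<^esub> (if 0 = i then \<ominus>\<^bsub>R\<^esub> r else \<zero>\<^bsub>R\<^esub>)" for i :: nat
  have b: "b i \<in> carrier R" if "i < m" for i using cR[OF that] r(1) by (simp add: b_def)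
  have "(\<Oplus>\<^bsub>U\<^esub>i\<in>{..<m}. psi n I (b i) \<otimes>\<^bsub>U\<^esub> F [^]\<^bsub>U\<^esub> i) =
      (\<Oplus>\<^bsub>U\<^esub>i\<in>{..<m}. psi n I (c i) \<otimes>\<^bsub>U\<^esub> F [^]\<^bsub>U\<^esub> i \<oplus>\<^bsub>U\<^esub> (if 0 = i then \<ominus>\<^bsub>U\<^esub> D else \<zero>\<^bsub>U\<^esub>))"
    using cR F r D by (intro U.P.finsum_cong') (auto simp: b_def U.P.l_distr)
  also have "\<dots> = C \<oplus>\<^bsub>U\<^esub> (\<Oplus>\<^bsub>U\<^esub>i\<in>{..<m}. if 0 = i then \<ominus>\<^bsub>U\<^esub> D else \<zero>\<^bsub>U\<^esub>)"
    unfolding C_def using cF D by (intro U.P.finsum_addf) auto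
  also have "(\<Oplus>\<^bsub>U\<^esub>i\<in>{..<m}. if 0 = i then \<ominus>\<^bsub>U\<^esub> D else \<zero>\<^bsub>U\<^esub>) = \<ominus>\<^bsub>U\<^esub> D"
    using \<open>m \<noteq> 0\<close> D by (intro U.P.finsum_singleton) auto
  finally have sum_b: "(\<Oplus>\<^bsub>U\<^esub>i\<in>{..<m}. psi n I (b i) \<otimes>\<^bsub>U\<^esub> F [^]\<^bsub>U\<^esub> i) = C \<oplus>\<^bsub>U\<^esub> \<ominus>\<^bsub>U\<^esub> D" .
  have "F [^]\<^bsub>U\<^esub> m \<oplus>\<^bsub>U\<^esub> (C \<oplus>\<^bsub>U\<^esub> \<ominus>\<^bsub>U\<^esub> D) = D \<oplus>\<^bsub>U\<^esub> \<ominus>\<^bsub>U\<^esub> D"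
    using F C D by (simp add: U.P.a_assoc D_def del: U.P.r_neg)
  also have "\<dots> = \<zero>\<^bsub>U\<^esub>" using D by (rule U.P.r_neg)
  finally have rel: "F [^]\<^bsub>U\<^esub> m \<oplus>\<^bsub>U\<^esub> (\<Oplus>\<^bsub>U\<^esub>i\<in>{..<m}. psi n I (b i) \<otimes>\<^bsub>U\<^esub> F [^]\<^bsub>U\<^esub> i) = \<zero>\<^bsub>U\<^esub>"
    unfolding sum_b .
  have bF: "(\<lambda>i. psi n I (b i) \<otimes>\<^bsub>U\<^esub> F [^]\<^bsub>U\<^esub> i) \<in> {..<m} \<rightarrow> carrier U" using b F by auto
  have "frac (\<Oplus>\<^bsub>U\<^esub>i\<in>{..<m}. psi n I (b i) \<otimes>\<^bsub>U\<^esub> F [^]\<^bsub>U\<^esub> i) =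
      (\<Oplus>\<^bsub>Q\<^esub>i\<in>{..<m}. frac (psi n I (b i) \<otimes>\<^bsub>U\<^esub> F [^]\<^bsub>U\<^esub> i))"
    using bF by (subst frac.hom_finsum) (auto simp: o_def)
  also have "\<dots> = (\<Oplus>\<^bsub>Q\<^esub>i\<in>{..<m}. emb (b i) \<otimes>\<^bsub>Q\<^esub> frac F [^]\<^bsub>Q\<^esub> i)"
    using b F by (intro Q.finsum_cong') (auto simp: frac_psi)
  finally have "frac F [^]\<^bsub>Q\<^esub> m \<oplus>\<^bsub>Q\<^esub> (\<Oplus>\<^bsub>Q\<^esub>i\<in>{..<m}. emb (b i) \<otimes>\<^bsub>Q\<^esub> frac F [^]\<^bsub>Q\<^esub> i) = \<zero>\<^bsub>Q\<^esub>"
    using arg_cong[OF rel, of frac] U.P.finsum_closed[OF bF] F by simp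
  then show ?thesis using b F by (intro ICI[of _ b m]) auto
qed

lemma R_tilde_integral: "R_tilde n I \<subseteq> IC"
  unfolding R_tilde_eq using frac_integral by blast

section \<open>Poles at x_0 = 0 and reducedness of S\<close>

lemma emb_cancel:
  assumes b: "b \<in> Z" and u: "u \<in> carrier Q" and w: "w \<in> carrier Q"
    and eq: "emb b \<otimes>\<^bsub>Q\<^esub> u = emb b \<otimes>\<^bsub>Q\<^esub> w"
  shows "u = w"
proof -
  obtain a d where a: "a \<in> carrier R" "d \<in> Z" "u = fr a d" using u by (rule Q_cases)
  obtain c e where c: "c \<in> carrier R" "e \<in> Z" "w = fr c e" using w by (rule Q_cases)
  note [simp] = nzd_closed[OF b] nzd_closed[OF a(2)] nzd_closed[OF c(2)] a(1) c(1)
  have "(b \<otimes>\<^bsub>R\<^esub> a) \<otimes>\<^bsub>R\<^esub> e = (b \<otimes>\<^bsub>R\<^esub> c) \<otimes>\<^bsub>R\<^esub> d"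
    using eq a(2) c(2) unfolding a(3) c(3)
    by (simp add: hquot_embed_def hfrac_mult hfrac_eq_iff one_nzd nzd_mult)
  then have "(a \<otimes>\<^bsub>R\<^esub> e) \<otimes>\<^bsub>R\<^esub> b = (c \<otimes>\<^bsub>R\<^esub> d) \<otimes>\<^bsub>R\<^esub> b" by (simp add: R.m_ac)
  then have "a \<otimes>\<^bsub>R\<^esub> e = c \<otimes>\<^bsub>R\<^esub> d" by (rule nzd_cancel[OF _ _ b, rotated 2]) simp_all
  then show ?thesis unfolding a(3) c(3) using a(2) c(2) by (simp add: hfrac_eq_iff)
qed

text \<open>From b c = x_0^{j+k0} follows x_0^{j+k0} (a/b) = c a, which already lies in R.\<close>

lemma x0_pow_denominator:
  assumes "z \<in> carrier Q"
  shows "\<exists>e. \<exists>F\<in>carrier U. emb (x [^]\<^bsub>R\<^esub> (e::nat)) \<otimes>\<^bsub>Q\<^esub> z = frac F"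
proof -
  obtain a b where ab: "a \<in> carrier R" "b \<in> Z" "z = fr a b" using assms by (rule Q_cases)
  obtain j where j: "b \<in> part j" using nzd_part[OF ab(2)] by blast
  obtain c where c: "c \<in> part k0" "dh b \<otimes>\<^bsub>S\<^esub> dh c = \<one>\<^bsub>S\<^esub>"
    using nzd_divides_x0_pow[OF ab(2) j] by blast
  note [simp] = ab(1) part_closed[OF j] part_closed[OF c(1)]
  have "x [^]\<^bsub>R\<^esub> (j + k0) = b \<otimes>\<^bsub>R\<^esub> c"
    by (rule dh_eqD[OF x0_pow_part part_mult[OF j c(1)]]) (simp add: c(2))
  then have "emb (x [^]\<^bsub>R\<^esub> (j + k0)) \<otimes>\<^bsub>Q\<^esub> z = emb c \<otimes>\<^bsub>Q\<^esub> (emb b \<otimes>\<^bsub>Q\<^esub> z)"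
    using assms by (simp add: Q.m_ac)
  also have "\<dots> = emb c \<otimes>\<^bsub>Q\<^esub> emb a" unfolding ab(3) by (simp only: hfrac_mult_denominator[OF ab(1,2)])
  also have "\<dots> = frac (psi n I (c \<otimes>\<^bsub>R\<^esub> a))" by (subst frac_psi) simp_all
  finally have "emb (x [^]\<^bsub>R\<^esub> (j + k0)) \<otimes>\<^bsub>Q\<^esub> z = frac (psi n I (c \<otimes>\<^bsub>R\<^esub> a))" .
  moreover have "psi n I (c \<otimes>\<^bsub>R\<^esub> a) \<in> carrier U" by (rule psi_closed) simp
  ultimately show ?thesis by blast
qed

lemma frac_T: "frac (T e) = emb (x [^]\<^bsub>R\<^esub> e)"
  using frac_psi[of "x [^]\<^bsub>R\<^esub> e"] unfolding psi_x0_pow by simp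

text \<open>A fraction outside $\widetilde R$ has, as a Laurent polynomial over $S$, a pole at $x_0 = 0$.\<close>

lemma pole_of_not_R_tilde:
  assumes z: "z \<in> carrier Q" "z \<notin> R_tilde n I"
  obtains e F where "e > 0" "F \<in> carrier U" "up_ring.coeff U F 0 \<noteq> \<zero>\<^bsub>S\<^esub>"
    "emb (x [^]\<^bsub>R\<^esub> (e::nat)) \<otimes>\<^bsub>Q\<^esub> z = frac F"
proof -
  let ?Pr = "\<lambda>e::nat. \<exists>F\<in>carrier U. emb (x [^]\<^bsub>R\<^esub> e) \<otimes>\<^bsub>Q\<^esub> z = frac F"
  \<comment> \<open>By minimality F has a nonzero constant coefficient: otherwise F = G x_0, and
    cancelling x_0 would lower the exponent to e - 1.\<close>
  define e where "e = (LEAST e. ?Pr e)"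
  have "?Pr e" unfolding e_def by (rule LeastI_ex) (rule x0_pow_denominator[OF z(1)])
  then obtain F where F: "F \<in> carrier U" "emb (x [^]\<^bsub>R\<^esub> e) \<otimes>\<^bsub>Q\<^esub> z = frac F" by blast
  have "e \<noteq> 0"
  proof
    assume "e = 0"
    then have "z = frac F" using F(2) z(1) by simp
    then show False using z(2) F(1) by (simp add: R_tilde_eq)
  qed
  moreover have "up_ring.coeff U F 0 \<noteq> \<zero>\<^bsub>S\<^esub>"
  proof
    assume "up_ring.coeff U F 0 = \<zero>\<^bsub>S\<^esub>"
    then have low: "up_ring.coeff U F j = \<zero>\<^bsub>S\<^esub>" if "j < 1" for j using that by simp
    obtain G where G: "G \<in> carrier U" "F = G \<otimes>\<^bsub>U\<^esub> T 1" by (rule divide_T[OF F(1) low])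
    obtain e' where e': "e = Suc e'" using \<open>e \<noteq> 0\<close> not0_implies_Suc by blast
    have "emb (x [^]\<^bsub>R\<^esub> (1::nat)) \<otimes>\<^bsub>Q\<^esub> (emb (x [^]\<^bsub>R\<^esub> e') \<otimes>\<^bsub>Q\<^esub> z) = emb (x [^]\<^bsub>R\<^esub> e) \<otimes>\<^bsub>Q\<^esub> z"
      unfolding e' using z(1) by (simp add: Q.m_ac)
    also have "\<dots> = frac (G \<otimes>\<^bsub>U\<^esub> T 1)"
      unfolding F(2) by (simp only: G(2))
    also have "\<dots> = frac G \<otimes>\<^bsub>Q\<^esub> frac (T 1)"
      by (rule frac.hom_mult[OF G(1)]) simp
    also have "\<dots> = emb (x [^]\<^bsub>R\<^esub> (1::nat)) \<otimes>\<^bsub>Q\<^esub> frac G"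
      unfolding frac_T by (rule Q.m_comm[OF frac.hom_closed[OF G(1)]]) simp
    finally have eq: "emb (x [^]\<^bsub>R\<^esub> (1::nat)) \<otimes>\<^bsub>Q\<^esub> (emb (x [^]\<^bsub>R\<^esub> e') \<otimes>\<^bsub>Q\<^esub> z) =
        emb (x [^]\<^bsub>R\<^esub> (1::nat)) \<otimes>\<^bsub>Q\<^esub> frac G" .
    have "emb (x [^]\<^bsub>R\<^esub> e') \<otimes>\<^bsub>Q\<^esub> z = frac G"
      by (rule emb_cancel[OF x0_pow_nzd _ _ eq]) (simp_all add: z(1) G(1))
    then have "?Pr e'" using G(1) by blast
    then have "e \<le> e'" unfolding e_def by (rule Least_le)
    then show False by (simp add: e')
  qed
  ultimately show ?thesis using that F by blast
qed

text \<open>Evaluation at x_0 = 0.\<close>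

lemma coeff0_hom: "ring_hom_cring U S (\<lambda>F. up_ring.coeff U F 0)"
proof (rule ring_hom_cringI)
  show "(\<lambda>F. up_ring.coeff U F 0) \<in> ring_hom U S"
    by (rule ring_hom_memI) (simp_all add: U.coeff_closed)
qed unfold_locales

text \<open>With F = x_0^e z, multiplying the integral equation by x_0^{e m} gives F^m + sum of
  x_0^{e (m-i)} b_i F^i = 0 in S[x_0]. Since e > 0, setting x_0 = 0 leaves F(0)^m = 0, so F(0) = 0
  as S is reduced, against the choice of F.\<close>

lemma IC_subset_R_tilde:
  assumes red: "reduced_ring S"
  shows "IC \<subseteq> R_tilde n I"
proof
  fix z assume "z \<in> IC"
  then obtain m :: nat and b where z: "z \<in> carrier Q" and b: "b \<in> {..<m} \<rightarrow> carrier R"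
    and eq: "z [^]\<^bsub>Q\<^esub> m \<oplus>\<^bsub>Q\<^esub> (\<Oplus>\<^bsub>Q\<^esub>i\<in>{..<m}. emb (b i) \<otimes>\<^bsub>Q\<^esub> z [^]\<^bsub>Q\<^esub> i) = \<zero>\<^bsub>Q\<^esub>"
    by (rule ICE)
  show "z \<in> R_tilde n I"
  proof (rule ccontr)
    assume "z \<notin> R_tilde n I"
    then obtain e :: nat and F where e: "e > 0" and F: "F \<in> carrier U" "up_ring.coeff U F 0 \<noteq> \<zero>\<^bsub>S\<^esub>"
      and zF: "emb (x [^]\<^bsub>R\<^esub> e) \<otimes>\<^bsub>Q\<^esub> z = frac F"
      by (rule pole_of_not_R_tilde[OF z])
    define t where "t = emb (x [^]\<^bsub>R\<^esub> e)"
    have t: "t \<in> carrier Q" by (simp add: t_def)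
    have bi: "b i \<in> carrier R" if "i < m" for i using b that by blast
    let ?c = "\<lambda>i. T e [^]\<^bsub>U\<^esub> (m - i) \<otimes>\<^bsub>U\<^esub> psi n I (b i) \<otimes>\<^bsub>U\<^esub> F [^]\<^bsub>U\<^esub> i"
    have cU: "?c \<in> {..<m} \<rightarrow> carrier U" using bi F(1) by auto
    have summand: "t [^]\<^bsub>Q\<^esub> m \<otimes>\<^bsub>Q\<^esub> (emb (b i) \<otimes>\<^bsub>Q\<^esub> z [^]\<^bsub>Q\<^esub> i) = frac (?c i)" if i: "i < m" for i
    proof -
      \<comment> \<open>Of the m factors t, exactly i meet z^i to form F^i; at least one is left
        because i < m.\<close>
      have "t [^]\<^bsub>Q\<^esub> m = t [^]\<^bsub>Q\<^esub> (m - i) \<otimes>\<^bsub>Q\<^esub> t [^]\<^bsub>Q\<^esub> i"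
        using i t by (simp add: Q.nat_pow_mult)
      then have "t [^]\<^bsub>Q\<^esub> m \<otimes>\<^bsub>Q\<^esub> (emb (b i) \<otimes>\<^bsub>Q\<^esub> z [^]\<^bsub>Q\<^esub> i) =
          t [^]\<^bsub>Q\<^esub> (m - i) \<otimes>\<^bsub>Q\<^esub> emb (b i) \<otimes>\<^bsub>Q\<^esub> (t [^]\<^bsub>Q\<^esub> i \<otimes>\<^bsub>Q\<^esub> z [^]\<^bsub>Q\<^esub> i)"
        using t z bi[OF i] by (simp add: Q.m_ac)
      also have "t [^]\<^bsub>Q\<^esub> i \<otimes>\<^bsub>Q\<^esub> z [^]\<^bsub>Q\<^esub> i = frac F [^]\<^bsub>Q\<^esub> i"
        using t z by (simp add: Q.nat_pow_distrib[symmetric] zF[folded t_def])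
      also have "t [^]\<^bsub>Q\<^esub> (m - i) \<otimes>\<^bsub>Q\<^esub> emb (b i) \<otimes>\<^bsub>Q\<^esub> frac F [^]\<^bsub>Q\<^esub> i = frac (?c i)"
        unfolding t_def frac_T[symmetric] frac_psi[OF bi[OF i], symmetric] using F(1) bi[OF i] by simp
      finally show ?thesis .
    qed
    have "t [^]\<^bsub>Q\<^esub> m \<otimes>\<^bsub>Q\<^esub> z [^]\<^bsub>Q\<^esub> m = frac (F [^]\<^bsub>U\<^esub> m)"
      using t z F(1) by (simp add: Q.nat_pow_distrib[symmetric] zF[folded t_def])
    moreover have "t [^]\<^bsub>Q\<^esub> m \<otimes>\<^bsub>Q\<^esub> (\<Oplus>\<^bsub>Q\<^esub>i\<in>{..<m}. emb (b i) \<otimes>\<^bsub>Q\<^esub> z [^]\<^bsub>Q\<^esub> i) = frac (\<Oplus>\<^bsub>U\<^esub>i\<in>{..<m}. ?c i)"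
    proof -
      have "t [^]\<^bsub>Q\<^esub> m \<otimes>\<^bsub>Q\<^esub> (\<Oplus>\<^bsub>Q\<^esub>i\<in>{..<m}. emb (b i) \<otimes>\<^bsub>Q\<^esub> z [^]\<^bsub>Q\<^esub> i) =
          (\<Oplus>\<^bsub>Q\<^esub>i\<in>{..<m}. t [^]\<^bsub>Q\<^esub> m \<otimes>\<^bsub>Q\<^esub> (emb (b i) \<otimes>\<^bsub>Q\<^esub> z [^]\<^bsub>Q\<^esub> i))"
        using t z bi by (intro Q.finsum_rdistr) auto
      also have "\<dots> = (\<Oplus>\<^bsub>Q\<^esub>i\<in>{..<m}. frac (?c i))"
        using cU by (intro Q.finsum_cong') (auto simp: summand)
      also have "\<dots> = frac (\<Oplus>\<^bsub>U\<^esub>i\<in>{..<m}. ?c i)"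
        using cU by (subst frac.hom_finsum) (auto simp: o_def)
      finally show ?thesis .
    qed
    moreover have sumQ: "(\<Oplus>\<^bsub>Q\<^esub>i\<in>{..<m}. emb (b i) \<otimes>\<^bsub>Q\<^esub> z [^]\<^bsub>Q\<^esub> i) \<in> carrier Q"
      using z bi by (intro Q.finsum_closed) auto
    moreover have sumU: "(\<Oplus>\<^bsub>U\<^esub>i\<in>{..<m}. ?c i) \<in> carrier U" by (rule U.P.finsum_closed[OF cU])
    ultimately have "frac (F [^]\<^bsub>U\<^esub> m \<oplus>\<^bsub>U\<^esub> (\<Oplus>\<^bsub>U\<^esub>i\<in>{..<m}. ?c i)) =
        t [^]\<^bsub>Q\<^esub> m \<otimes>\<^bsub>Q\<^esub> (z [^]\<^bsub>Q\<^esub> m \<oplus>\<^bsub>Q\<^esub> (\<Oplus>\<^bsub>Q\<^esub>i\<in>{..<m}. emb (b i) \<otimes>\<^bsub>Q\<^esub> z [^]\<^bsub>Q\<^esub> i))"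
      using t z F(1) by (simp add: Q.r_distr)
    also have "\<dots> = frac \<zero>\<^bsub>U\<^esub>" unfolding eq using t by simp
    finally have "F [^]\<^bsub>U\<^esub> m \<oplus>\<^bsub>U\<^esub> (\<Oplus>\<^bsub>U\<^esub>i\<in>{..<m}. ?c i) = \<zero>\<^bsub>U\<^esub>"
      by (rule inj_onD[OF frac_inj]) (use F(1) sumU in simp_all)
    then have "up_ring.coeff U (F [^]\<^bsub>U\<^esub> m) 0 \<oplus>\<^bsub>S\<^esub> up_ring.coeff U (\<Oplus>\<^bsub>U\<^esub>i\<in>{..<m}. ?c i) 0 = \<zero>\<^bsub>S\<^esub>"
      using U.coeff_add[of "F [^]\<^bsub>U\<^esub> m" "\<Oplus>\<^bsub>U\<^esub>i\<in>{..<m}. ?c i" 0] F(1) sumU by simp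
    moreover have "up_ring.coeff U (\<Oplus>\<^bsub>U\<^esub>i\<in>{..<m}. ?c i) 0 = \<zero>\<^bsub>S\<^esub>"
    proof -
      interpret ev: ring_hom_cring U S "\<lambda>F. up_ring.coeff U F 0" by (rule coeff0_hom)
      have "up_ring.coeff U (?c i) 0 = \<zero>\<^bsub>S\<^esub>" if "i < m" for i
      proof -
        have "up_ring.coeff U (T e [^]\<^bsub>U\<^esub> (m - i)) 0 = \<zero>\<^bsub>S\<^esub>"
          using ev.hom_pow[of "T e" "m - i"] e that by (simp add: S.nat_pow_zero)
        then show ?thesis
          using ev.hom_mult bi[OF that] F(1) by (simp del: U.coeff_mult add: U.coeff_closed)
      qed
      then have "(\<Oplus>\<^bsub>S\<^esub>i\<in>{..<m}. up_ring.coeff U (?c i) 0) = (\<Oplus>\<^bsub>S\<^esub>i\<in>{..<m}. \<zero>\<^bsub>S\<^esub>)"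
        by (intro S.finsum_cong') auto
      then show ?thesis using ev.hom_finsum[OF cU] by (simp add: o_def)
    qed
    moreover have "up_ring.coeff U (F [^]\<^bsub>U\<^esub> m) 0 = up_ring.coeff U F 0 [^]\<^bsub>S\<^esub> m"
      using ring_hom_cring.hom_pow[OF coeff0_hom F(1)] .
    ultimately have "up_ring.coeff U F 0 [^]\<^bsub>S\<^esub> m = \<zero>\<^bsub>S\<^esub>"
      using F(1) by (simp add: U.coeff_closed)
    then have "up_ring.coeff U F 0 = \<zero>\<^bsub>S\<^esub>"
      using red U.coeff_closed[OF F(1), of 0] unfolding reduced_ring_def by blast
    then show False using F(2) by contradiction
  qed
qed

text \<open>For nilpotent s the element s/x_0 is nilpotent, hence integral, whereas a polynomial F
  with F x_0 = s exists only for s = 0.\<close>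

lemma reduced_of_IC_subset_R_tilde:
  assumes sub: "IC \<subseteq> R_tilde n I"
  shows "reduced_ring S"
  unfolding reduced_ring_def
proof (intro ballI allI impI)
  fix s and k :: nat assume s: "s \<in> carrier S" "s [^]\<^bsub>S\<^esub> k = \<zero>\<^bsub>S\<^esub>"
  obtain a where a: "a \<in> part k0" "s = dh a" using dh_surj_part[OF order_refl s(1)] by metis
  note [simp] = part_closed[OF a(1)]
  \<comment> \<open>As a / x_0^{k0} is the constant polynomial s, this fraction is s/x_0, of degree
    -1.\<close>
  define z where "z = fr a (x [^]\<^bsub>R\<^esub> Suc k0)"
  have z: "z \<in> carrier Q" unfolding z_def by (rule hfrac_closed[OF _ x0_pow_nzd]) simp
  have "emb x \<otimes>\<^bsub>Q\<^esub> z = fr a (x [^]\<^bsub>R\<^esub> k0)"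
    using x0_pow_nzd[of "Suc k0"] x0_pow_nzd[of k0] unfolding z_def
    by (simp add: hquot_embed_def hfrac_mult hfrac_eq_iff one_nzd nzd_mult R.m_ac del: R.nat_pow_Suc)
  also have "\<dots> = frac (up_ring.monom U s 0)"
    unfolding a(2) frac_monom[OF a(1)] by simp
  finally have xz: "emb x \<otimes>\<^bsub>Q\<^esub> z = frac (up_ring.monom U s 0)" .
  have ms: "up_ring.monom U s 0 \<in> carrier U" using s(1) by simp
  have "up_ring.monom U s 0 [^]\<^bsub>U\<^esub> k = \<zero>\<^bsub>U\<^esub>"
    using U.monom_pow[OF s(1), of 0 k] s(2) by simp
  then have "(emb x \<otimes>\<^bsub>Q\<^esub> z) [^]\<^bsub>Q\<^esub> k = \<zero>\<^bsub>Q\<^esub>"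
    unfolding xz using frac.hom_pow[OF ms, of k] by simp
  then have "emb (x [^]\<^bsub>R\<^esub> k) \<otimes>\<^bsub>Q\<^esub> z [^]\<^bsub>Q\<^esub> k = emb (x [^]\<^bsub>R\<^esub> k) \<otimes>\<^bsub>Q\<^esub> \<zero>\<^bsub>Q\<^esub>"
    using z by (simp add: Q.nat_pow_distrib)
  then have "z [^]\<^bsub>Q\<^esub> k = \<zero>\<^bsub>Q\<^esub>"
    by (rule emb_cancel[OF x0_pow_nzd, rotated 2]) (simp_all add: z)
  \<comment> \<open>The integral equation is z^k = 0, with all lower coefficients zero.\<close>
  then have "z \<in> IC"
    using z by (intro ICI[of z "\<lambda>_. \<zero>\<^bsub>R\<^esub>" k]) simp_all
  then obtain F where F: "F \<in> carrier U" "z = frac F" using sub unfolding R_tilde_eq by blast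
  have "frac (F \<otimes>\<^bsub>U\<^esub> T 1) = frac F \<otimes>\<^bsub>Q\<^esub> emb (x [^]\<^bsub>R\<^esub> (1::nat))"
    unfolding frac_T[symmetric] using F(1) by (intro frac.hom_mult) simp_all
  also have "\<dots> = frac (up_ring.monom U s 0)"
    unfolding xz[symmetric] F(2) using F(1) by (simp add: Q.m_comm)
  finally have "F \<otimes>\<^bsub>U\<^esub> T 1 = up_ring.monom U s 0"
    by (rule inj_onD[OF frac_inj]) (use F(1) ms in simp_all)
  then have "up_ring.coeff U (up_ring.monom U s 0) 0 = \<zero>\<^bsub>S\<^esub>"
    using coeff_mult_T_below[OF F(1), of 0 1] by simp
  then show "s = \<zero>\<^bsub>S\<^esub>" using U.coeff_monom[OF s(1), of 0 0] by simp
qed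

lemma R_tilde_eq_IC_iff: "R_tilde n I = IC \<longleftrightarrow> reduced_ring S"
  using R_tilde_integral IC_subset_R_tilde reduced_of_IC_subset_R_tilde by blast

end

theorem proposition2p6:
  fixes n :: nat and I :: "'k::field mpoly set"
  assumes "perfect_field TYPE('k)"
    and "n \<ge> 1"
    and "homogeneous_ideal n I"
    and "saturated n I"
    and "scheme_has_dim n I 0"
    and "\<forall>p\<in>scheme_points n I. Var 0 \<notin> p"
  shows
    \<comment> \<open>(a)\<close>
    "((\<forall>d. \<forall>f\<in>coord_part n I d. psi n I f = up_ring.monom (Sx0 n I) (deh n I f) d) \<and>
      graded_algebra_hom (Kx0 TYPE('k))
        (coord_ring n I) (coord_struct n I) (coord_part n I)
        (Sx0 n I) (Sx0_struct n I) (Sx0_part n I) (psi n I) \<and>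
      inj_on (psi n I) (carrier (coord_ring n I)))
     \<and> \<comment> \<open>(b)\<close>
     (\<forall>i\<ge>reg_index n I. vector_space_iso
        (coord_ring n I) (coord_const n I) (coord_part n I i)
        (Sx0 n I) (Sx0_const n I) (Sx0_part n I i) (psi n I))
     \<and> \<comment> \<open>(c)\<close>
     ((\<exists>h. h \<in> ring_iso (R_tilde_ring n I) (Sx0 n I) \<and>
        graded_algebra_hom (Kx0 TYPE('k))
          (R_tilde_ring n I) (R_tilde_struct n I) (R_tilde_part n I)
          (Sx0 n I) (Sx0_struct n I) (Sx0_part n I) h) \<and>
      R_tilde n I \<subseteq>
        integral_closure (hquot_ring n I) (hquot_embed n I ` carrier (coord_ring n I)))
     \<and> \<comment> \<open>(d)\<close>
     (R_tilde n I =
        integral_closure (hquot_ring n I) (hquot_embed n I ` carrier (coord_ring n I)) \<longleftrightarrow>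
      reduced_ring (deh_ring n I))"
proof -
  \<comment> \<open>Dimension 0 supplies a chain of length 0, that is, a point.\<close>
  have "scheme_points n I \<noteq> {}"
    using assms(5) unfolding scheme_has_dim_def point_chain_def by blast
  then interpret zero_dim_scheme n I
    using assms(3,4,6) by unfold_locales auto
  show ?thesis
    using psi_of_part psi_graded_algebra_hom psi_inj psi_vector_space_iso R_tilde_iso
      R_tilde_integral R_tilde_eq_IC_iff
    by (intro conjI allI ballI impI)
qed

end
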